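(* Suppose that $\mathbb{P}$ is admissible. Then there exists $C<\infty$ such that for all $T>0$, $$\mathbb{E}\Big[\mathrm{E}^\omega_{0,0}\Big[\sup_{0\le t\le T}|X_t|\Big]\Big]\le C\sqrt{T}.$$ In particular, for any $t>0$, the family $\{X^{(n)}_t:n\in\mathbb{N}\}$, where $X^{(n)}_t=\frac1n X_{tn^2}$, is tight under the annealed measure $\mathbb{P}^*_{0,0}[\,\cdot\,]=\mathbb{E}\big[\mathrm{P}^\omega_{0,0}[\,\cdot\,]\big]$.
   Context: Setting. Let $d\ge 1$, let $|\cdot|$ be the graph distance on $\mathbb{Z}^d$ (the $\ell^1$-distance), $E_d=\{(x,y):x,y\in\mathbb{Z}^d,\ |x-y|=1\}$ (oriented nearest-neighbour bonds), and write $x\sim y$ if $(x,y)\in E_d$. Let $\Omega=(0,\infty)^{\mathbb{R}\times E_d}$ with Borel $\sigma$-algebra $\mathcal{F}$; its elements are families $\omega=\{\omega_t(e): e\in E_d, t\in\mathbb{R}\}$ of time-dependent conductances, and $\omega_t(x,y)=0$ if $(x,y)\notin E_d$. Time-space shifts: $(\tau_{s,z}\omega)_t(x,y)=\omega_{t+s}(x+z,y+z)$ for $(s,z)\in\mathbb{R}\times\mathbb{Z}^d$. A probability measure $\mathbb{P}$ on $(\Omega,\mathcal{F})$ (expectation $\mathbb{E}$) is called admissible if: (i) $\mathbb{P}$ is stationary and ergodic with respect to the time-space shifts $\{\tau_{s,z}\}$; (ii) $\mathbb{P}[\omega_t(x,y)=\omega_t(y,x)\ \forall t\in\mathbb{R}]=1$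 for all $(x,y)\in E_d$; (iii) $\mathbb{E}[\omega_t(e)]<\infty$ for all $e\in E_d$, $t\in\mathbb{R}$; (iv) for every $A\in\mathcal{F}$ the map $(\omega,t,x)\mapsto \mathbf 1_A(\tau_{t,x}\omega)$ is jointly measurable with respect to $\mathcal{F}\otimes\mathcal{B}(\mathbb{R})\otimes\mathcal{P}(\mathbb{Z}^d)$. Process. For fixed $\omega$, $X=(X_t)_{t\ge s}$ under $\mathrm{P}^\omega_{s,x}$ (expectation $\mathrm{E}^\omega_{s,x}$) is the time-inhomogeneous continuous-time Markov chain (variable speed random walk) started at time $s$ in $x\in\mathbb{Z}^d$ with time-dependent generator $(\mathcal{L}^\omega_t f)(x)=\sum_{y\sim x}\omega_t(x,y)(f(y)-f(x))$: if it arrives in $z$ at time $r$, its next jump time $J$ satisfies $\mathrm{P}(J>t)=\exp(-\int_r^t\mu^\omega_u(z)\,du)$, where $\mu^\omega_u(z)=\sum_{y\sim z}\omega_u(z,y)$, and given $J$ it jumps to $y$ with probability $\omega_J(z,y)/\mu^\omega_J(z)$. For admissible $\mathbb{P}$, for $\mathbb{P}$-a.e. $\omega$ the rates are locally integrable in time and the process does not explode. *)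

theory Defs
  imports "HOL-Probability.Probability"
begin

section \<open>The lattice\<close>

type_synonym 'd site = "int ^ 'd"

definition graph_norm :: "'d::finite site \<Rightarrow> int" where
  "graph_norm x = (\<Sum>i\<in>UNIV. \<bar>x $ i\<bar>)"

definition edges :: "('d::finite site \<times> 'd site) set" where
  "edges = {(x, y). graph_norm (x - y) = 1}"

section \<open>Time-dependent random environments\<close>

type_synonym 'd env = "real \<Rightarrow> 'd site \<times> 'd site \<Rightarrow> real"

text \<open>
  The space \<open>(0,\<infinity>)\<^bsup>\<real> \<times> E\<^esup>\<close>, where \<open>E\<close> is the set of oriented bonds: environments are
  extended by \<open>0\<close> off \<open>E\<close>, and the \<open>\<sigma>\<close>-algebra is the Borel \<open>\<sigma>\<close>-algebra of the product
  topology (\<open>borel\<close> refers to the topology of pointwise convergence on functions).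
\<close>

definition env_space :: "'d::finite env measure" where
  "env_space = restrict_space borel
     {\<omega>. \<forall>t e. if e \<in> edges then 0 < \<omega> t e else \<omega> t e = 0}"

definition env_shift :: "real \<Rightarrow> 'd::finite site \<Rightarrow> 'd env \<Rightarrow> 'd env" where
  "env_shift s z \<omega> = (\<lambda>t (x, y). \<omega> (t + s) (x + z, y + z))"

definition stationary :: "'d::finite env measure \<Rightarrow> bool" where
  "stationary P \<longleftrightarrow> (\<forall>s z. distr P P (env_shift s z) = P)"

definition ergodic :: "'d::finite env measure \<Rightarrow> bool" where
  "ergodic P \<longleftrightarrow>
     (\<forall>A\<in>sets P. (\<forall>s z. env_shift s z -` A \<inter> space P = A)
        \<longrightarrow> measure P A = 0 \<or> measure P A = 1)"

text \<open>
  Joint measurability of \<open>(\<omega>, t, x) \<mapsto> 1\<^sub>A(\<tau>\<^sub>t\<^sub>,\<^sub>x \<omega>)\<close> is required outside a \<open>P\<close>-null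
  set of environments.  It cannot be required with \<open>N = {}\<close>: for \<open>A = {\<omega>. \<omega>\<^sub>0(e) > 1}\<close> a set in a
  product \<open>\<sigma>\<close>-algebra has at most continuum many distinct sections \<open>{t. \<omega>\<^sub>t(e) > 1}\<close>, whereas
  all \<open>2\<^bsup>|\<real>|\<^esup>\<close> subsets of \<open>\<real>\<close> occur as \<open>\<omega>\<close> ranges over the full product space.  The
  condition with \<open>N = {}\<close> implies this one.
\<close>

definition shifts_measurable :: "'d::finite env measure \<Rightarrow> bool" where
  "shifts_measurable P \<longleftrightarrow>
     (\<forall>A\<in>sets P. \<exists>N\<in>null_sets P.
        (\<lambda>(\<omega>, t, x). indicator A (env_shift t x \<omega>) :: real) \<in> borel_measurable
          (restrict_space P (space P - N) \<Otimes>\<^sub>M (borel \<Otimes>\<^sub>M count_space UNIV)))"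

definition admissible :: "'d::finite env measure \<Rightarrow> bool" where
  "admissible P \<longleftrightarrow>
     prob_space P \<and> sets P = sets env_space \<and>
     stationary P \<and> ergodic P \<and>
     (\<forall>(x, y)\<in>edges. AE \<omega> in P. \<forall>t. \<omega> t (x, y) = \<omega> t (y, x)) \<and>
     (\<forall>e\<in>edges. \<forall>t. integrable P (\<lambda>\<omega>. \<omega> t e)) \<and>
     shifts_measurable P"

section \<open>The variable speed random walk\<close>

definition total_rate :: "'d::finite env \<Rightarrow> real \<Rightarrow> 'd site \<Rightarrow> real" where
  "total_rate \<omega> u z = (\<Sum>y\<in>{y. (z, y) \<in> edges}. \<omega> u (z, y))"

text \<open>
  The law of the next jump time after an arrival in \<open>z\<close> at time \<open>r\<close>.  It lives on the extended
  reals, since it has an atom at \<open>\<infinity>\<close> when the total rate is integrable on \<open>[r,\<infinity>)\<close>.  It is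
  well-defined for locally integrable rates, see \<open>ex1_hold_law\<close> below.
\<close>

definition is_hold_law :: "'d::finite env \<Rightarrow> real \<Rightarrow> 'd site \<Rightarrow> ereal measure \<Rightarrow> bool" where
  "is_hold_law \<omega> r z N \<longleftrightarrow>
     prob_space N \<and> sets N = sets borel \<and>
     (\<forall>t\<ge>r. measure N {ereal t<..} = exp (- (LBINT u:{r..t}. total_rate \<omega> u z)))"

definition hold_law :: "'d::finite env \<Rightarrow> real \<Rightarrow> 'd site \<Rightarrow> ereal measure" where
  "hold_law \<omega> r z = (THE N. is_hold_law \<omega> r z N)"

definition jump_pmf :: "'d::finite env \<Rightarrow> real \<Rightarrow> 'd site \<Rightarrow> 'd site pmf" where
  "jump_pmf \<omega> j z = embed_pmf (\<lambda>y. \<omega> j (z, y) / total_rate \<omega> j z)"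

text \<open>
  The walk is encoded by the sequence \<open>(J\<^sub>n, Z\<^sub>n)\<close> of its arrival times and the sites it
  arrives in, which is a Markov chain; \<open>J\<^sub>n = \<infinity>\<close> from some \<open>n\<close> on if the walk jumps only finitely
  often, and then the site is frozen.
\<close>

type_synonym 'd walk = "nat \<Rightarrow> ereal \<times> 'd site"

definition state_space :: "(ereal \<times> 'd::finite site) measure" where
  "state_space = borel \<Otimes>\<^sub>M count_space UNIV"

definition jump_kernel ::
  "'d::finite env \<Rightarrow> ereal \<times> 'd site \<Rightarrow> (ereal \<times> 'd site) measure" where
  "jump_kernel \<omega> = (\<lambda>(r, z).
     if r = \<infinity> then return state_space (\<infinity>, z)
     else hold_law \<omega> (real_of_ereal r) z \<bind> (\<lambda>j.
       if j = \<infinity> then return state_space (\<infinity>, z)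
       else distr (measure_pmf (jump_pmf \<omega> (real_of_ereal j) z)) state_space (\<lambda>y. (j, y))))"

definition step_kernel ::
  "'d::finite env \<Rightarrow> real \<Rightarrow> 'd site \<Rightarrow> nat \<Rightarrow> 'd walk \<Rightarrow> (ereal \<times> 'd site) measure" where
  "step_kernel \<omega> s x n h =
     (if n = 0 then return state_space (ereal s, x) else jump_kernel \<omega> (h (n - 1)))"

text \<open>The quenched law: the Ionescu-Tulcea measure on trajectories of the chain.\<close>

definition walk_law :: "'d::finite env \<Rightarrow> real \<Rightarrow> 'd site \<Rightarrow> 'd walk measure" where
  "walk_law \<omega> s x = projective_family.lim UNIV
     (Ionescu_Tulcea.CI (step_kernel \<omega> s x) (\<lambda>_. state_space)) (\<lambda>_. state_space)"

text \<open>The position at time \<open>t\<close>; meaningful from the starting time on and up to explosion.\<close>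

definition position :: "real \<Rightarrow> 'd walk \<Rightarrow> 'd site" where
  "position t w = snd (w (LEAST n. ereal t < fst (w (Suc n))))"

definition max_displacement :: "real \<Rightarrow> 'd::finite walk \<Rightarrow> ennreal" where
  "max_displacement T w =
     (SUP t\<in>{0..T}. ennreal (real_of_int (graph_norm (position t w))))"

definition rescaled :: "nat \<Rightarrow> real \<Rightarrow> 'd::finite walk \<Rightarrow> real ^ 'd" where
  "rescaled n t w = (\<chi> i. real_of_int (position (t * (real n)\<^sup>2) w $ i) / real n)"

section \<open>Annealed measure and tightness\<close>

definition annealed ::
  "'d::finite env measure \<Rightarrow> real \<Rightarrow> 'd site \<Rightarrow> 'd walk set \<Rightarrow> ennreal" where
  "annealed P s x A = (\<integral>\<^sup>+ \<omega>. emeasure (walk_law \<omega> s x) A \<partial>P)"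

text \<open>Tightness of \<open>(Y\<^sub>i)\<^sub>i\<^sub>\<in>\<^sub>I\<close> under a probability \<open>Q\<close> given as a set function.\<close>

definition tight_family ::
  "('w set \<Rightarrow> ennreal) \<Rightarrow> ('i \<Rightarrow> 'w \<Rightarrow> 'a::topological_space) \<Rightarrow> 'i set \<Rightarrow> bool" where
  "tight_family Q Y I \<longleftrightarrow>
     (\<forall>\<epsilon>>0. \<exists>K. compact K \<and> (\<forall>i\<in>I. ennreal (1 - \<epsilon>) \<le> Q {w. Y i w \<in> K}))"

section \<open>Well-definedness of the holding time law\<close>

lemma ex1_hold_law:
  fixes \<omega> :: "'d::finite env"
  assumes int: "\<And>t. set_integrable lborel {r..t} (\<lambda>u. total_rate \<omega> u z)"
    and nonneg: "\<And>u. 0 \<le> total_rate \<omega> u z"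
  shows "\<exists>!N. is_hold_law \<omega> r z N"
proof
  define f where "f = (\<lambda>u. total_rate \<omega> u z)"
  define H where "H = (\<lambda>t. LBINT u:{r..t}. f u)"
  have int: "set_integrable lborel {r..t} f" for t
    using int unfolding f_def by simp
  have fon: "f integrable_on {r..t}" for t
    using set_borel_integral_eq_integral(1)[OF int] .
  have HK: "H t = integral {r..t} f" for t
    unfolding H_def using set_borel_integral_eq_integral(2)[OF int] .
  have cont: "continuous_on {r..b} H" for b
    unfolding HK by (rule indefinite_integral_continuous_1[OF fon])
  have mono: "H s \<le> H t" if "r \<le> s" "s \<le> t" for s t
    unfolding HK using that nonneg
    by (intro integral_subset_le fon) (auto simp: f_def)
  have H_nonneg: "0 \<le> H t" for t
    unfolding HK using nonneg by (intro integral_nonneg fon) (auto simp: f_def)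
  define J where "J = (\<lambda>\<xi>. Inf {ereal t | t. r \<le> t \<and> \<xi> \<le> H t})"
  define N where "N = distr (density lborel (exponential_density 1)) borel J"
  have J_iff: "ereal t < J \<xi> \<longleftrightarrow> H t < \<xi>" if t: "r \<le> t" for t \<xi>
  proof
    assume "ereal t < J \<xi>"
    then show "H t < \<xi>"
      using t unfolding J_def by (metis (mono_tags, lifting) Inf_lower linorder_not_le mem_Collect_eq)
  next
    assume less: "H t < \<xi>"
    have "continuous (at t within {r..t+1}) H"
      using cont[of "t+1"] t by (simp add: continuous_on_eq_continuous_within)
    then have "eventually (\<lambda>u. H u < \<xi>) (at t within {r..t+1})"
      using less by (simp add: continuous_within order_tendsto_iff)
    then obtain d where d: "d > 0" "\<And>u. u \<in> {r..t+1} \<Longrightarrow> u \<noteq> t \<Longrightarrow> dist u t < d \<Longrightarrow> H u < \<xi>"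
      unfolding eventually_at by blast
    define u where "u = t + min (d/2) 1"
    have u: "t < u" "u \<in> {r..t+1}" "dist u t < d" using d(1) t by (auto simp: u_def dist_real_def)
    then have "H u < \<xi>" using d(2) by auto
    then have "u \<le> v" if "r \<le> v" "\<xi> \<le> H v" for v
      using that mono[of v u] by (meson le_cases not_le order_trans)
    then have "ereal u \<le> J \<xi>"
      unfolding J_def by (intro Inf_greatest) auto
    then show "ereal t < J \<xi>" using u(1) by (meson ereal_less_le less_ereal.simps(1) less_le_trans)
  qed
  have J_ge: "ereal r \<le> J \<xi>" for \<xi>
    unfolding J_def by (intro Inf_greatest) auto
  have [measurable]: "J \<in> borel_measurable borel"
  proof (rule borel_measurableI_greater)
    fix a
    consider "a = \<infinity>" | "a < ereal r" | t where "a = ereal t" "r \<le> t"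
      by (cases a) (auto simp: not_less[symmetric])
    then show "{\<xi> \<in> space borel. a < J \<xi>} \<in> sets borel"
    proof cases
      case 2
      then have "{\<xi> \<in> space borel. a < J \<xi>} = UNIV"
        using J_ge less_le_trans by auto
      then show ?thesis by simp
    qed (auto simp: J_iff)
  qed
  interpret E: prob_space "density lborel (exponential_density 1)"
    by (rule prob_space_exponential_density) simp
  have surv: "measure N {ereal t<..} = exp (- H t)" if "r \<le> t" for t
  proof -
    have "measure N {ereal t<..} = measure (density lborel (exponential_density 1)) {\<xi>. H t < \<xi>}"
      unfolding N_def using that
      by (subst measure_distr) (auto simp: J_iff vimage_def)
    also have "\<dots> = exp (- H t)"
    proof -
      have "distributed (density lborel (exponential_density 1)) lborel (\<lambda>x. x) (exponential_density 1)"
        unfolding distributed_def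
        using distr_id2[of lborel "density lborel (exponential_density 1)"] by (auto simp: exponential_density_def)
      from E.exponential_distributedD_gt[OF this H_nonneg[of t]] show ?thesis by simp
    qed
    finally show ?thesis .
  qed
  show "is_hold_law \<omega> r z N"
    unfolding is_hold_law_def
    using surv E.prob_space_distr[of J borel] unfolding N_def H_def f_def by auto
  have uniq: "M = M'" if M: "is_hold_law \<omega> r z M" and M': "is_hold_law \<omega> r z M'" for M M'
  proof -
    have *: "emeasure L {a<..} = (if a = \<infinity> then 0 else if a < ereal r then 1
               else ennreal (exp (- H (real_of_ereal a))))" if L: "is_hold_law \<omega> r z L" for L a
    proof -
      interpret L: prob_space L using L by (simp add: is_hold_law_def)
      have [measurable_cong]: "sets L = sets borel" using L by (simp add: is_hold_law_def)
      have s: "measure L {ereal t<..} = exp (- H t)" if "r \<le> t" for t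
        using L that by (simp add: is_hold_law_def H_def f_def)
      consider "a = \<infinity>" | "a < ereal r" | t where "a = ereal t" "r \<le> t"
        by (cases a) (auto simp: not_less[symmetric])
      then show ?thesis
      proof cases
        case 2
        have "H r = 0" unfolding HK by simp
        then have "1 = measure L {ereal r<..}" using s[of r] by simp
        also have "\<dots> \<le> measure L {a<..}" using 2 by (intro L.finite_measure_mono) auto
        finally have "measure L {a<..} = 1" using L.prob_le_1 antisym by blast
        then show ?thesis using 2 by (auto simp: L.emeasure_eq_measure)
      next
        case 1
        then have "{a<..} = {}" by auto
        then show ?thesis using 1 by simp
      qed (auto simp: L.emeasure_eq_measure s)
    qed
    interpret M: prob_space M using M by (simp add: is_hold_law_def)
    have sg: "sets L = sigma_sets UNIV (range (\<lambda>a. {a<..}))" if "is_hold_law \<omega> r z L" for L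
      using that by (simp add: is_hold_law_def borel_Ioi)
    show "M = M'"
    proof (rule measure_eqI_generator_eq_countable[of "insert UNIV (range (\<lambda>a::ereal. {a<..}))" UNIV M M' "{UNIV}"])
      have "{a<..} \<inter> {b<..} = {max a b<..}" for a b :: ereal by auto
      then show "Int_stable (insert UNIV (range (\<lambda>a::ereal. {a<..})))"
        by (auto simp: Int_stable_def)
      have ins: "sigma_sets UNIV (insert UNIV (range (\<lambda>a::ereal. {a<..})))
          = sigma_sets UNIV (range (\<lambda>a. {a<..}))"
        by (intro sigma_sets_eqI) (auto intro: sigma_sets_top)
      show "sets M = sigma_sets UNIV (insert UNIV (range (\<lambda>a::ereal. {a<..})))"
        "sets M' = sigma_sets UNIV (insert UNIV (range (\<lambda>a::ereal. {a<..})))"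
        unfolding ins using sg M M' by auto
      have "space L = UNIV \<and> prob_space L" if "is_hold_law \<omega> r z L" for L
        using that sets_eq_imp_space_eq[of L borel] by (simp add: is_hold_law_def)
      then have "emeasure M UNIV = 1" "emeasure M' UNIV = 1"
        using M M' prob_space.emeasure_space_1 by metis+
      then show "emeasure M X = emeasure M' X" if "X \<in> insert UNIV (range (\<lambda>a::ereal. {a<..}))" for X
        using that *[OF M] *[OF M'] by auto
      show "emeasure M a \<noteq> \<infinity>" for a by simp
    qed auto
  qed
  show "M = N" if "is_hold_law \<omega> r z M" for M
    by (rule uniq[OF that \<open>is_hold_law \<omega> r z N\<close>])
qed

section \<open>Admissibility is satisfiable\<close>

lemma space_env_space: "space (env_space::'d::finite env measure) = {\<omega>. \<forall>t e. if e \<in> edges then 0 < \<omega> t e else \<omega> t e = 0}"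
  by (simp add: env_space_def space_restrict_space)

lemma continuous_on_eval_env: "continuous_on UNIV (\<lambda>\<omega>::'d::finite env. \<omega> t e)"
  by (rule continuous_on_product_then_coordinatewise[OF continuous_on_product_then_coordinatewise]) (rule continuous_on_id)

lemma measurable_eval_env: "(\<lambda>\<omega>. \<omega> t e) \<in> borel_measurable (env_space::'d::finite env measure)"
  unfolding env_space_def
  by (intro measurable_restrict_space1 borel_measurable_continuous_onI continuous_on_eval_env)

lemma measurable_env_shift: "env_shift s z \<in> measurable env_space (env_space::'d::finite env measure)"
proof -
  have "continuous_on UNIV (env_shift s z :: 'd env \<Rightarrow> 'd env)"
    unfolding env_shift_def
    apply (intro continuous_on_coordinatewise_then_product)
    apply (simp add: case_prod_unfold)
    apply (rule continuous_on_product_then_coordinatewise[OF continuous_on_product_then_coordinatewise])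
    by (rule continuous_on_id)
  then have "env_shift s z \<in> borel_measurable (borel :: 'd env measure)" by (rule borel_measurable_continuous_onI)
  then show ?thesis unfolding env_space_def
    by (intro measurable_restrict_space3) (auto simp: env_shift_def edges_def)
qed

lemma admissible_unit_conductances:
  "admissible (return env_space (\<lambda>t e. indicator edges e) :: 'd::finite env measure)"
proof -
  let ?c = "(\<lambda>t e. indicator edges e) :: 'd env"
  let ?P = "return env_space ?c"
  have c: "?c \<in> space env_space" by (auto simp: space_env_space)
  have sh: "env_shift s z ?c = ?c" for s z
    by (auto simp: env_shift_def edges_def fun_eq_iff indicator_def)
  interpret prob_space ?P using c by (rule prob_space_return)
  have "{?c} = (\<Inter>t e. {\<omega>. \<omega> t e = ?c t e})" by auto (auto simp: fun_eq_iff)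
  moreover have "closed (\<Inter>t e. {\<omega>::'d env. \<omega> t e = ?c t e})"
    by (intro closed_INT ballI closed_Collect_eq continuous_on_eval_env continuous_on_const)
  ultimately have "closed {?c}" by simp
  then have "{?c} \<in> sets env_space" using c unfolding env_space_def
    by (auto simp: sets_restrict_space space_restrict_space intro!: image_eqI[of _ _ "{?c}"])
  then have N: "space ?P - {?c} \<in> null_sets ?P" using c by (auto simp: null_sets_def emeasure_return)
  have sm: "shifts_measurable ?P" unfolding shifts_measurable_def
  proof safe
    fix A assume "A \<in> sets ?P"
    have "(\<lambda>(\<omega>, t, x). indicator A (env_shift t x \<omega>) :: real) \<in> borel_measurable
          (restrict_space ?P (space ?P - (space ?P - {?c})) \<Otimes>\<^sub>M ((borel::real measure) \<Otimes>\<^sub>M count_space UNIV))"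
      by (subst measurable_cong[of _ _ "\<lambda>_. indicator A ?c"])
         (auto simp: space_pair_measure space_restrict_space sh)
    then show "\<exists>N\<in>null_sets ?P. (\<lambda>(\<omega>, t, x). indicator A (env_shift t x \<omega>) :: real) \<in> borel_measurable
          (restrict_space ?P (space ?P - N) \<Otimes>\<^sub>M (borel \<Otimes>\<^sub>M count_space UNIV))" using N by blast
  qed
  have m: "env_shift s z \<in> measurable ?P ?P" for s z using measurable_env_shift by simp
  have st: "stationary ?P" unfolding stationary_def
  proof (intro allI measure_eqI)
    fix s z A assume "A \<in> sets (distr ?P ?P (env_shift s z))"
    then have A: "A \<in> sets ?P" by simp
    have "env_shift s z -` A \<inter> space ?P \<in> sets ?P" by (rule measurable_sets[OF m A])
    then show "emeasure (distr ?P ?P (env_shift s z)) A = emeasure ?P A"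
      using A c by (subst emeasure_distr[OF m A]) (simp add: emeasure_return indicator_def[of "_ :: 'd env set"] sh)
  qed simp
  have er: "ergodic ?P" unfolding ergodic_def by (auto simp: measure_return indicator_def)
  have symm: "((x,y)\<in>edges) = ((y,x)\<in>edges)" for x y :: "'d site"
    unfolding edges_def graph_norm_def by (simp add: abs_minus_commute)
  have AEs: "AE \<omega> in ?P. \<forall>t. \<omega> t (x, y) = \<omega> t (y, x)" for x y
    using AE_not_in[OF N] AE_space by eventually_elim (auto simp: indicator_def symm)
  have "integrable ?P (\<lambda>\<omega>. \<omega> t e)" for t e
  proof (rule integrable_const_bound[of _ 1])
    show "AE \<omega> in ?P. norm (\<omega> t e) \<le> 1"
      using AE_not_in[OF N] AE_space by eventually_elim (auto simp: indicator_def)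
  qed (use measurable_eval_env[of t e] in simp)
  then show ?thesis unfolding admissible_def using st er sm AEs prob_space_axioms by auto
qed

end

theory Submission
  imports Defs
begin

text \<open>
  For a finite set \<open>B\<close> of sites let \<open>u(s, x)\<close> be the quenched probability that the walk which is in \<open>x\<close> at
  time \<open>s\<close> leaves \<open>B\<close> by time \<open>T\<close>.  In \<open>B\<close> it solves the backward equation \<open>\<partial>\<^sub>s u + L\<^sub>s u = 0\<close> with \<open>u = 0\<close> at
  time \<open>T\<close>, and \<open>u = 1\<close> off \<open>B\<close>.  Since the conductances are symmetric, testing the equation with \<open>\<eta>\<^sup>2 sqrt u\<close>
  for a cutoff function \<open>\<eta>\<close> supported in \<open>B\<close> gives a Caccioppoli inequality.  Because \<open>u \<le> 1\<close>, it reads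
    \<open>\<Sum>\<^sub>x \<eta>(x)\<^sup>2 u(0, x)\<^bsup>3/2\<^esup> \<le> 3/2 \<integral>\<^sub>0\<^sup>T \<Sum>\<^sub>x\<^sub>,\<^sub>y \<omega>\<^sub>s(x, y) (\<eta>(x) - \<eta>(y))\<^sup>2 ds\<close>
  (\<open>exit_prob_energy_estimate\<close>).  The right hand side is linear in the conductances, and this is why
  first moments suffice.

  For a cube of radius of order \<open>k\<close> and a linear cutoff, the expectation of the right hand side is at most
  \<open>C T k\<^bsup>d-2\<^esup>\<close>, while the left hand side dominates a sum over \<open>c k\<^sup>d\<close> starting points of \<open>3/2\<close>-th powers of
  probabilities to move by \<open>k\<close>.  By stationarity these all have the same expectation, so
    \<open>E[P\<^sup>\<omega>(sup\<^bsub>t\<le>T\<^esub> \<bar>X\<^sub>t\<bar> \<ge> k)\<^bsup>3/2\<^esup>] \<le> C T / k\<^sup>2\<close>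
  (\<open>annealed_exit_energy\<close>).  Young's inequality turns this into the annealed tail bound
  \<open>C (sqrt T / k)\<^bsup>4/3\<^esup>\<close>, which is summable over \<open>k\<close> with a sum of order \<open>sqrt T\<close> (\<open>annealed_exit_prob\<close>,
  \<open>sum_decay_le\<close>).  This is the reason for the exponent \<open>3/2\<close>: the exponent must exceed \<open>1\<close> for the energy to
  dissipate and stay below \<open>2\<close> for the tail to be summable.  The bound is a function of \<open>sqrt T / k\<close>, and
  tightness follows.

  Two points need care.  The conductances are only measurable in time, so \<open>u\<close> is absolutely continuous and
  the energy argument rests on a chain rule for such functions (\<open>primitive_on_compose\<close>).  And \<open>u\<close> is
  approximated from below by exit probabilities within \<open>n\<close> jumps, which are given by explicit iterated
  integrals (\<open>exit_prob\<close>).  They are measurable in the environment, they increase in \<open>n\<close> and hence are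
  subsolutions of the backward equation, and they dominate the probabilities of the walk, which is defined
  as a chain of arrivals (\<open>emeasure_walk_exit_le\<close>).
\<close>

section \<open>Calculus of indefinite Lebesgue integrals\<close>

lemma LBINT_combine:
  fixes f :: "real \<Rightarrow> real"
  assumes f: "set_integrable lborel {a..c} f" and abc: "a \<le> b" "b \<le> c"
  shows "(LBINT x:{a..c}. f x) = (LBINT x:{a..b}. f x) + (LBINT x:{b..c}. f x)"
proof -
  have sub: "set_integrable lborel {a..b} f" "set_integrable lborel {b..c} f"
    using abc by (auto intro: set_integrable_subset[OF f])
  have "integral {a..b} f + integral {b..c} f = integral {a..c} f"
    using abc set_borel_integral_eq_integral(1)[OF f]
    by (intro Henstock_Kurzweil_Integration.integral_combine)
  then show ?thesis
    using set_borel_integral_eq_integral(2)[OF f] set_borel_integral_eq_integral(2)[OF sub(1)]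
      set_borel_integral_eq_integral(2)[OF sub(2)] by simp
qed

lemma set_integrable_cont_mult:
  fixes f g :: "real \<Rightarrow> real"
  assumes f: "set_integrable lborel {a..b} f" and g: "continuous_on {a..b} g"
  shows "set_integrable lborel {a..b} (\<lambda>t. g t * f t)"
proof -
  have "bounded (g ` {a..b})"
    by (intro compact_imp_bounded compact_continuous_image g) auto
  then obtain M where M: "\<And>t. t \<in> {a..b} \<Longrightarrow> \<bar>g t\<bar> \<le> M"
    unfolding bounded_iff by (metis imageI real_norm_def)
  have gm: "(\<lambda>t. indicator {a..b} t *\<^sub>R g t) \<in> borel_measurable borel"
    using borel_measurable_continuous_on_indicator[OF _ g] by auto
  have fm: "(\<lambda>t. indicator {a..b} t *\<^sub>R f t) \<in> borel_measurable borel"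
    using f unfolding set_integrable_def by (auto dest: borel_measurable_integrable)
  show ?thesis unfolding set_integrable_def
  proof (rule Bochner_Integration.integrable_bound)
    show "integrable lborel (\<lambda>t. M * (indicator {a..b} t *\<^sub>R f t))"
      using f unfolding set_integrable_def by (intro integrable_mult_right)
    have "(\<lambda>t. (indicator {a..b} t *\<^sub>R g t) * (indicator {a..b} t *\<^sub>R f t)) \<in> borel_measurable borel"
      using gm fm by (rule borel_measurable_times)
    moreover have "(\<lambda>t. (indicator {a..b} t *\<^sub>R g t) * (indicator {a..b} t *\<^sub>R f t))
       = (\<lambda>t. indicator {a..b} t *\<^sub>R (g t * f t))"
      by (auto simp: indicator_def)
    ultimately show "(\<lambda>t. indicator {a..b} t *\<^sub>R (g t * f t)) \<in> borel_measurable lborel"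
      by simp
    show "AE t in lborel. norm (indicator {a..b} t *\<^sub>R (g t * f t)) \<le> norm (M * (indicator {a..b} t *\<^sub>R f t))"
    proof (rule AE_I2)
      fix t show "norm (indicator {a..b} t *\<^sub>R (g t * f t)) \<le> norm (M * (indicator {a..b} t *\<^sub>R f t))"
        using M[of t] by (auto simp: indicator_def abs_mult intro!: mult_right_mono)
    qed
  qed
qed

text \<open>
  The exit probabilities below solve differential equations whose coefficients are only locally
  integrable in time, so they are differentiable merely almost everywhere.  The predicate expresses that
  \<open>F\<close> is absolutely continuous with density \<open>f\<close>, in the integrated form in which it is used.
\<close>

definition primitive_on :: "real \<Rightarrow> real \<Rightarrow> (real \<Rightarrow> real) \<Rightarrow> (real \<Rightarrow> real) \<Rightarrow> bool" where
  "primitive_on a b F f \<longleftrightarrow> set_integrable lborel {a..b} f \<and>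
     (\<forall>s t. a \<le> s \<longrightarrow> s \<le> t \<longrightarrow> t \<le> b \<longrightarrow> F t - F s = (LBINT x:{s..t}. f x))"

lemma primitive_on_integrable:
  assumes "primitive_on a b F f" "a \<le> s" "t \<le> b"
  shows "set_integrable lborel {s..t} f"
proof -
  have "set_integrable lborel {a..b} f" using assms by (simp add: primitive_on_def)
  then show ?thesis using assms by (rule_tac set_integrable_subset) auto
qed

lemma primitive_on_subinterval:
  assumes "primitive_on a b F f" "a \<le> a'" "b' \<le> b"
  shows "primitive_on a' b' F f"
  using assms(1) primitive_on_integrable[OF assms] assms(2,3) unfolding primitive_on_def by auto

lemma primitive_on_cong:
  assumes "primitive_on a b F f" "\<And>t. a \<le> t \<Longrightarrow> t \<le> b \<Longrightarrow> F t = G t" "\<And>t. a \<le> t \<Longrightarrow> t \<le> b \<Longrightarrow> f t = g t"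
  shows "primitive_on a b G g"
proof -
  have 1: "(LBINT x:{s..t}. f x) = (LBINT x:{s..t}. g x)" if "a \<le> s" "t \<le> b" for s t
    using that assms(3) by (intro set_lebesgue_integral_cong) auto
  have "set_integrable lborel {a..b} f = set_integrable lborel {a..b} g"
    using assms(3) by (intro set_integrable_cong) auto
  moreover have "F t - F s = G t - G s" if "a \<le> s" "s \<le> t" "t \<le> b" for s t
    using assms(2)[of s] assms(2)[of t] that by simp
  ultimately show ?thesis using assms(1) 1 unfolding primitive_on_def by auto
qed

lemma primitive_continuous:
  fixes f F :: "real \<Rightarrow> real"
  assumes prim: "primitive_on a b F f"
  shows "continuous_on {a..b} F"
proof -
  have f: "set_integrable lborel {a..b} f"
    and F: "\<And>s t. a \<le> s \<Longrightarrow> s \<le> t \<Longrightarrow> t \<le> b \<Longrightarrow> F t - F s = (LBINT x:{s..t}. f x)"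
    using prim by (auto simp: primitive_on_def)
  have "continuous_on {a..b} (\<lambda>t. F a + integral {a..t} f)"
    by (intro continuous_intros indefinite_integral_continuous_1 set_borel_integral_eq_integral(1) f)
  moreover have "F a + integral {a..t} f = F t" if "t \<in> {a..b}" for t
  proof -
    have "set_integrable lborel {a..t} f"
      using that by (auto intro: set_integrable_subset[OF f])
    from set_borel_integral_eq_integral(2)[OF this] show ?thesis
      using F[of a t] that by simp
  qed
  ultimately show ?thesis
    by (simp cong: continuous_on_cong_simp)
qed

text \<open>
  The defect \<open>D s t = \<phi> (F t) - \<phi> (F s) - \<integral>\<^sub>s\<^sup>t \<phi>' (F) f\<close> is additive in the interval.  On a short interval the
  mean value theorem writes \<open>\<phi> (F t) - \<phi> (F s)\<close> as \<open>\<phi>' \<xi> \<integral> f\<close> with \<open>\<xi>\<close> close to all values of \<open>F\<close> there, so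
  \<open>\<bar>D s t\<bar> \<le> e \<integral>\<^sub>s\<^sup>t \<bar>f\<bar>\<close>.  Bisection extends this bound to every interval, and \<open>e\<close> is arbitrary.
\<close>

lemma primitive_on_compose:
  fixes f F \<phi> \<phi>' :: "real \<Rightarrow> real"
  assumes prim: "primitive_on a0 b0 F f"
    and \<phi>: "\<And>x. (\<phi> has_real_derivative \<phi>' x) (at x)" and cont: "\<And>x. isCont \<phi>' x"
  shows "primitive_on a0 b0 (\<lambda>t. \<phi> (F t)) (\<lambda>t. \<phi>' (F t) * f t)"
proof -
  have int: "set_integrable lborel {a0..b0} (\<lambda>t. \<phi>' (F t) * f t)"
  proof (rule set_integrable_cont_mult)
    show "continuous_on {a0..b0} (\<lambda>t. \<phi>' (F t))"
      by (rule continuous_on_compose2[OF _ primitive_continuous[OF prim], of UNIV])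
        (auto intro: continuous_at_imp_continuous_on cont)
  qed (use prim in \<open>simp add: primitive_on_def\<close>)
  moreover have "\<phi> (F b) - \<phi> (F a) = (LBINT t:{a..b}. \<phi>' (F t) * f t)"
    if "a0 \<le> a" and ab: "a \<le> b" and "b \<le> b0" for a b
  proof -
    have prim': "primitive_on a b F f"
      using primitive_on_subinterval[OF prim that(1,3)] .
    have f: "set_integrable lborel {a..b} f"
      and F: "\<And>s t. a \<le> s \<Longrightarrow> s \<le> t \<Longrightarrow> t \<le> b \<Longrightarrow> F t - F s = (LBINT x:{s..t}. f x)"
      using prim' by (auto simp: primitive_on_def)
    have contF: "continuous_on {a..b} F" by (rule primitive_continuous[OF prim'])
    have int: "set_integrable lborel {a..b} (\<lambda>t. \<phi>' (F t) * f t)"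
      using that by (auto intro: set_integrable_subset[OF int])
    have absf: "set_integrable lborel {a..b} (\<lambda>t. \<bar>f t\<bar>)"
      by (rule set_integrable_abs[OF f])
    define D where "D s t = \<phi> (F t) - \<phi> (F s) - (LBINT t:{s..t}. \<phi>' (F t) * f t)" for s t
    define G where "G s t = (LBINT x:{s..t}. \<bar>f x\<bar>)" for s t
    have main: "\<bar>D a b\<bar> \<le> e * G a b" if e: "e > 0" for e
    proof -
      (* The guards make the property vacuous on intervals that leave [a, b]. *)
      define P where "P s t \<longleftrightarrow> (a \<le> s \<and> s \<le> t \<and> t \<le> b \<longrightarrow> \<bar>D s t\<bar> \<le> e * G s t)" for s t
      have "P a b"
        using ab
      proof (induction rule: Bolzano)
        case (trans s t u)
        show ?case unfolding P_def
        proof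
          assume su: "a \<le> s \<and> s \<le> u \<and> u \<le> b"
          have "set_integrable lborel {s..u} (\<lambda>t. \<phi>' (F t) * f t)" "set_integrable lborel {s..u} (\<lambda>t. \<bar>f t\<bar>)"
            using su by (auto intro: set_integrable_subset[OF int] set_integrable_subset[OF absf])
          then have "D s u = D s t + D t u" "G s u = G s t + G t u"
            using trans(3,4) by (simp_all add: D_def G_def LBINT_combine[of s u _ t])
          then show "\<bar>D s u\<bar> \<le> e * G s u"
            using trans su by (auto simp: distrib_left P_def)
        qed
      next
        case (local x)
        obtain \<delta> where \<delta>: "\<delta> > 0" "\<And>z. \<bar>z - F x\<bar> < \<delta> \<Longrightarrow> \<bar>\<phi>' z - \<phi>' (F x)\<bar> < e/2"
          using cont[of "F x"] e unfolding continuous_at_eps_delta dist_real_def by (metis half_gt_zero)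
        obtain d where d: "d > 0" "\<And>y. y \<in> {a..b} \<Longrightarrow> \<bar>y - x\<bar> < d \<Longrightarrow> \<bar>F y - F x\<bar> < \<delta>"
          using contF local \<delta>(1) unfolding continuous_on_iff dist_real_def by (metis atLeastAtMost_iff)
        show ?case unfolding P_def
        proof (intro exI[of _ d] conjI allI impI d(1))
          fix s t assume st: "s \<le> x \<and> x \<le> t \<and> t - s < d" and "a \<le> s \<and> s \<le> t \<and> t \<le> b"
          then have ast: "a \<le> s" "s \<le> t" "t \<le> b" by auto
          have near: "\<bar>F u - F x\<bar> < \<delta>" if "u \<in> {s..t}" for u
            using that st ast by (intro d(2)) auto
          obtain \<xi> where \<xi>: "\<phi> (F t) - \<phi> (F s) = \<phi>' \<xi> * (F t - F s)" "\<bar>\<xi> - F x\<bar> < \<delta>"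
          proof (cases "F s" "F t" rule: linorder_cases)
            case less
            then obtain \<xi> where "F s < \<xi>" "\<xi> < F t" "\<phi> (F t) - \<phi> (F s) = (F t - F s) * \<phi>' \<xi>"
              using MVT2[of "F s" "F t" \<phi> \<phi>'] \<phi> by blast
            then show ?thesis using that[of \<xi>] near[of s] near[of t] ast by auto
          next
            case equal then show ?thesis using that[of "F s"] near[of s] ast by auto
          next
            case greater
            then obtain \<xi> where "F t < \<xi>" "\<xi> < F s" "\<phi> (F s) - \<phi> (F t) = (F s - F t) * \<phi>' \<xi>"
              using MVT2[of "F t" "F s" \<phi> \<phi>'] \<phi> by blast
            then show ?thesis using that[of \<xi>] near[of s] near[of t] ast by (auto simp: algebra_simps)
          qed
          have fi: "set_integrable lborel {s..t} f" "set_integrable lborel {s..t} (\<lambda>t. \<phi>' (F t) * f t)"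
             "set_integrable lborel {s..t} (\<lambda>t. \<bar>f t\<bar>)"
            using ast by (auto intro: set_integrable_subset[OF f] set_integrable_subset[OF int] set_integrable_subset[OF absf])
          have "D s t = (LBINT u:{s..t}. \<phi>' \<xi> * f u - \<phi>' (F u) * f u)"
            unfolding D_def \<xi>(1) using fi F[OF ast] by (simp add: set_integral_diff)
          also have "\<bar>\<dots>\<bar> \<le> (LBINT u:{s..t}. \<bar>\<phi>' \<xi> * f u - \<phi>' (F u) * f u\<bar>)"
            using set_integral_norm_bound[of lborel "{s..t}" "\<lambda>u. \<phi>' \<xi> * f u - \<phi>' (F u) * f u"] fi by simp
          also have "\<dots> \<le> (LBINT u:{s..t}. e * \<bar>f u\<bar>)"
          proof (rule set_integral_mono)
            fix u assume u: "u \<in> {s..t}"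
            have "\<bar>\<phi>' \<xi> - \<phi>' (F u)\<bar> \<le> e"
              using \<delta>(2)[OF \<xi>(2)] \<delta>(2)[OF near[OF u]] by linarith
            then have "\<bar>\<phi>' \<xi> - \<phi>' (F u)\<bar> * \<bar>f u\<bar> \<le> e * \<bar>f u\<bar>" by (intro mult_right_mono) auto
            then show "\<bar>\<phi>' \<xi> * f u - \<phi>' (F u) * f u\<bar> \<le> e * \<bar>f u\<bar>"
              by (simp add: abs_mult[symmetric] left_diff_distrib)
          qed (use fi in \<open>auto intro!: set_integrable_abs set_integral_diff(1) set_integrable_mult_right\<close>)
          also have "\<dots> = e * G s t" unfolding G_def by simp
          finally show "\<bar>D s t\<bar> \<le> e * G s t" .
        qed
      qed
      then show ?thesis using ab by (simp add: P_def)
    qed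
    have "\<bar>D a b\<bar> \<le> 0"
    proof (rule field_le_epsilon)
      fix e :: real assume e: "e > 0"
      have G: "G a b \<ge> 0" unfolding G_def by (simp add: set_lebesgue_integral_def)
      have "\<bar>D a b\<bar> \<le> e / (G a b + 1) * G a b" using main[of "e / (G a b + 1)"] G e by simp
      also have "\<dots> \<le> e" using G e by (simp add: field_simps)
      finally show "\<bar>D a b\<bar> \<le> 0 + e" by simp
    qed
    then show "\<phi> (F b) - \<phi> (F a) = (LBINT t:{a..b}. \<phi>' (F t) * f t)" by (simp add: D_def)
  qed
  ultimately show ?thesis unfolding primitive_on_def by auto
qed

lemma primitive_on_add:
  assumes "primitive_on a b F f" "primitive_on a b G g"
  shows "primitive_on a b (\<lambda>t. F t + G t) (\<lambda>t. f t + g t)"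
proof -
  have f: "set_integrable lborel {s..t} f" and g: "set_integrable lborel {s..t} g"
    if "a \<le> s" "t \<le> b" for s t
    using assms that by (auto intro: primitive_on_integrable)
  then have 1: "(LBINT x:{s..t}. f x + g x) = (LBINT x:{s..t}. f x) + (LBINT x:{s..t}. g x)"
    if "a \<le> s" "t \<le> b" for s t using that by (simp add: set_integral_add)
  show ?thesis unfolding primitive_on_def
  proof (intro conjI allI impI)
    show "set_integrable lborel {a..b} (\<lambda>t. f t + g t)" using f g by (simp add: set_integral_add)
    fix s t assume "a \<le> s" "s \<le> t" "t \<le> b"
    then have "F t - F s = (LBINT x:{s..t}. f x)" "G t - G s = (LBINT x:{s..t}. g x)"
      using assms by (auto simp: primitive_on_def)
    then show "F t + G t - (F s + G s) = (LBINT x:{s..t}. f x + g x)"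
      using 1[OF \<open>a \<le> s\<close> \<open>t \<le> b\<close>] by simp
  qed
qed

lemma primitive_on_cmult:
  assumes "primitive_on a b F f"
  shows "primitive_on a b (\<lambda>t. c * F t) (\<lambda>t. c * f t)"
  using assms by (auto simp: primitive_on_def right_diff_distrib[symmetric])

text \<open>
  Polarisation: the chain rule for the square gives the product rule.
\<close>

lemma primitive_on_mult:
  assumes F: "primitive_on a b F f" and G: "primitive_on a b G g"
  shows "primitive_on a b (\<lambda>t. F t * G t) (\<lambda>t. f t * G t + F t * g t)"
proof -
  have sq: "primitive_on a b (\<lambda>t. (K t)\<^sup>2) (\<lambda>t. 2 * K t * k t)" if "primitive_on a b K k" for K k
    by (rule primitive_on_compose[where \<phi> = "\<lambda>x. x\<^sup>2" and \<phi>' = "\<lambda>x. 2 * x", OF that])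
      (auto intro!: derivative_eq_intros)
  have "primitive_on a b (\<lambda>t. 1/2 * ((F t + G t)\<^sup>2 + -1 * ((F t)\<^sup>2 + (G t)\<^sup>2)))
     (\<lambda>t. 1/2 * (2 * (F t + G t) * (f t + g t) + -1 * (2 * F t * f t + 2 * G t * g t)))"
    by (intro primitive_on_cmult primitive_on_add sq F G)
  then show ?thesis
    by (rule primitive_on_cong) (auto simp: power2_eq_square algebra_simps)
qed

lemma primitive_on_indefinite_integral:
  assumes "set_integrable lborel {a..b} f"
  shows "primitive_on a b (\<lambda>t. LBINT x:{a..t}. f x) f"
    and "primitive_on a b (\<lambda>t. LBINT x:{t..b}. f x) (\<lambda>t. - f t)"
proof -
  have f: "set_integrable lborel {s..t} f" if "a \<le> s" "t \<le> b" for s t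
    using that by (auto intro: set_integrable_subset[OF assms])
  show "primitive_on a b (\<lambda>t. LBINT x:{a..t}. f x) f"
    unfolding primitive_on_def
  proof (intro conjI allI impI assms)
    fix s t assume "a \<le> s" "s \<le> t" "t \<le> b"
    then have "(LBINT x:{a..t}. f x) = (LBINT x:{a..s}. f x) + (LBINT x:{s..t}. f x)"
      by (intro LBINT_combine f) auto
    then show "(LBINT x:{a..t}. f x) - (LBINT x:{a..s}. f x) = (LBINT x:{s..t}. f x)" by simp
  qed
  have neg: "(LBINT x:{s..t}. - f x) = - (LBINT x:{s..t}. f x)" for s t
    by (simp add: set_lebesgue_integral_def)
  have "set_integrable lborel {a..b} (\<lambda>t. - f t)"
    using set_integrable_mult_right[of "-1" lborel "{a..b}" f] assms by simp
  moreover have "(LBINT x:{t..b}. f x) - (LBINT x:{s..b}. f x) = (LBINT x:{s..t}. - f x)"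
    if "a \<le> s" "s \<le> t" "t \<le> b" for s t
  proof -
    have "(LBINT x:{s..b}. f x) = (LBINT x:{s..t}. f x) + (LBINT x:{t..b}. f x)"
      using that by (intro LBINT_combine f) auto
    then show ?thesis by (simp add: neg)
  qed
  ultimately show "primitive_on a b (\<lambda>t. LBINT x:{t..b}. f x) (\<lambda>t. - f t)"
    unfolding primitive_on_def by blast
qed

section \<open>Bonds of the lattice\<close>

abbreviation neighbours :: "'d::finite site \<Rightarrow> 'd site set" where
  "neighbours z \<equiv> {y. (z, y) \<in> edges}"

lemma edges_sym: "(x, y) \<in> edges \<longleftrightarrow> (y, x) \<in> edges"
  unfolding edges_def graph_norm_def by (simp add: abs_minus_commute)

lemma edges_shift: "(x + z, y + z) \<in> edges \<longleftrightarrow> (x, y) \<in> edges"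
  by (simp add: edges_def)

lemma finite_bounded_sites: "finite {x :: 'd::finite site. \<forall>i. \<bar>x $ i\<bar> \<le> k}"
proof -
  have "{x :: 'd site. \<forall>i. \<bar>x $ i\<bar> \<le> k} \<subseteq> vec_lambda ` (UNIV \<rightarrow>\<^sub>E {-k..k})"
  proof
    fix x :: "'d site" assume "x \<in> {x. \<forall>i. \<bar>x $ i\<bar> \<le> k}"
    then have "vec_nth x \<in> UNIV \<rightarrow>\<^sub>E {-k..k}" by (auto simp: abs_le_iff minus_le_iff)
    then show "x \<in> vec_lambda ` (UNIV \<rightarrow>\<^sub>E {-k..k})" by (metis image_eqI vec_nth_inverse)
  qed
  moreover have "finite (vec_lambda ` (UNIV \<rightarrow>\<^sub>E {-k..k}) :: 'd site set)"
    by (intro finite_imageI finite_PiE) auto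
  ultimately show ?thesis by (rule finite_subset)
qed

lemma abs_component_le_graph_norm: "\<bar>x $ i\<bar> \<le> graph_norm (x :: 'd::finite site)"
  unfolding graph_norm_def by (rule member_le_sum) auto

lemma neighbours_translate: "neighbours z = (\<lambda>y. y + z) ` neighbours (0 :: 'd::finite site)"
proof -
  have "y \<in> (\<lambda>y. y + z) ` neighbours 0" if "(z, y) \<in> edges" for y
  proof (rule image_eqI)
    show "y - z \<in> neighbours 0" using that edges_shift[of 0 z "y - z"] by simp
  qed simp
  moreover have "(z, y + z) \<in> edges" if "(0, y) \<in> edges" for y
    using that edges_shift[of 0 z y] by simp
  ultimately show ?thesis by auto
qed

lemma finite_neighbours [simp]: "finite (neighbours (z :: 'd::finite site))"
proof -
  have "neighbours (0 :: 'd site) \<subseteq> {x. \<forall>i. \<bar>x $ i\<bar> \<le> 1}"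
  proof safe
    fix y :: "'d site" and i assume "(0, y) \<in> edges"
    then show "\<bar>y $ i\<bar> \<le> 1"
      using abs_component_le_graph_norm[of "0 - y" i] by (simp add: edges_def)
  qed
  then have "finite (neighbours (0 :: 'd site))" using finite_bounded_sites by (rule finite_subset)
  then show ?thesis by (subst neighbours_translate) simp
qed

lemma neighbours_nonempty: "neighbours (z :: 'd::finite site) \<noteq> {}"
proof -
  fix i :: 'd
  have "graph_norm (0 - axis i 1 :: 'd site) = (\<Sum>j\<in>UNIV. if j = i then 1 else 0)"
    unfolding graph_norm_def by (intro sum.cong) (auto simp: axis_def)
  then have "axis i 1 \<in> neighbours (0 :: 'd site)"
    by (simp add: edges_def)
  then show ?thesis by (subst neighbours_translate) blast
qed

text \<open>
  Holding times and exit probabilities are built from integrals over intervals with moving end points;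
  this is what makes them measurable in the starting time and, later, in the environment.
\<close>

lemma borel_measurable_LBINT_interval:
  fixes f :: "'a \<Rightarrow> real \<Rightarrow> real"
  assumes [measurable]: "(\<lambda>p. f (fst p) (snd p)) \<in> borel_measurable (M \<Otimes>\<^sub>M borel)"
    "l \<in> borel_measurable M" "h \<in> borel_measurable M"
  shows "(\<lambda>x. LBINT u:{l x..h x}. f x u) \<in> borel_measurable M"
proof -
  have "(\<lambda>p. (if l (fst p) \<le> snd p \<and> snd p \<le> h (fst p) then f (fst p) (snd p) else 0))
      \<in> borel_measurable (M \<Otimes>\<^sub>M lborel)" by measurable
  then have "(\<lambda>x. \<integral>u. (if l x \<le> u \<and> u \<le> h x then f x u else 0) \<partial>lborel) \<in> borel_measurable M"
    by (intro lborel.borel_measurable_lebesgue_integral) (simp add: split_beta')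
  moreover have "(LBINT u:{l x..h x}. f x u) = (\<integral>u. (if l x \<le> u \<and> u \<le> h x then f x u else 0) \<partial>lborel)" for x
    unfolding set_lebesgue_integral_def by (intro Bochner_Integration.integral_cong) auto
  ultimately show ?thesis by simp
qed

lemma set_integrable_sum:
  fixes f :: "'i \<Rightarrow> 'a \<Rightarrow> real"
  assumes "\<And>i. i \<in> I \<Longrightarrow> set_integrable M A (f i)"
  shows "set_integrable M A (\<lambda>x. \<Sum>i\<in>I. f i x)"
  using assms unfolding set_integrable_def scaleR_sum_right
  by (rule Bochner_Integration.integrable_sum)

lemma set_integral_sum:
  fixes f :: "'i \<Rightarrow> 'a \<Rightarrow> real"
  assumes "\<And>i. i \<in> I \<Longrightarrow> set_integrable M A (f i)"
  shows "(LINT x:A|M. \<Sum>i\<in>I. f i x) = (\<Sum>i\<in>I. LINT x:A|M. f i x)"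
  using assms unfolding set_integrable_def set_lebesgue_integral_def scaleR_sum_right
  by (rule Bochner_Integration.integral_sum)

section \<open>Holding times in a regular environment\<close>

text \<open>
  The integrated rate at \<open>z\<close>: the walk leaves \<open>z\<close> when this clock passes an exponential variable.
\<close>

definition clock :: "'d::finite env \<Rightarrow> 'd site \<Rightarrow> real \<Rightarrow> real \<Rightarrow> real" where
  "clock \<omega> z r t = (LBINT u:{r..t}. total_rate \<omega> u z)"

text \<open>
  The properties that almost every environment has and that make the quenched walk well behaved.
  Everything about a fixed environment is proved in this locale.
\<close>

locale regular_environment =
  fixes \<omega> :: "'d::finite env"
  assumes positive: "\<And>e t. e \<in> edges \<Longrightarrow> 0 < \<omega> t e"
    and zero_off: "\<And>e t. e \<notin> edges \<Longrightarrow> \<omega> t e = 0"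
    and symmetric: "\<And>x y t. \<omega> t (x, y) = \<omega> t (y, x)"
    and rate_measurable [measurable]: "\<And>e. (\<lambda>t. \<omega> t e) \<in> borel_measurable borel"
    and locally_integrable: "\<And>a b e. set_integrable lborel {a..b} (\<lambda>t. \<omega> t e)"
begin

lemma rate_nonneg: "0 \<le> \<omega> t e"
  using positive[of e t] zero_off[of e t] by (cases "e \<in> edges") auto

lemma total_rate_pos: "0 < total_rate \<omega> t z"
  unfolding total_rate_def
  by (rule sum_pos[OF finite_neighbours neighbours_nonempty]) (auto simp: positive)

lemma total_rate_nonneg: "0 \<le> total_rate \<omega> t z"
  using total_rate_pos by (rule less_imp_le)

lemma total_rate_measurable [measurable]: "(\<lambda>t. total_rate \<omega> t z) \<in> borel_measurable borel"
  unfolding total_rate_def by measurable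

lemma total_rate_integrable: "set_integrable lborel {a..b} (\<lambda>t. total_rate \<omega> t z)"
  unfolding total_rate_def by (intro set_integrable_sum locally_integrable)

lemma clock_nonneg: "0 \<le> clock \<omega> z r t"
  unfolding clock_def set_lebesgue_integral_def
  by (intro integral_nonneg_AE AE_I2) (simp add: total_rate_nonneg)

lemma clock_empty: "t \<le> r \<Longrightarrow> clock \<omega> z r t = 0"
proof -
  assume "t \<le> r"
  then consider "t < r" | "t = r" by linarith
  then show ?thesis
  proof cases
    case 2
    have "set_integrable lborel {r..r} (\<lambda>t. total_rate \<omega> t z)" by (rule total_rate_integrable)
    from set_borel_integral_eq_integral(2)[OF this] show ?thesis using 2 by (simp add: clock_def)
  qed (simp add: clock_def set_lebesgue_integral_def)
qed

lemma clock_combine: "a \<le> b \<Longrightarrow> b \<le> c \<Longrightarrow> clock \<omega> z a c = clock \<omega> z a b + clock \<omega> z b c"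
  unfolding clock_def by (rule LBINT_combine[OF total_rate_integrable])

lemma clock_measurable [measurable (raw)]:
  assumes [measurable]: "f \<in> borel_measurable M" "g \<in> borel_measurable M"
  shows "(\<lambda>x. clock \<omega> z (f x) (g x)) \<in> borel_measurable M"
  unfolding clock_def by (rule borel_measurable_LBINT_interval) measurable

lemma clock_primitive: "primitive_on a b (clock \<omega> z a) (\<lambda>t. total_rate \<omega> t z)"
  unfolding clock_def[abs_def] by (rule primitive_on_indefinite_integral(1)[OF total_rate_integrable])

lemma survival_primitive:
  "primitive_on a b (\<lambda>t. exp (- clock \<omega> z a t)) (\<lambda>t. - exp (- clock \<omega> z a t) * total_rate \<omega> t z)"
  by (rule primitive_on_compose[where \<phi> = "\<lambda>x. exp (- x)" and \<phi>' = "\<lambda>x. - exp (- x)", OF clock_primitive])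
    (auto intro!: derivative_eq_intros)

lemma hold_law: "is_hold_law \<omega> r z (hold_law \<omega> r z)"
  unfolding hold_law_def
  by (rule theI'[OF ex1_hold_law[OF total_rate_integrable total_rate_nonneg]])

lemma prob_space_hold_law: "prob_space (hold_law \<omega> r z)"
  and sets_hold_law [simp, measurable_cong]: "sets (hold_law \<omega> r z) = sets borel"
  using hold_law[of r z] by (auto simp: is_hold_law_def)

lemma emeasure_hold_law:
  "emeasure (hold_law \<omega> r z) {a<..} =
     (if a = \<infinity> then 0 else if a < ereal r then 1 else ennreal (exp (- clock \<omega> z r (real_of_ereal a))))"
proof -
  interpret prob_space "hold_law \<omega> r z" by (rule prob_space_hold_law)
  have s: "measure (hold_law \<omega> r z) {ereal t<..} = exp (- clock \<omega> z r t)" if "r \<le> t" for t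
    using hold_law[of r z] that by (simp add: is_hold_law_def clock_def)
  consider "a = \<infinity>" | "a < ereal r" | t where "a = ereal t" "r \<le> t"
    by (cases a) (auto simp: not_less[symmetric])
  then show ?thesis
  proof cases
    case 1
    then have "{a<..} = {}" by auto
    then show ?thesis using 1 by simp
  next
    case 2
    have "1 = measure (hold_law \<omega> r z) {ereal r<..}" using s[of r] by (simp add: clock_empty)
    also have "\<dots> \<le> measure (hold_law \<omega> r z) {a<..}" using 2 by (intro finite_measure_mono) auto
    finally have "measure (hold_law \<omega> r z) {a<..} = 1" using prob_le_1 antisym by blast
    then show ?thesis using 2 by (auto simp: emeasure_eq_measure)
  qed (auto simp: emeasure_eq_measure s)
qed

lemma Int_stable_greaterThan: "Int_stable (range (\<lambda>a::ereal. {a<..}))"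
proof -
  have "{a<..} \<inter> {b<..} = {max a b<..}" for a b :: ereal by auto
  then show ?thesis by (auto simp: Int_stable_def)
qed

lemma hold_law_measurable: "(\<lambda>r. hold_law \<omega> (real_of_ereal r) z) \<in> borel \<rightarrow>\<^sub>M prob_algebra borel"
proof (rule measurable_prob_algebra_generated[where G = "range (\<lambda>a::ereal. {a<..})" and \<Omega> = UNIV])
  show "sets (borel :: ereal measure) = sigma_sets UNIV (range (\<lambda>a::ereal. {a<..}))"
    by (simp add: borel_Ioi)
  fix A assume "A \<in> range (\<lambda>a::ereal. {a<..})"
  then obtain a where A: "A = {a<..}" by blast
  show "(\<lambda>r. emeasure (hold_law \<omega> (real_of_ereal r) z) A) \<in> borel_measurable borel"
    unfolding A emeasure_hold_law by measurable
qed (auto simp: Int_stable_greaterThan prob_space_hold_law)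

text \<open>
  On the holding time law the survival function is \<open>exp (- clock)\<close>, whose density is computed by the
  chain rule.  Restricting to times up to \<open>T\<close> removes the atom at \<open>\<infinity>\<close>, so that two finite measures
  have to be compared on the half lines \<open>{a<..}\<close> only.
\<close>

lemma nn_integral_hold_law:
  assumes f [measurable]: "f \<in> borel_measurable borel" and f0: "\<And>j. ereal T < j \<Longrightarrow> f j = 0"
  shows "(\<integral>\<^sup>+ j. f j \<partial>hold_law \<omega> r z) =
    (\<integral>\<^sup>+ s. ennreal (total_rate \<omega> s z * exp (- clock \<omega> z r s)) * f (ereal s) * indicator {r..T} s \<partial>lborel)"
proof -
  interpret prob_space "hold_law \<omega> r z" by (rule prob_space_hold_law)
  define d where "d s = ennreal (total_rate \<omega> s z * exp (- clock \<omega> z r s)) * indicator {r..T} s" for s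
  have d[measurable]: "d \<in> borel_measurable lborel" unfolding d_def by measurable
  define Q where "Q = density (hold_law \<omega> r z) (indicator {..ereal T})"
  define R where "R = distr (density lborel d) borel ereal"
  have d_int: "(\<integral>\<^sup>+ s. d s * indicator {t<..} s \<partial>lborel) =
      ennreal (exp (- clock \<omega> z r (max r t)) - exp (- clock \<omega> z r T))" if "max r t \<le> T" for t
  proof -
    let ?t = "max r t" and ?g = "\<lambda>s. exp (- clock \<omega> z r s) * total_rate \<omega> s z"
    have prim: "primitive_on ?t T (\<lambda>t. exp (- clock \<omega> z r t)) (\<lambda>s. - exp (- clock \<omega> z r s) * total_rate \<omega> s z)"
      by (rule primitive_on_subinterval[OF survival_primitive]) auto
    then have int: "set_integrable lborel {?t..T} (\<lambda>s. - 1 * (- exp (- clock \<omega> z r s) * total_rate \<omega> s z))"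
      unfolding primitive_on_def by (intro set_integrable_mult_right) auto
    then have int: "set_integrable lborel {?t..T} ?g" by simp
    have val: "(LBINT s:{?t..T}. ?g s) = exp (- clock \<omega> z r ?t) - exp (- clock \<omega> z r T)"
    proof -
      have "(LBINT s:{?t..T}. - ?g s) = exp (- clock \<omega> z r T) - exp (- clock \<omega> z r ?t)"
        using prim that by (simp add: primitive_on_def)
      then show ?thesis by (simp add: set_lebesgue_integral_def)
    qed
    have "(\<integral>\<^sup>+ s. d s * indicator {t<..} s \<partial>lborel) = (\<integral>\<^sup>+ s. ennreal (indicator {?t..T} s *\<^sub>R ?g s) \<partial>lborel)"
    proof (rule nn_integral_cong_AE)
      have "AE s in lborel. s \<noteq> t" by (rule AE_lborel_singleton)
      then show "AE s in lborel. d s * indicator {t<..} s = ennreal (indicator {?t..T} s *\<^sub>R ?g s)"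
        by eventually_elim (auto simp: d_def indicator_def mult.commute)
    qed
    also have "\<dots> = ennreal (LBINT s:{?t..T}. ?g s)"
      unfolding set_lebesgue_integral_def
      using int unfolding set_integrable_def
      by (intro nn_integral_eq_integral) (auto simp: total_rate_nonneg)
    finally show ?thesis by (simp add: val)
  qed
  have Qe: "emeasure Q {a<..} = emeasure R {a<..}" for a
  proof -
    have Q: "emeasure Q {a<..} = emeasure (hold_law \<omega> r z) {a<..ereal T}"
    proof -
      have "emeasure Q {a<..} = (\<integral>\<^sup>+ j. indicator {..ereal T} j * indicator {a<..} j \<partial>hold_law \<omega> r z)"
        unfolding Q_def by (rule emeasure_density) auto
      also have "\<dots> = (\<integral>\<^sup>+ j. indicator {a<..ereal T} j \<partial>hold_law \<omega> r z)"
        by (rule nn_integral_cong) (auto simp: indicator_def)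
      also have "\<dots> = emeasure (hold_law \<omega> r z) {a<..ereal T}" by (rule nn_integral_indicator) simp
      finally show ?thesis .
    qed
    have R: "emeasure R {a<..} = (\<integral>\<^sup>+ s. d s * indicator {s. a < ereal s} s \<partial>lborel)"
    proof -
      have "ereal -` {a<..} = {s. a < ereal s}" by auto
      moreover have "{s. a < ereal s} \<in> sets lborel" by measurable
      ultimately show ?thesis
        unfolding R_def by (subst emeasure_distr) (auto simp: emeasure_density)
    qed
    (* The last two cases are a below and above the starting time r; the first two are degenerate. *)
    consider "ereal T \<le> a" | "T < r" "a < ereal T" | "a < ereal T" "r \<le> T" "a < ereal r" | t where "a = ereal t" "r \<le> t" "t \<le> T"
    proof (cases a)
      case (real t)
      then show ?thesis using that(1,2,3) that(4)[of t]
        by (metis ereal_less_eq(3) less_ereal.simps(1) linorder_le_less_linear order_less_imp_le)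
    next
      case PInf then show ?thesis using that(1) by simp
    next
      case MInf then show ?thesis using that(2,3) by (cases "T < r") auto
    qed
    then show ?thesis
    proof cases
      case 1
      then have "{a<..ereal T} = {}" by auto
      moreover have "d s * indicator {s. a < ereal s} s = 0" for s
        using 1 order_le_less_trans[of "ereal T" a "ereal s"] by (auto simp: d_def indicator_def)
      ultimately show ?thesis unfolding Q R by (simp only: emeasure_empty nn_integral_const mult_zero_left)
    next
      case 2
      have "emeasure (hold_law \<omega> r z) {a<..ereal T} \<le> emeasure (hold_law \<omega> r z) (space (hold_law \<omega> r z) - {ereal T<..})"
        by (intro emeasure_mono) (auto simp: sets_eq_imp_space_eq[OF sets_hold_law])
      also have "\<dots> = 0"
        using 2 by (subst emeasure_compl) (auto simp: emeasure_hold_law emeasure_space_1)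
      finally have "emeasure (hold_law \<omega> r z) {a<..ereal T} = 0" by simp
      moreover have "d s = 0" for s using 2 by (auto simp: d_def)
      ultimately show ?thesis unfolding Q R by simp
    next
      case 3
      have "{a<..ereal T} = {a<..} - {ereal T<..}" by auto
      then have "emeasure (hold_law \<omega> r z) {a<..ereal T} = emeasure (hold_law \<omega> r z) {a<..} - emeasure (hold_law \<omega> r z) {ereal T<..}"
        using 3 by (simp add: emeasure_Diff)
      also have "\<dots> = ennreal (1 - exp (- clock \<omega> z r T))"
        using 3 ennreal_minus[of "exp (- clock \<omega> z r T)" 1] by (auto simp: emeasure_hold_law)
      also have "\<dots> = (\<integral>\<^sup>+ s. d s * indicator {r-1<..} s \<partial>lborel)"
        using 3 by (subst d_int) (auto simp: clock_empty)
      also have "\<dots> = (\<integral>\<^sup>+ s. d s * indicator {s. a < ereal s} s \<partial>lborel)"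
      proof (rule nn_integral_cong)
        fix s show "d s * indicator {r-1<..} s = d s * indicator {s. a < ereal s} s"
          using 3 less_le_trans[of a "ereal r" "ereal s"] by (auto simp: d_def indicator_def)
      qed
      finally show ?thesis unfolding Q R .
    next
      case (4 t)
      have "{a<..ereal T} = {a<..} - {ereal T<..}" by auto
      then have "emeasure (hold_law \<omega> r z) {a<..ereal T} = emeasure (hold_law \<omega> r z) {a<..} - emeasure (hold_law \<omega> r z) {ereal T<..}"
        using 4 by (simp add: emeasure_Diff)
      also have "\<dots> = ennreal (exp (- clock \<omega> z r t) - exp (- clock \<omega> z r T))"
        using 4 by (auto simp: emeasure_hold_law ennreal_minus)
      also have "\<dots> = (\<integral>\<^sup>+ s. d s * indicator {s. a < ereal s} s \<partial>lborel)"
        using 4 d_int[of t] by (simp add: greaterThan_def max_def)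
      finally show ?thesis unfolding Q R .
    qed
  qed
  (* Half lines do not see a mass at - infinity, so the whole line is added to the generator. *)
  have "Q = R"
  proof (rule measure_eqI_generator_eq[where \<Omega> = UNIV and E = "range (\<lambda>a::ereal. {a<..}) \<union> {UNIV}" and A = "\<lambda>_. UNIV"])
    have "{a<..} \<inter> {b<..} = {max a b<..}" for a b :: ereal by auto
    then show "Int_stable (range (\<lambda>a::ereal. {a<..}) \<union> {UNIV})" by (auto simp: Int_stable_def)
    have ins: "sigma_sets UNIV (range (\<lambda>a::ereal. {a<..}) \<union> {UNIV}) = sigma_sets UNIV (range (\<lambda>a. {a<..}))"
      by (intro sigma_sets_eqI) (auto intro: sigma_sets_top)
    show "sets Q = sigma_sets UNIV (range (\<lambda>a::ereal. {a<..}) \<union> {UNIV})"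
      "sets R = sigma_sets UNIV (range (\<lambda>a::ereal. {a<..}) \<union> {UNIV})"
      unfolding ins by (simp_all add: Q_def R_def borel_Ioi)
    have "emeasure (hold_law \<omega> r z) {-\<infinity>} = 0"
    proof -
      have eq: "{-\<infinity>} = space (hold_law \<omega> r z) - {-\<infinity><..}" by (auto simp: sets_eq_imp_space_eq[OF sets_hold_law])
      show ?thesis unfolding eq
        by (subst emeasure_compl) (auto simp: emeasure_hold_law emeasure_space_1)
    qed
    then have "AE j in hold_law \<omega> r z. j \<noteq> -\<infinity>" by (intro AE_I[where N = "{-\<infinity>}"]) auto
    then have "emeasure Q UNIV = emeasure Q {-\<infinity><..}"
      unfolding Q_def
      by (subst (1 2) emeasure_density) (auto intro!: nn_integral_cong_AE simp: indicator_def)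
    moreover have "emeasure R UNIV = emeasure R {-\<infinity><..}"
    proof -
      have "ereal -` {-\<infinity><..} = UNIV" by auto
      then show ?thesis unfolding R_def by (subst (1 2) emeasure_distr) auto
    qed
    ultimately show "emeasure Q X = emeasure R X" if "X \<in> range (\<lambda>a::ereal. {a<..}) \<union> {UNIV}" for X
      using that Qe by auto
    have "emeasure Q UNIV = (\<integral>\<^sup>+ j. indicator {..ereal T} j * indicator UNIV j \<partial>hold_law \<omega> r z)"
      unfolding Q_def by (rule emeasure_density) auto
    also have "\<dots> \<le> (\<integral>\<^sup>+ j. 1 \<partial>hold_law \<omega> r z)"
      by (rule nn_integral_mono) (auto simp: indicator_def)
    also have "\<dots> = 1" by (simp add: emeasure_space_1)
    finally show "emeasure Q UNIV \<noteq> \<infinity>" by (auto simp: top_unique)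
  qed auto
  have "(\<integral>\<^sup>+ j. f j \<partial>hold_law \<omega> r z) = (\<integral>\<^sup>+ j. indicator {..ereal T} j * f j \<partial>hold_law \<omega> r z)"
    using f0 by (intro nn_integral_cong) (auto simp: indicator_def not_le)
  also have "\<dots> = (\<integral>\<^sup>+ j. f j \<partial>Q)" unfolding Q_def
    by (subst nn_integral_density) auto
  also have "\<dots> = (\<integral>\<^sup>+ s. d s * f (ereal s) \<partial>lborel)"
    unfolding \<open>Q = R\<close> R_def by (subst nn_integral_distr) (auto simp: nn_integral_density)
  finally show ?thesis by (simp add: d_def ac_simps)
qed

end

section \<open>Exit probabilities and the backward equation\<close>

text \<open>
  The probability that the walk, having arrived in \<open>z\<close> at time \<open>r\<close>, is outside \<open>B\<close> at one of its next \<open>n\<close>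
  arrivals (or already is), at a time not later than \<open>T\<close>.  The recursion integrates over the first jump.
  Counting jumps makes the function explicit, and in the limit \<open>n \<rightarrow> \<infinity>\<close> it is the exit probability.
\<close>

primrec exit_prob :: "'d::finite env \<Rightarrow> 'd site set \<Rightarrow> real \<Rightarrow> nat \<Rightarrow> real \<Rightarrow> 'd site \<Rightarrow> real" where
  "exit_prob \<omega> B T 0 = (\<lambda>r z. if r \<le> T \<and> z \<notin> B then 1 else 0)"
| "exit_prob \<omega> B T (Suc n) = (\<lambda>r z. if z \<notin> B then (if r \<le> T then 1 else 0) else
     (LBINT s:{r..T}. exp (- clock \<omega> z r s) * (\<Sum>y\<in>neighbours z. \<omega> s (z, y) * exit_prob \<omega> B T n s y)))"

declare exit_prob.simps(2) [simp del]

text \<open>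
  The gain term of the backward equation
  \<open>- \<partial>\<^sub>s u\<^bsub>n+1\<^esub>(s, z) = \<Sum>\<^sub>y \<omega>\<^sub>s(z, y) u\<^sub>n(s, y) - \<mu>\<^sub>s(z) u\<^bsub>n+1\<^esub>(s, z)\<close>.
\<close>

definition inflow :: "'d::finite env \<Rightarrow> 'd site set \<Rightarrow> real \<Rightarrow> nat \<Rightarrow> real \<Rightarrow> 'd site \<Rightarrow> real" where
  "inflow \<omega> B T n s z = (\<Sum>y\<in>neighbours z. \<omega> s (z, y) * exit_prob \<omega> B T n s y)"

lemma exit_prob_outside: "z \<notin> B \<Longrightarrow> exit_prob \<omega> B T n r z = (if r \<le> T then 1 else 0)"
  by (cases n) (auto simp: exit_prob.simps(2))

lemma exit_prob_inside:
  "z \<in> B \<Longrightarrow> exit_prob \<omega> B T (Suc n) r z = (LBINT s:{r..T}. exp (- clock \<omega> z r s) * inflow \<omega> B T n s z)"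
  by (simp add: inflow_def exit_prob.simps(2))

lemma exit_prob_late: "T < r \<Longrightarrow> exit_prob \<omega> B T n r z = 0"
  by (cases n) (auto simp: exit_prob.simps(2) set_lebesgue_integral_def)

context regular_environment
begin

lemma exit_prob_measurable [measurable]: "(\<lambda>r. exit_prob \<omega> B T n r z) \<in> borel_measurable borel"
proof (induction n arbitrary: z)
  case (Suc n)
  note Suc [measurable]
  have [measurable]: "(\<lambda>s. inflow \<omega> B T n s z) \<in> borel_measurable borel"
    unfolding inflow_def by measurable
  have "(\<lambda>r. LBINT s:{r..T}. exp (- clock \<omega> z r s) * inflow \<omega> B T n s z) \<in> borel_measurable borel"
    by (rule borel_measurable_LBINT_interval) measurable
  then show ?case
    by (cases "z \<in> B") (simp_all add: exit_prob_inside exit_prob_outside)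
qed simp

lemma inflow_measurable [measurable]: "(\<lambda>s. inflow \<omega> B T n s z) \<in> borel_measurable borel"
  unfolding inflow_def by measurable

lemma survival_density:
  "set_integrable lborel {r..T} (\<lambda>s. exp (- clock \<omega> z r s) * total_rate \<omega> s z)"
  "r \<le> T \<Longrightarrow> (LBINT s:{r..T}. exp (- clock \<omega> z r s) * total_rate \<omega> s z) = 1 - exp (- clock \<omega> z r T)"
proof -
  have "primitive_on r T (\<lambda>t. - 1 * exp (- clock \<omega> z r t)) (\<lambda>t. - 1 * (- exp (- clock \<omega> z r t) * total_rate \<omega> t z))"
    by (rule primitive_on_cmult[OF survival_primitive])
  then show "set_integrable lborel {r..T} (\<lambda>s. exp (- clock \<omega> z r s) * total_rate \<omega> s z)"
    and "r \<le> T \<Longrightarrow> (LBINT s:{r..T}. exp (- clock \<omega> z r s) * total_rate \<omega> s z) = 1 - exp (- clock \<omega> z r T)"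
    by (auto simp: primitive_on_def clock_empty)
qed

lemma set_integrable_dominated:
  fixes f g :: "real \<Rightarrow> real"
  assumes "set_integrable lborel {a..b} g" "f \<in> borel_measurable borel"
    "\<And>s. a \<le> s \<Longrightarrow> s \<le> b \<Longrightarrow> \<bar>f s\<bar> \<le> g s"
  shows "set_integrable lborel {a..b} f"
  using assms(1)
proof (rule set_integrable_bound)
  show "set_borel_measurable lborel {a..b} f"
    unfolding set_borel_measurable_def using assms(2) by measurable
  show "AE x in lborel. x \<in> {a..b} \<longrightarrow> norm (f x) \<le> norm (g x)"
    using assms(3) by (intro AE_I2) force
qed

lemma inflow_bounds:
  assumes "\<And>y. 0 \<le> exit_prob \<omega> B T n s y \<and> exit_prob \<omega> B T n s y \<le> 1"
  shows "0 \<le> inflow \<omega> B T n s z \<and> inflow \<omega> B T n s z \<le> total_rate \<omega> s z"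
proof
  show "0 \<le> inflow \<omega> B T n s z"
    unfolding inflow_def using assms rate_nonneg by (intro sum_nonneg mult_nonneg_nonneg) auto
  have "\<omega> s (z, y) * exit_prob \<omega> B T n s y \<le> \<omega> s (z, y)" for y
    using assms[of y] rate_nonneg[of s "(z, y)"] by (simp add: mult_left_le)
  then show "inflow \<omega> B T n s z \<le> total_rate \<omega> s z"
    unfolding inflow_def total_rate_def by (intro sum_mono)
qed

lemma exit_prob_bounds: "0 \<le> exit_prob \<omega> B T n r z \<and> exit_prob \<omega> B T n r z \<le> 1"
proof (induction n arbitrary: r z)
  case (Suc n)
  have b: "0 \<le> inflow \<omega> B T n s z \<and> inflow \<omega> B T n s z \<le> total_rate \<omega> s z" for s
    by (rule inflow_bounds) (rule Suc)
  show ?case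
  proof (cases "z \<in> B \<and> r \<le> T")
    case True
    have le: "exp (- clock \<omega> z r s) * inflow \<omega> B T n s z \<le> exp (- clock \<omega> z r s) * total_rate \<omega> s z"
      and nn: "0 \<le> exp (- clock \<omega> z r s) * inflow \<omega> B T n s z" for s
      using b[of s] by (auto intro: mult_left_mono)
    have int: "set_integrable lborel {r..T} (\<lambda>s. exp (- clock \<omega> z r s) * inflow \<omega> B T n s z)"
      by (rule set_integrable_dominated[OF survival_density(1)[of r T z]]) (use le nn in \<open>auto simp: abs_of_nonneg\<close>)
    have "0 \<le> (LBINT s:{r..T}. exp (- clock \<omega> z r s) * inflow \<omega> B T n s z)"
      using nn unfolding set_lebesgue_integral_def by (intro integral_nonneg_AE AE_I2) simp
    moreover have "(LBINT s:{r..T}. exp (- clock \<omega> z r s) * inflow \<omega> B T n s z) \<le>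
       (LBINT s:{r..T}. exp (- clock \<omega> z r s) * total_rate \<omega> s z)"
      using le by (intro set_integral_mono int survival_density(1)) auto
    ultimately show ?thesis
      using True survival_density(2)[of r T z] exit_prob_inside[of z B \<omega> T n r] exp_gt_zero[of "- clock \<omega> z r T"]
      by linarith
  qed (auto simp: exit_prob_outside exit_prob_late)
qed simp

lemma inflow_nonneg: "0 \<le> inflow \<omega> B T n s z"
  and inflow_le_total_rate: "inflow \<omega> B T n s z \<le> total_rate \<omega> s z"
  using inflow_bounds[of B T n s z] exit_prob_bounds by blast+

lemma exit_prob_integrable:
  "set_integrable lborel {r..T} (\<lambda>s. exp (- clock \<omega> z r s) * inflow \<omega> B T n s z)"
  by (rule set_integrable_dominated[OF survival_density(1)[of r T z]])
    (auto simp: abs_mult abs_of_nonneg[OF inflow_nonneg] intro!: mult_left_mono inflow_le_total_rate)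

lemma exit_prob_Suc_mono: "exit_prob \<omega> B T n r z \<le> exit_prob \<omega> B T (Suc n) r z"
proof (induction n arbitrary: r z)
  case 0
  show ?case
    using exit_prob_bounds[of B T "Suc 0" r z]
    by (cases "z \<in> B") (simp_all add: exit_prob_outside)
next
  case (Suc n)
  have "inflow \<omega> B T n s z \<le> inflow \<omega> B T (Suc n) s z" for s
    unfolding inflow_def by (intro sum_mono mult_left_mono Suc rate_nonneg)
  then have "(LBINT s:{r..T}. exp (- clock \<omega> z r s) * inflow \<omega> B T n s z) \<le>
      (LBINT s:{r..T}. exp (- clock \<omega> z r s) * inflow \<omega> B T (Suc n) s z)"
    by (intro set_integral_mono exit_prob_integrable) auto
  then show ?case
    by (cases "z \<in> B") (simp_all add: exit_prob_outside exit_prob_inside)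
qed

text \<open>
  The backward equation in integrated form.  Since \<open>clock r s = clock a s - clock a r\<close>, the
  defining integral is \<open>exp (clock a r)\<close> times an integral over \<open>[r, T]\<close> whose integrand is free of \<open>r\<close>,
  and the product rule applies.
\<close>

lemma exit_prob_primitive:
  assumes z: "z \<in> B"
  shows "primitive_on a T (\<lambda>r. exit_prob \<omega> B T (Suc n) r z)
     (\<lambda>s. total_rate \<omega> s z * exit_prob \<omega> B T (Suc n) s z - inflow \<omega> B T n s z)"
proof -
  let ?h = "\<lambda>s. exp (- clock \<omega> z a s) * inflow \<omega> B T n s z"
  have "primitive_on a T (\<lambda>r. exp (clock \<omega> z a r)) (\<lambda>r. exp (clock \<omega> z a r) * total_rate \<omega> r z)"
    by (rule primitive_on_compose[where \<phi> = exp and \<phi>' = exp, OF clock_primitive])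
      (auto intro!: derivative_eq_intros)
  moreover have "primitive_on a T (\<lambda>r. LBINT s:{r..T}. ?h s) (\<lambda>s. - ?h s)"
    by (rule primitive_on_indefinite_integral(2)[OF exit_prob_integrable])
  ultimately have prim: "primitive_on a T (\<lambda>r. exp (clock \<omega> z a r) * (LBINT s:{r..T}. ?h s))
    (\<lambda>r. exp (clock \<omega> z a r) * total_rate \<omega> r z * (LBINT s:{r..T}. ?h s) + exp (clock \<omega> z a r) * (- ?h r))"
    by (rule primitive_on_mult)
  have eq: "exp (clock \<omega> z a r) * (LBINT s:{r..T}. ?h s) = exit_prob \<omega> B T (Suc n) r z"
    if "a \<le> r" for r
  proof -
    have "exp (clock \<omega> z a r) * (LBINT s:{r..T}. ?h s) = (LBINT s:{r..T}. exp (clock \<omega> z a r) * ?h s)"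
      by simp
    also have "\<dots> = (LBINT s:{r..T}. exp (- clock \<omega> z r s) * inflow \<omega> B T n s z)"
    proof (rule set_lebesgue_integral_cong)
      show "\<forall>s. s \<in> {r..T} \<longrightarrow> exp (clock \<omega> z a r) * ?h s = exp (- clock \<omega> z r s) * inflow \<omega> B T n s z"
      proof safe
        fix s assume "s \<in> {r..T}"
        then have "clock \<omega> z a s = clock \<omega> z a r + clock \<omega> z r s"
          using that by (intro clock_combine) auto
        then show "exp (clock \<omega> z a r) * ?h s = exp (- clock \<omega> z r s) * inflow \<omega> B T n s z"
          by (simp add: mult.assoc[symmetric] exp_add[symmetric])
      qed
    qed simp
    finally show ?thesis by (simp only: exit_prob_inside[OF z])
  qed
  from prim show ?thesis
  proof (rule primitive_on_cong)
    fix t assume "a \<le> t"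
    show "exp (clock \<omega> z a t) * (LBINT s:{t..T}. ?h s) = exit_prob \<omega> B T (Suc n) t z"
      by (rule eq) fact
    have "exp (clock \<omega> z a t) * total_rate \<omega> t z * (LBINT s:{t..T}. ?h s) =
       total_rate \<omega> t z * exit_prob \<omega> B T (Suc n) t z"
      unfolding eq[OF \<open>a \<le> t\<close>, symmetric] by simp
    moreover have "exp (clock \<omega> z a t) * (- ?h t) = - inflow \<omega> B T n t z"
      by (simp add: mult.assoc[symmetric] exp_add[symmetric])
    ultimately show "exp (clock \<omega> z a t) * total_rate \<omega> t z * (LBINT s:{t..T}. ?h s) + exp (clock \<omega> z a t) * (- ?h t)
       = total_rate \<omega> t z * exit_prob \<omega> B T (Suc n) t z - inflow \<omega> B T n t z"
      by (simp only: diff_conv_add_uminus)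
  qed
qed

end

lemma env_shift_apply: "env_shift s x \<omega> t (y, z) = \<omega> (t + s) (y + x, z + x)"
  by (simp add: env_shift_def)

lemma neighbours_shift: "neighbours (z + x) = (\<lambda>y. y + x) ` neighbours z"
proof -
  have "neighbours (z + x) = (\<lambda>y. y + x) ` (\<lambda>y. y + z) ` neighbours 0"
    unfolding image_image add.assoc by (rule neighbours_translate)
  then show ?thesis by (simp only: neighbours_translate[of z])
qed

lemma total_rate_shift: "total_rate (env_shift 0 x \<omega>) t z = total_rate \<omega> t (z + x)"
proof -
  have "total_rate \<omega> t (z + x) = (\<Sum>y\<in>(\<lambda>y. y + x) ` neighbours z. \<omega> t (z + x, y))"
    unfolding total_rate_def neighbours_shift ..
  then show ?thesis by (simp add: total_rate_def sum.reindex env_shift_apply)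
qed

context regular_environment
begin

lemma regular_shift: "regular_environment (env_shift 0 x \<omega>)"
proof
  fix e :: "'d site \<times> 'd site" and t
  obtain y z where e: "e = (y, z)" by (cases e)
  show "e \<in> edges \<Longrightarrow> 0 < env_shift 0 x \<omega> t e" "e \<notin> edges \<Longrightarrow> env_shift 0 x \<omega> t e = 0"
    by (auto simp: e env_shift_apply edges_shift positive zero_off)
qed (auto simp: env_shift_def symmetric locally_integrable split: prod.splits)

text \<open>
  A walk in the shifted environment is a shifted walk, and leaving a larger set is less likely.  Both
  comparisons together let one quenched estimate for \<open>B\<close> control the walks from all starting points
  in the middle of \<open>B\<close>.
\<close>

lemma exit_prob_compare:
  assumes B: "\<And>z. z + x \<in> B \<Longrightarrow> z \<in> B'"
  shows "exit_prob (env_shift 0 x \<omega>) B' T n r z \<le> exit_prob \<omega> B T n r (z + x)"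
proof (induction n arbitrary: r z)
  case 0
  show ?case using B by auto
next
  case (Suc n)
  interpret shift: regular_environment "env_shift 0 x \<omega>" by (rule regular_shift)
  consider "T < r" | "z + x \<notin> B" "r \<le> T" | "z + x \<in> B" "z \<in> B'"
    using B[of z] by linarith
  then show ?case
  proof cases
    case 1
    then show ?thesis by (simp only: exit_prob_late)
  next
    case 2
    then show ?thesis
      using shift.exit_prob_bounds[of B' T "Suc n" r z] by (simp add: exit_prob_outside)
  next
    case 3
    have "inflow (env_shift 0 x \<omega>) B' T n s z \<le> inflow \<omega> B T n s (z + x)" for s
    proof -
      have "inflow (env_shift 0 x \<omega>) B' T n s z \<le>
          (\<Sum>y\<in>neighbours z. \<omega> s (z + x, y + x) * exit_prob \<omega> B T n s (y + x))"
        unfolding inflow_def env_shift_apply add_0_right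
        by (intro sum_mono mult_left_mono Suc rate_nonneg)
      also have "\<dots> = inflow \<omega> B T n s (z + x)"
        unfolding inflow_def neighbours_shift by (simp add: sum.reindex)
      finally show ?thesis .
    qed
    moreover have "clock (env_shift 0 x \<omega>) z r s = clock \<omega> (z + x) r s" for s
      by (simp add: clock_def total_rate_shift)
    ultimately have "(LBINT s:{r..T}. exp (- clock (env_shift 0 x \<omega>) z r s) * inflow (env_shift 0 x \<omega>) B' T n s z)
      \<le> (LBINT s:{r..T}. exp (- clock \<omega> (z + x) r s) * inflow \<omega> B T n s (z + x))"
      by (intro set_integral_mono exit_prob_integrable shift.exit_prob_integrable) auto
    then show ?thesis using 3 by (simp only: exit_prob_inside)
  qed
qed

end

section \<open>The energy estimate\<close>

text \<open>
  The function \<open>u\<^bsup>3/2\<^esup>\<close> as a continuously differentiable function on the whole line; the formula is valid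
  for negative arguments because \<open>sqrt\<close> is extended as an odd function.
\<close>

lemma has_real_derivative_mult_sqrt:
  "((\<lambda>x. x * sqrt x) has_real_derivative 3/2 * sqrt x) (at x)"
proof -
  have pos: "((\<lambda>x. x * sqrt x) has_real_derivative 3/2 * sqrt x) (at x)" if "x > 0" for x
    using that by (auto intro!: derivative_eq_intros simp: field_simps)
  show ?thesis
  proof (cases x "0::real" rule: linorder_cases)
    case greater then show ?thesis by (rule pos)
  next
    case equal
    have "sqrt \<midarrow>0\<rightarrow> sqrt 0" by (intro tendsto_intros)
    then have "sqrt \<midarrow>0\<rightarrow> 0" by simp
    then have "(\<lambda>h. h * sqrt h / h) \<midarrow>0\<rightarrow> 0"
      by (rule Lim_transform_eventually) (auto simp: eventually_at_filter)
    then show ?thesis using equal by (simp add: DERIV_def)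
  next
    case less
    have "((\<lambda>x. (- x) * sqrt (- x)) has_real_derivative (3/2 * sqrt (- x)) * (- 1)) (at x)"
      by (rule DERIV_chain2[where f = "\<lambda>x. x * sqrt x", OF pos]) (use less in \<open>auto intro!: derivative_eq_intros\<close>)
    then show ?thesis by (simp add: real_sqrt_minus)
  qed
qed

text \<open>
  The pointwise form of the Caccioppoli inequality with exponent \<open>3/2\<close>.  In terms of \<open>A = sqrt a\<close> and
  \<open>B = sqrt b\<close> both factors are polynomial: the left hand side is a negative square, which comes
  from the dissipation of energy, plus a mixed term that the square absorbs at the cost of
  \<open>(A + B)\<^sup>3 (\<alpha> - \<beta>)\<^sup>2 / 4\<close>.
\<close>

lemma weighted_sqrt_increment_bound:
  fixes a b \<alpha> \<beta> :: real
  assumes "0 \<le> a" "a \<le> 1" "0 \<le> b" "b \<le> 1"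
  shows "(b - a) * (sqrt a * \<alpha>\<^sup>2 - sqrt b * \<beta>\<^sup>2) \<le> 2 * (\<alpha> - \<beta>)\<^sup>2"
proof -
  define A B where "A = sqrt a" and "B = sqrt b"
  have AB: "0 \<le> A" "A \<le> 1" "0 \<le> B" "B \<le> 1" "a = A\<^sup>2" "b = B\<^sup>2"
    using assms by (auto simp: A_def B_def)
  define s d where "s = A + B" and "d = B - A"
  have s: "0 \<le> s" "s \<le> 2" using AB by (auto simp: s_def)
  let ?q = "d * (\<alpha> + \<beta>) / 2"
  have "(b - a) * (A * \<alpha>\<^sup>2 - B * \<beta>\<^sup>2) = s * (s * d * (\<alpha> - \<beta>) * (\<alpha> + \<beta>) / 2 - d\<^sup>2 * (\<alpha>\<^sup>2 + \<beta>\<^sup>2) / 2)"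
    unfolding AB s_def d_def by (simp add: power2_eq_square field_simps)
  (* Completion of the square; the sum of the squares of alpha and beta is half
     the sum of the squares of alpha + beta and alpha - beta. *)
  also have "\<dots> = s * (s\<^sup>2 * (\<alpha> - \<beta>)\<^sup>2 / 4 - (?q - s * (\<alpha> - \<beta>) / 2)\<^sup>2 - (d * (\<alpha> - \<beta>) / 2)\<^sup>2)"
    by (simp add: power2_eq_square field_simps)
  also have "\<dots> \<le> s * (s\<^sup>2 * (\<alpha> - \<beta>)\<^sup>2 / 4)"
  proof (rule mult_left_mono[OF _ s(1)])
    have "0 \<le> (?q - s * (\<alpha> - \<beta>) / 2)\<^sup>2" "0 \<le> (d * (\<alpha> - \<beta>) / 2)\<^sup>2" by auto
    then show "s\<^sup>2 * (\<alpha> - \<beta>)\<^sup>2 / 4 - (?q - s * (\<alpha> - \<beta>) / 2)\<^sup>2 - (d * (\<alpha> - \<beta>) / 2)\<^sup>2 \<le> s\<^sup>2 * (\<alpha> - \<beta>)\<^sup>2 / 4"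
      by linarith
  qed
  also have "\<dots> = s ^ 3 / 4 * (\<alpha> - \<beta>)\<^sup>2" by (simp add: power2_eq_square power3_eq_cube)
  also have "\<dots> \<le> 2 * (\<alpha> - \<beta>)\<^sup>2"
    using power_mono[OF s(2) s(1), of 3] by (intro mult_right_mono) auto
  finally show ?thesis by (simp add: A_def B_def)
qed

text \<open>
  Symmetry of the weights turns the sum over sites into a sum over bonds, to which the
  inequality for a single bond applies.
\<close>

lemma dirichlet_form_bound:
  fixes w :: "'v \<Rightarrow> 'v \<Rightarrow> real" and v \<eta> :: "'v \<Rightarrow> real"
  assumes w: "\<And>x y. 0 \<le> w x y" "\<And>x y. w x y = w y x" and v: "\<And>x. 0 \<le> v x" "\<And>x. v x \<le> 1"
  shows "(\<Sum>x\<in>V. (\<eta> x)\<^sup>2 * sqrt (v x) * (\<Sum>y\<in>V. w x y * (v y - v x))) \<le>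
    (\<Sum>x\<in>V. \<Sum>y\<in>V. w x y * (\<eta> x - \<eta> y)\<^sup>2)"
proof -
  let ?S = "\<Sum>x\<in>V. \<Sum>y\<in>V. w x y * (v y - v x) * (sqrt (v x) * (\<eta> x)\<^sup>2)"
  have L: "(\<Sum>x\<in>V. (\<eta> x)\<^sup>2 * sqrt (v x) * (\<Sum>y\<in>V. w x y * (v y - v x))) = ?S"
    by (simp add: sum_distrib_left ac_simps)
  have "?S = (\<Sum>y\<in>V. \<Sum>x\<in>V. w x y * (v y - v x) * (sqrt (v x) * (\<eta> x)\<^sup>2))"
    by (rule sum.swap)
  also have "\<dots> = - (\<Sum>x\<in>V. \<Sum>y\<in>V. w x y * (v y - v x) * (sqrt (v y) * (\<eta> y)\<^sup>2))"
    unfolding sum_negf[symmetric] using w(2) by (intro sum.cong refl) (simp add: algebra_simps)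
  finally have "2 * ?S = ?S - (\<Sum>x\<in>V. \<Sum>y\<in>V. w x y * (v y - v x) * (sqrt (v y) * (\<eta> y)\<^sup>2))"
    by linarith
  also have "\<dots> = (\<Sum>x\<in>V. \<Sum>y\<in>V. w x y * ((v y - v x) * (sqrt (v x) * (\<eta> x)\<^sup>2 - sqrt (v y) * (\<eta> y)\<^sup>2)))"
    unfolding sum_subtractf[symmetric] by (intro sum.cong refl) (simp add: algebra_simps)
  also have "\<dots> \<le> (\<Sum>x\<in>V. \<Sum>y\<in>V. w x y * (2 * (\<eta> x - \<eta> y)\<^sup>2))"
    by (intro sum_mono mult_left_mono weighted_sqrt_increment_bound w v)
  also have "\<dots> = 2 * (\<Sum>x\<in>V. \<Sum>y\<in>V. w x y * (\<eta> x - \<eta> y)\<^sup>2)"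
    by (simp add: sum_distrib_left ac_simps)
  finally show ?thesis unfolding L by simp
qed

context regular_environment
begin

text \<open>
  The heart of the proof.  The exit probabilities increase with \<open>n\<close>, so replacing \<open>u\<^sub>n\<close> by \<open>u\<^bsub>n+1\<^esub>\<close> in the
  gain term shows that \<open>u = u\<^bsub>n+1\<^esub>\<close> is a subsolution, \<open>- \<partial>\<^sub>s u \<le> L u\<close> in \<open>B\<close>, with \<open>u = 0\<close> in \<open>B\<close> at the final
  time \<open>T\<close>.  Testing with \<open>\<eta>\<^sup>2 sqrt u\<close> and integrating over \<open>[0, T]\<close> bounds \<open>\<Sum> \<eta>\<^sup>2 u\<^bsup>3/2\<^esup>\<close> at time \<open>0\<close> by the
  energy of the cutoff \<open>\<eta>\<close> alone, and this energy is linear in the conductances.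
\<close>

lemma exit_prob_energy_estimate:
  assumes T: "0 \<le> T" and V: "finite V" "B \<subseteq> V" "\<And>x. x \<in> B \<Longrightarrow> neighbours x \<subseteq> V"
    and \<eta>: "\<And>x. x \<notin> B \<Longrightarrow> \<eta> x = 0"
  shows "(\<Sum>x\<in>B. (\<eta> x)\<^sup>2 * (exit_prob \<omega> B T n 0 x * sqrt (exit_prob \<omega> B T n 0 x))) \<le>
    3/2 * (LBINT s:{0..T}. (\<Sum>x\<in>V. \<Sum>y\<in>V. \<omega> s (x, y) * (\<eta> x - \<eta> y)\<^sup>2))"
proof -
  define u where "u s x = exit_prob \<omega> B T (Suc n) s x" for s x
  have u: "0 \<le> u s x" "u s x \<le> 1" for s x
    using exit_prob_bounds[of B T "Suc n" s x] by (simp_all add: u_def)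
  define k where "k x s = 3/2 * sqrt (u s x) * (inflow \<omega> B T n s x - total_rate \<omega> s x * u s x)" for x s
  have finB: "finite B" using V finite_subset by blast
  (* The backward equation tested with 3/2 sqrt u; the boundary term at time T vanishes. *)
  have prim: "set_integrable lborel {0..T} (k x) \<and> u 0 x * sqrt (u 0 x) = (LBINT s:{0..T}. k x s)" if x: "x \<in> B" for x
  proof -
    have "primitive_on 0 T (\<lambda>s. u s x * sqrt (u s x))
       (\<lambda>s. 3/2 * sqrt (u s x) * (total_rate \<omega> s x * u s x - inflow \<omega> B T n s x))"
      unfolding u_def
      by (rule primitive_on_compose[where \<phi> = "\<lambda>x. x * sqrt x" and \<phi>' = "\<lambda>x. 3/2 * sqrt x", OF exit_prob_primitive[OF x]])
        (rule has_real_derivative_mult_sqrt, intro continuous_intros)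
    then have "primitive_on 0 T (\<lambda>s. - 1 * (u s x * sqrt (u s x)))
      (\<lambda>s. - 1 * (3/2 * sqrt (u s x) * (total_rate \<omega> s x * u s x - inflow \<omega> B T n s x)))"
      by (rule primitive_on_cmult)
    then have p: "primitive_on 0 T (\<lambda>s. - (u s x * sqrt (u s x))) (k x)"
      by (rule primitive_on_cong) (auto simp: k_def algebra_simps)
    have "u T x = 0"
    proof -
      have "set_integrable lborel {T..T} (\<lambda>s. exp (- clock \<omega> x T s) * inflow \<omega> B T n s x)"
        by (rule exit_prob_integrable)
      from set_borel_integral_eq_integral(2)[OF this] show ?thesis
        unfolding u_def exit_prob_inside[OF x] by simp
    qed
    then show ?thesis using p T unfolding primitive_on_def by fastforce
  qed
  let ?R = "\<lambda>s. 3/2 * (\<Sum>x\<in>V. \<Sum>y\<in>V. \<omega> s (x, y) * (\<eta> x - \<eta> y)\<^sup>2)"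
  have R: "set_integrable lborel {0..T} ?R"
    by (intro set_integrable_mult_right set_integrable_sum set_integrable_mult_left locally_integrable)
  have pointwise: "(\<Sum>x\<in>B. (\<eta> x)\<^sup>2 * k x s) \<le> ?R s" if s: "s \<le> T" for s
  proof -
    (* Monotonicity in n is used here: u is a subsolution. *)
    have flow: "inflow \<omega> B T n s x - total_rate \<omega> s x * u s x \<le> (\<Sum>y\<in>V. \<omega> s (x, y) * (u s y - u s x))"
      if x: "x \<in> B" for x
    proof -
      have "inflow \<omega> B T n s x - total_rate \<omega> s x * u s x \<le>
         (\<Sum>y\<in>neighbours x. \<omega> s (x, y) * u s y) - (\<Sum>y\<in>neighbours x. \<omega> s (x, y)) * u s x"
        unfolding inflow_def total_rate_def u_def
        by (intro diff_right_mono sum_mono mult_left_mono exit_prob_Suc_mono rate_nonneg)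
      also have "\<dots> = (\<Sum>y\<in>neighbours x. \<omega> s (x, y) * (u s y - u s x))"
        by (simp add: sum_distrib_right right_diff_distrib sum_subtractf)
      also have "\<dots> = (\<Sum>y\<in>V. \<omega> s (x, y) * (u s y - u s x))"
        using V x by (intro sum.mono_neutral_left) (auto simp: zero_off)
      finally show ?thesis .
    qed
    have "(\<Sum>x\<in>B. (\<eta> x)\<^sup>2 * k x s) = 3/2 * (\<Sum>x\<in>B. (\<eta> x)\<^sup>2 * sqrt (u s x) * (inflow \<omega> B T n s x - total_rate \<omega> s x * u s x))"
      unfolding sum_distrib_left k_def by (intro sum.cong refl) (simp only: ac_simps)
    also have "\<dots> \<le> 3/2 * (\<Sum>x\<in>B. (\<eta> x)\<^sup>2 * sqrt (u s x) * (\<Sum>y\<in>V. \<omega> s (x, y) * (u s y - u s x)))"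
      using flow u by (intro mult_left_mono sum_mono) auto
    also have "\<dots> = 3/2 * (\<Sum>x\<in>V. (\<eta> x)\<^sup>2 * sqrt (u s x) * (\<Sum>y\<in>V. \<omega> s (x, y) * (u s y - u s x)))"
      using V \<eta> by (intro arg_cong[where f = "(*) (3/2)"] sum.mono_neutral_left) auto
    also have "\<dots> \<le> ?R s"
      by (intro mult_left_mono dirichlet_form_bound) (auto simp: rate_nonneg u intro: symmetric)
    finally show ?thesis .
  qed
  have "(\<Sum>x\<in>B. (\<eta> x)\<^sup>2 * (exit_prob \<omega> B T n 0 x * sqrt (exit_prob \<omega> B T n 0 x))) \<le>
     (\<Sum>x\<in>B. (\<eta> x)\<^sup>2 * (u 0 x * sqrt (u 0 x)))"
    unfolding u_def using exit_prob_bounds exit_prob_Suc_mono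
    by (intro sum_mono mult_left_mono mult_mono real_sqrt_le_mono) auto
  also have "\<dots> = (\<Sum>x\<in>B. (LBINT s:{0..T}. (\<eta> x)\<^sup>2 * k x s))"
    using prim by simp
  also have "\<dots> = (LBINT s:{0..T}. \<Sum>x\<in>B. (\<eta> x)\<^sup>2 * k x s)"
    by (intro set_integral_sum[symmetric] set_integrable_mult_right) (use prim in blast)
  also have "\<dots> \<le> (LBINT s:{0..T}. ?R s)"
  proof (rule set_integral_mono[OF _ R])
    show "set_integrable lborel {0..T} (\<lambda>s. \<Sum>x\<in>B. (\<eta> x)\<^sup>2 * k x s)"
      by (intro set_integrable_sum set_integrable_mult_right) (use prim in blast)
  qed (use pointwise in auto)
  finally show ?thesis by simp
qed

end

section \<open>Exit events of the walk\<close>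

lemma space_state_space [simp]: "space state_space = UNIV"
  by (simp add: state_space_def space_pair_measure)

lemma measurable_fixed_site [measurable]: "(\<lambda>r. (r, z)) \<in> borel \<rightarrow>\<^sub>M state_space"
  unfolding state_space_def by measurable

lemma measurable_state_spaceI:
  assumes "\<And>z :: 'd::finite site. (\<lambda>r. F (r, z)) \<in> borel \<rightarrow>\<^sub>M N"
  shows "F \<in> state_space \<rightarrow>\<^sub>M N"
proof -
  have "(\<lambda>p :: ereal \<times> 'd site. F (fst p, snd p)) \<in> borel \<Otimes>\<^sub>M count_space UNIV \<rightarrow>\<^sub>M N"
  proof (rule measurable_compose_countable'[where f = "\<lambda>z p. F (fst p, z)" and g = snd and I = UNIV])
    fix z :: "'d site"
    show "(\<lambda>p :: ereal \<times> 'd site. F (fst p, z)) \<in> borel \<Otimes>\<^sub>M count_space UNIV \<rightarrow>\<^sub>M N"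
      by (rule measurable_compose[OF measurable_fst assms])
  qed auto
  then show ?thesis by (simp add: state_space_def)
qed

text \<open>
  The path event whose probability \<open>exit_prob\<close> is shown to dominate.
\<close>

definition exits_within :: "'d::finite site set \<Rightarrow> real \<Rightarrow> nat \<Rightarrow> 'd walk \<Rightarrow> bool" where
  "exits_within B T n w \<longleftrightarrow> (\<exists>i\<le>n. fst (w i) \<le> ereal T \<and> snd (w i) \<notin> B)"

lemma exits_within_measurable:
  fixes B :: "'d::finite site set"
  assumes "\<And>i. i \<le> n \<Longrightarrow> (\<lambda>w. w i) \<in> M \<rightarrow>\<^sub>M state_space"
  shows "Measurable.pred M (exits_within B T n)"
proof -
  have target: "Measurable.pred state_space (\<lambda>p. fst p \<le> ereal T \<and> snd p \<notin> B)"
    by (rule measurable_state_spaceI, unfold fst_conv snd_conv, measurable)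
  have "Measurable.pred M (\<lambda>w. fst (w i) \<le> ereal T \<and> snd (w i) \<notin> B)" if "i \<in> {..n}" for i
    using that by (intro measurable_compose[OF assms[of i] target]) simp
  then have "Measurable.pred M (\<lambda>w. \<exists>i\<in>{..n}. fst (w i) \<le> ereal T \<and> snd (w i) \<notin> B)"
    by (rule pred_intros_finite(4)[OF finite_atMost])
  then show ?thesis unfolding exits_within_def[abs_def] Bex_def atMost_iff .
qed

context regular_environment
begin

lemma total_rate_sum: "(\<Sum>y\<in>neighbours z. \<omega> j (z, y)) = total_rate \<omega> j z"
  by (simp add: total_rate_def)

lemma pmf_jump_pmf: "pmf (jump_pmf \<omega> j z) y = \<omega> j (z, y) / total_rate \<omega> j z"
  unfolding jump_pmf_def
proof (rule pmf_embed_pmf)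
  show "0 \<le> \<omega> j (z, x) / total_rate \<omega> j z" for x
    using rate_nonneg total_rate_nonneg by (intro divide_nonneg_nonneg)
  have "(\<integral>\<^sup>+ x. ennreal (\<omega> j (z, x) / total_rate \<omega> j z) \<partial>count_space UNIV) =
      (\<Sum>y\<in>neighbours z. ennreal (\<omega> j (z, y) / total_rate \<omega> j z))"
    by (rule nn_integral_count_space') (auto simp: zero_off)
  also have "\<dots> = ennreal (\<Sum>y\<in>neighbours z. \<omega> j (z, y) / total_rate \<omega> j z)"
    by (intro sum_ennreal divide_nonneg_nonneg rate_nonneg total_rate_nonneg)
  also have "(\<Sum>y\<in>neighbours z. \<omega> j (z, y) / total_rate \<omega> j z) = 1"
    using total_rate_pos[of j z] by (simp add: sum_divide_distrib[symmetric] total_rate_sum)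
  finally show "(\<integral>\<^sup>+ x. ennreal (\<omega> j (z, x) / total_rate \<omega> j z) \<partial>count_space UNIV) = 1" by simp
qed

lemma nn_integral_jump_pmf:
  "(\<integral>\<^sup>+ y. f y \<partial>measure_pmf (jump_pmf \<omega> j z)) =
     (\<Sum>y\<in>neighbours z. ennreal (\<omega> j (z, y) / total_rate \<omega> j z) * f y)"
  unfolding nn_integral_measure_pmf pmf_jump_pmf
  by (rule nn_integral_count_space') (auto simp: zero_off)

text \<open>
  The law of the next arrival, given that the walk leaves \<open>z\<close> at time \<open>j\<close>.
\<close>

definition landing :: "'d site \<Rightarrow> ereal \<Rightarrow> (ereal \<times> 'd site) measure" where
  "landing z j = (if j = \<infinity> then return state_space (\<infinity>, z)
     else distr (measure_pmf (jump_pmf \<omega> (real_of_ereal j) z)) state_space (\<lambda>y. (j, y)))"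

lemma jump_kernel_eq: "jump_kernel \<omega> (r, z) =
   (if r = \<infinity> then return state_space (\<infinity>, z) else hold_law \<omega> (real_of_ereal r) z \<bind> landing z)"
  unfolding jump_kernel_def landing_def[abs_def] by simp

lemma prob_space_landing: "prob_space (landing z j)"
  unfolding landing_def
  by (auto intro!: prob_space_return prob_space.prob_space_distr measure_pmf.prob_space_axioms)

lemma sets_landing [simp]: "sets (landing z j) = sets state_space"
  by (simp add: landing_def)

lemma nn_integral_landing:
  assumes [measurable]: "f \<in> borel_measurable state_space"
  shows "(\<integral>\<^sup>+ p. f p \<partial>landing z j) = (if j = \<infinity> then f (\<infinity>, z)
    else (\<Sum>y\<in>neighbours z. ennreal (\<omega> (real_of_ereal j) (z, y) / total_rate \<omega> (real_of_ereal j) z) * f (j, y)))"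
  by (auto simp: landing_def nn_integral_return nn_integral_distr nn_integral_jump_pmf)

lemma landing_measurable: "landing z \<in> borel \<rightarrow>\<^sub>M subprob_algebra state_space"
proof (rule measurable_subprob_algebra)
  fix A :: "(ereal \<times> 'd site) set" assume A [measurable]: "A \<in> sets state_space"
  have "emeasure (landing z j) A = (if j = \<infinity> then indicator A (\<infinity>, z)
    else (\<Sum>y\<in>neighbours z. ennreal (\<omega> (real_of_ereal j) (z, y) / total_rate \<omega> (real_of_ereal j) z) * indicator A (j, y)))" for j
    using nn_integral_landing[of "indicator A" z j] by simp
  moreover have [measurable]: "(\<lambda>j. indicator A (j, y) :: ennreal) \<in> borel_measurable borel" for y
    by (rule measurable_compose[OF measurable_fixed_site]) measurable
  ultimately show "(\<lambda>j. emeasure (landing z j) A) \<in> borel_measurable borel" by simp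
qed (auto intro: prob_space_imp_subprob_space prob_space_landing)

lemma jump_kernel_measurable: "jump_kernel \<omega> \<in> state_space \<rightarrow>\<^sub>M subprob_algebra state_space"
proof (rule measurable_state_spaceI)
  fix z :: "'d site"
  have [measurable]: "(\<lambda>r. hold_law \<omega> (real_of_ereal r) z) \<in> borel \<rightarrow>\<^sub>M subprob_algebra borel"
    by (rule measurable_prob_algebraD[OF hold_law_measurable])
  note landing_measurable [measurable]
  show "(\<lambda>r. jump_kernel \<omega> (r, z)) \<in> borel \<rightarrow>\<^sub>M subprob_algebra state_space"
    unfolding jump_kernel_eq by measurable
qed

lemma prob_space_jump_kernel: "prob_space (jump_kernel \<omega> p)"
proof (cases p)
  case (Pair r z)
  have l: "landing z \<in> hold_law \<omega> (real_of_ereal r) z \<rightarrow>\<^sub>M subprob_algebra state_space"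
    using landing_measurable by (simp cong: measurable_cong_sets)
  show ?thesis unfolding Pair jump_kernel_eq
    by (auto intro!: prob_space_return prob_space.prob_space_bind[OF prob_space_hold_law _ l] prob_space_landing)
qed

lemma nn_integral_jump_kernel:
  assumes f [measurable]: "f \<in> borel_measurable state_space" and f0: "\<And>j y. ereal T < j \<Longrightarrow> f (j, y) = 0"
    and r: "r \<noteq> \<infinity>"
  shows "(\<integral>\<^sup>+ p. f p \<partial>jump_kernel \<omega> (r, z)) = (\<integral>\<^sup>+ s. ennreal (exp (- clock \<omega> z (real_of_ereal r) s)) *
     (\<Sum>y\<in>neighbours z. ennreal (\<omega> s (z, y)) * f (ereal s, y)) * indicator {real_of_ereal r..T} s \<partial>lborel)"
proof -
  have l: "landing z \<in> hold_law \<omega> (real_of_ereal r) z \<rightarrow>\<^sub>M subprob_algebra state_space"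
    using landing_measurable by (simp cong: measurable_cong_sets)
  note [measurable] = measurable_compose[OF measurable_fixed_site f]
  let ?g = "\<lambda>j. if j = \<infinity> then f (\<infinity>, z)
    else (\<Sum>y\<in>neighbours z. ennreal (\<omega> (real_of_ereal j) (z, y) / total_rate \<omega> (real_of_ereal j) z) * f (j, y))"
  have "(\<integral>\<^sup>+ p. f p \<partial>jump_kernel \<omega> (r, z)) = (\<integral>\<^sup>+ j. ?g j \<partial>hold_law \<omega> (real_of_ereal r) z)"
    using r by (simp add: jump_kernel_eq nn_integral_bind[OF f l] nn_integral_landing)
  also have "\<dots> = (\<integral>\<^sup>+ s. ennreal (total_rate \<omega> s z * exp (- clock \<omega> z (real_of_ereal r) s)) * ?g (ereal s) *
      indicator {real_of_ereal r..T} s \<partial>lborel)"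
  proof (rule nn_integral_hold_law)
    show "?g \<in> borel_measurable borel" by measurable
  qed (use f0 in auto)
  also have "\<dots> = (\<integral>\<^sup>+ s. ennreal (exp (- clock \<omega> z (real_of_ereal r) s)) *
     (\<Sum>y\<in>neighbours z. ennreal (\<omega> s (z, y)) * f (ereal s, y)) * indicator {real_of_ereal r..T} s \<partial>lborel)"
  proof (rule nn_integral_cong, rule arg_cong2[where f = "(*)", OF _ refl])
    fix s
    have "ennreal (total_rate \<omega> s z * e) * (ennreal (\<omega> s (z, y) / total_rate \<omega> s z) * c) =
        ennreal e * (ennreal (\<omega> s (z, y)) * c)" if "0 \<le> e" for y e c
    proof -
      have "ennreal (total_rate \<omega> s z * e) * ennreal (\<omega> s (z, y) / total_rate \<omega> s z) = ennreal e * ennreal (\<omega> s (z, y))"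
        using total_rate_pos[of s z] rate_nonneg[of s "(z, y)"] that
        by (simp add: ennreal_mult[symmetric] del: ennreal_mult')
      then show ?thesis by (metis mult.assoc)
    qed
    then show "ennreal (total_rate \<omega> s z * exp (- clock \<omega> z (real_of_ereal r) s)) * ?g (ereal s) =
      ennreal (exp (- clock \<omega> z (real_of_ereal r) s)) * (\<Sum>y\<in>neighbours z. ennreal (\<omega> s (z, y)) * f (ereal s, y))"
      by (simp add: sum_distrib_left)
  qed
  finally show ?thesis .
qed

text \<open>
  The exit probability as a function on the state space of the chain of arrivals.  At the arrival time
  \<open>- \<infinity>\<close> it takes the value at time \<open>0\<close>, as the jump kernel does.
\<close>

definition exit_value :: "'d site set \<Rightarrow> real \<Rightarrow> nat \<Rightarrow> ereal \<times> 'd site \<Rightarrow> ennreal" where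
  "exit_value B T n p = (if fst p = \<infinity> then 0 else ennreal (exit_prob \<omega> B T n (real_of_ereal (fst p)) (snd p)))"

lemma exit_value_measurable [measurable]: "exit_value B T n \<in> borel_measurable state_space"
  unfolding exit_value_def by (rule measurable_state_spaceI, unfold fst_conv snd_conv, measurable)

lemma exit_value_le_1: "exit_value B T n p \<le> 1"
  using exit_prob_bounds by (auto simp: exit_value_def)

lemma exit_value_outside: "0 \<le> T \<Longrightarrow> fst p \<le> ereal T \<Longrightarrow> snd p \<notin> B \<Longrightarrow> exit_value B T n p = 1"
  by (cases "fst p") (auto simp: exit_value_def exit_prob_outside)

lemma exit_value_late: "ereal T < j \<Longrightarrow> exit_value B T n (j, y) = 0"
  by (cases j) (auto simp: exit_value_def exit_prob_late)

text \<open>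
  Equality holds for states in \<open>B\<close>, by the recursion for \<open>exit_prob\<close>.  Outside \<open>B\<close> the right hand side is
  \<open>1\<close> up to time \<open>T\<close>, and after time \<open>T\<close> both sides vanish.
\<close>

lemma exit_value_superharmonic:
  "(\<integral>\<^sup>+ q. exit_value B T n q \<partial>jump_kernel \<omega> p) \<le> exit_value B T (Suc n) p"
proof -
  obtain r z where p: "p = (r, z)" by (cases p)
  let ?r = "real_of_ereal r"
  interpret K: prob_space "jump_kernel \<omega> p" by (rule prob_space_jump_kernel)
  show ?thesis
  proof (cases "r = \<infinity>")
    case True
    then show ?thesis
      by (simp add: p jump_kernel_eq nn_integral_return) (simp add: exit_value_def)
  next
    case False
    have "(\<integral>\<^sup>+ q. exit_value B T n q \<partial>jump_kernel \<omega> p) =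
        (\<integral>\<^sup>+ s. ennreal (exp (- clock \<omega> z ?r s)) *
        (\<Sum>y\<in>neighbours z. ennreal (\<omega> s (z, y)) * exit_value B T n (ereal s, y)) * indicator {?r..T} s \<partial>lborel)"
      unfolding p by (rule nn_integral_jump_kernel[OF exit_value_measurable exit_value_late False])
    also have "\<dots> = (\<integral>\<^sup>+ s. ennreal (indicator {?r..T} s *\<^sub>R (exp (- clock \<omega> z ?r s) * inflow \<omega> B T n s z)) \<partial>lborel)"
    proof (rule nn_integral_cong)
      fix s
      have "(\<Sum>y\<in>neighbours z. ennreal (\<omega> s (z, y)) * exit_value B T n (ereal s, y)) = ennreal (inflow \<omega> B T n s z)"
        unfolding inflow_def
        by (subst sum_ennreal[symmetric])
          (auto simp: exit_value_def ennreal_mult rate_nonneg exit_prob_bounds)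
      then show "ennreal (exp (- clock \<omega> z ?r s)) *
        (\<Sum>y\<in>neighbours z. ennreal (\<omega> s (z, y)) * exit_value B T n (ereal s, y)) * indicator {?r..T} s
        = ennreal (indicator {?r..T} s *\<^sub>R (exp (- clock \<omega> z ?r s) * inflow \<omega> B T n s z))"
        by (simp add: indicator_def ennreal_mult inflow_nonneg)
    qed
    also have "\<dots> = ennreal (LBINT s:{?r..T}. exp (- clock \<omega> z ?r s) * inflow \<omega> B T n s z)"
      using exit_prob_integrable[of ?r T z B n]
      unfolding set_lebesgue_integral_def set_integrable_def
      by (intro nn_integral_eq_integral) (auto simp: inflow_nonneg)
    finally have eq: "(\<integral>\<^sup>+ q. exit_value B T n q \<partial>jump_kernel \<omega> p) =
      ennreal (LBINT s:{?r..T}. exp (- clock \<omega> z ?r s) * inflow \<omega> B T n s z)" .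
    consider "z \<in> B" | "z \<notin> B" "?r \<le> T" | "T < ?r" by linarith
    then show ?thesis
    proof cases
      case 1
      then show ?thesis using False unfolding eq by (simp add: p exit_value_def exit_prob_inside)
    next
      case 2
      have "(\<integral>\<^sup>+ q. exit_value B T n q \<partial>jump_kernel \<omega> p) \<le> (\<integral>\<^sup>+ q. 1 \<partial>jump_kernel \<omega> p)"
        by (intro nn_integral_mono exit_value_le_1)
      also have "\<dots> = 1" by (simp add: K.emeasure_space_1)
      finally show ?thesis using 2 False by (simp add: p exit_value_def exit_prob_outside)
    next
      case 3
      then show ?thesis unfolding eq by (simp add: set_lebesgue_integral_def)
    qed
  qed
qed

lemma step_kernel_measurable:
  "step_kernel \<omega> s x n \<in> PiM {0..<n} (\<lambda>_. state_space) \<rightarrow>\<^sub>M subprob_algebra state_space"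
proof (cases n)
  case 0
  have "subprob_space (return state_space (ereal s, x))"
    by (intro prob_space_imp_subprob_space prob_space_return) simp
  then show ?thesis
    using 0 unfolding step_kernel_def by (simp add: space_subprob_algebra)
next
  case (Suc m)
  have "(\<lambda>h. h m) \<in> PiM {0..<n} (\<lambda>_. state_space :: (ereal \<times> 'd site) measure) \<rightarrow>\<^sub>M state_space"
    by (rule measurable_component_singleton) (simp add: Suc)
  then have "(\<lambda>h. jump_kernel \<omega> (h m)) \<in> PiM {0..<n} (\<lambda>_. state_space) \<rightarrow>\<^sub>M subprob_algebra state_space"
    by (rule measurable_compose[OF _ jump_kernel_measurable])
  then show ?thesis using Suc by (simp add: step_kernel_def[abs_def])
qed

lemma prob_space_step_kernel: "prob_space (step_kernel \<omega> s x n h)"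
  unfolding step_kernel_def by (auto intro!: prob_space_return prob_space_jump_kernel)

sublocale walk: Ionescu_Tulcea "step_kernel \<omega> s x" "\<lambda>_. state_space" for s x
  by (rule Ionescu_Tulcea.intro) (rule step_kernel_measurable, rule prob_space_step_kernel)

lemma walk_law_eq: "walk_law \<omega> s x = walk.PF.lim s x"
  by (simp add: walk_law_def)

lemma sets_walk_law [measurable_cong]: "sets (walk_law \<omega> s x) = sets (PiM UNIV (\<lambda>_. state_space))"
  unfolding walk_law_eq by simp

lemma space_walk_law [simp]: "space (walk_law \<omega> s x) = UNIV"
  using sets_eq_imp_space_eq[OF sets_walk_law] by (simp add: space_PiM)

lemma measurable_walk_coordinate [measurable]: "(\<lambda>w. w i) \<in> walk_law \<omega> s x \<rightarrow>\<^sub>M state_space"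
proof -
  have "(\<lambda>w. w i) \<in> PiM UNIV (\<lambda>_. state_space :: (ereal \<times> 'd site) measure) \<rightarrow>\<^sub>M state_space"
    by (rule measurable_component_singleton) simp
  then show ?thesis by (simp cong: measurable_cong_sets add: sets_walk_law)
qed

lemma emeasure_walk_law_initial_segment:
  assumes X: "X \<in> sets (PiM {0..<n} (\<lambda>_. state_space))"
  shows "emeasure (walk_law \<omega> s x) {w. restrict w {0..<n} \<in> X} = emeasure (walk.C s x 0 n (\<lambda>_. undefined)) X"
proof -
  have "{w. restrict w {0..<n} \<in> X} = prod_emb UNIV (\<lambda>_. state_space) {0..<n} X"
    by (auto simp: prod_emb_def space_PiM)
  moreover have "prod_emb {0..<n} (\<lambda>_. state_space) {0..<n} X = X"
    using sets.sets_into_space[OF X] by (intro prod_emb_id) (simp add: space_PiM)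
  ultimately show ?thesis
    unfolding walk_law_eq using X by (simp add: walk.lim walk.emeasure_CI[of "{0..<n}" n])
qed

lemma prob_space_walk_law: "prob_space (walk_law \<omega> s x)"
proof
  interpret C: prob_space "walk.C s x 0 0 (\<lambda>_. undefined)" by (rule walk.prob_space_C) simp
  let ?X = "space (PiM {0..<0} (\<lambda>_. state_space)) :: (nat \<Rightarrow> ereal \<times> 'd site) set"
  have "space (walk_law \<omega> s x) = {w. restrict w {0..<0} \<in> ?X}"
    by (auto simp: space_PiM)
  then have "emeasure (walk_law \<omega> s x) (space (walk_law \<omega> s x)) = emeasure (walk.C s x 0 0 (\<lambda>_. undefined)) ?X"
    by (simp only: emeasure_walk_law_initial_segment[OF sets.top])
  also have "?X = space (walk.C s x 0 0 (\<lambda>_. undefined))"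
    using walk.space_C[of "\<lambda>_. undefined" 0 s x 0] by simp
  finally show "emeasure (walk_law \<omega> s x) (space (walk_law \<omega> s x)) = 1"
    using C.emeasure_space_1 by simp
qed

lemma nn_integral_C_Suc:
  assumes f: "f \<in> borel_measurable (PiM {0..<Suc n} (\<lambda>_. state_space))"
  shows "(\<integral>\<^sup>+ h. f h \<partial>walk.C s x 0 (Suc n) (\<lambda>_. undefined)) =
    (\<integral>\<^sup>+ h. (\<integral>\<^sup>+ p. f (h(n := p)) \<partial>step_kernel \<omega> s x n h) \<partial>walk.C s x 0 n (\<lambda>_. undefined))"
proof -
  have eP: "walk.eP s x n \<in> walk.C s x 0 n (\<lambda>_. undefined) \<rightarrow>\<^sub>M subprob_algebra (PiM {0..<Suc n} (\<lambda>_. state_space))"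
    using walk.measurable_eP[of s x n] walk.sets_C[of "\<lambda>_. undefined" 0 s x n]
    by (simp cong: measurable_cong_sets)
  have "(\<integral>\<^sup>+ h. f h \<partial>walk.C s x 0 (Suc n) (\<lambda>_. undefined)) =
    (\<integral>\<^sup>+ h. (\<integral>\<^sup>+ h'. f h' \<partial>walk.eP s x n h) \<partial>walk.C s x 0 n (\<lambda>_. undefined))"
    using nn_integral_bind[OF f eP] by simp
  also have "\<dots> = (\<integral>\<^sup>+ h. (\<integral>\<^sup>+ p. f (h(n := p)) \<partial>step_kernel \<omega> s x n h) \<partial>walk.C s x 0 n (\<lambda>_. undefined))"
    by (intro nn_integral_cong walk.nn_integral_eP f) (simp add: walk.space_C)
  finally show ?thesis .
qed

lemma walk_start: "AE w in walk_law \<omega> s x. w 0 = (ereal s, x)"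
proof -
  let ?S = "PiM {0..<1} (\<lambda>_. state_space) :: (nat \<Rightarrow> ereal \<times> 'd site) measure"
  have single: "{(ereal s, x)} \<in> sets state_space"
  proof -
    have "{ereal s} \<times> {x} \<in> sets (borel \<Otimes>\<^sub>M count_space UNIV)" by (rule pair_measureI) auto
    moreover have "{ereal s} \<times> {x} = {(ereal s, x)}" by auto
    ultimately show ?thesis by (simp add: state_space_def)
  qed
  define X where "X = {h \<in> space ?S. h 0 \<noteq> (ereal s, x)}"
  have X: "X \<in> sets ?S"
  proof -
    have "(\<lambda>h. h 0) \<in> ?S \<rightarrow>\<^sub>M state_space" by (rule measurable_component_singleton) simp
    moreover have "space state_space - {(ereal s, x)} \<in> sets state_space"
      using single by (rule sets.compl_sets)
    ultimately have "(\<lambda>h. h 0) -` (space state_space - {(ereal s, x)}) \<inter> space ?S \<in> sets ?S"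
      by (rule measurable_sets)
    moreover have "(\<lambda>h. h 0) -` (space state_space - {(ereal s, x)}) \<inter> space ?S = X"
      by (auto simp: X_def)
    ultimately show ?thesis by simp
  qed
  have "emeasure (walk_law \<omega> s x) {w. w 0 \<noteq> (ereal s, x)} = emeasure (walk_law \<omega> s x) {w. restrict w {0..<1} \<in> X}"
    by (intro arg_cong2[where f = emeasure]) (auto simp: X_def space_PiM)
  also have "\<dots> = emeasure (walk.C s x 0 (Suc 0) (\<lambda>_. undefined)) X"
    unfolding One_nat_def by (rule emeasure_walk_law_initial_segment) (use X in simp)
  also have "\<dots> = (\<integral>\<^sup>+ h. indicator X h \<partial>walk.C s x 0 (Suc 0) (\<lambda>_. undefined))"
    using X walk.sets_C[of "\<lambda>_. undefined" 0 s x "Suc 0"] by (intro nn_integral_indicator[symmetric]) simp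
  also have "\<dots> = (\<integral>\<^sup>+ h. (\<integral>\<^sup>+ p. indicator X (h(0 := p)) \<partial>step_kernel \<omega> s x 0 h) \<partial>walk.C s x 0 0 (\<lambda>_. undefined))"
    using X by (intro nn_integral_C_Suc) simp
  also have "\<dots> = 0"
  proof -
    have m: "(\<lambda>p. indicator X ((\<lambda>_. undefined)(0 := p)) :: ennreal) \<in> borel_measurable state_space"
      by (rule measurable_compose[OF _ borel_measurable_indicator[OF X]], rule measurable_fun_upd[where J = "{}"]) auto
    have "(\<integral>\<^sup>+ p. indicator X (h(0 := p)) \<partial>step_kernel \<omega> s x 0 h) = 0"
      if h: "h \<in> space (walk.C s x 0 0 (\<lambda>_. undefined))" for h
    proof -
      have "h = (\<lambda>_. undefined)" using h by (auto simp: space_PiM)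
      then show ?thesis using m by (simp add: step_kernel_def nn_integral_return X_def)
    qed
    then show ?thesis by (simp cong: nn_integral_cong_simp del: walk.C.simps)
  qed
  finally show ?thesis
    using measurable_sets[OF measurable_walk_coordinate[of 0 s x] sets.compl_sets[OF single]]
    by (intro AE_I[where N = "{w. w 0 \<noteq> (ereal s, x)}"]) (auto simp: vimage_def)
qed

text \<open>
  With \<open>N\<close> jumps allowed in all, \<open>exit_value B T (N - j)\<close> evaluated at the \<open>j\<close>-th arrival and stopped at the
  first exit is a supermartingale.
\<close>

lemma walk_exit_initial_segment:
  assumes T: "0 \<le> T"
  shows "(\<integral>\<^sup>+ h. (if exits_within B T j h then 1 else exit_value B T n (h j)) \<partial>walk.C s x 0 (Suc j) (\<lambda>_. undefined))
    \<le> exit_value B T (n + j) (ereal s, x)"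
proof (induction j arbitrary: n)
  have coord: "(\<lambda>h. h i) \<in> PiM {0..<Suc j} (\<lambda>_. state_space :: (ereal \<times> 'd site) measure) \<rightarrow>\<^sub>M state_space"
    if "i < Suc j" for i j
    using that by (intro measurable_component_singleton) auto
  have meas: "(\<lambda>h. if exits_within B T j h then 1 else exit_value B T n (h j)) \<in> borel_measurable (PiM {0..<Suc j} (\<lambda>_. state_space))"
    for j n
  proof -
    have "Measurable.pred (PiM {0..<Suc j} (\<lambda>_. state_space)) (exits_within B T j)"
    proof (rule exits_within_measurable)
      show "(\<lambda>w. w i) \<in> PiM {0..<Suc j} (\<lambda>_. state_space :: (ereal \<times> 'd site) measure) \<rightarrow>\<^sub>M state_space" if "i \<le> j" for i
        by (rule coord) (use that in simp)
    qed
    moreover have "(\<lambda>h. exit_value B T n (h j)) \<in> borel_measurable (PiM {0..<Suc j} (\<lambda>_. state_space))"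
      by (rule measurable_compose[OF coord[OF lessI] exit_value_measurable])
    ultimately show ?thesis by (intro measurable_If) (auto simp: pred_def)
  qed
  {
    case 0
    let ?h0 = "\<lambda>_::nat. undefined :: ereal \<times> 'd site"
    have "(\<integral>\<^sup>+ h. (if exits_within B T 0 h then 1 else exit_value B T n (h 0)) \<partial>walk.C s x 0 (Suc 0) ?h0) =
      (\<integral>\<^sup>+ h. (\<integral>\<^sup>+ p. (if exits_within B T 0 (h(0 := p)) then 1 else exit_value B T n p) \<partial>step_kernel \<omega> s x 0 h) \<partial>walk.C s x 0 0 ?h0)"
      unfolding nn_integral_C_Suc[OF meas[of 0 n]] fun_upd_same ..
    also have "\<dots> = (\<integral>\<^sup>+ h. exit_value B T n (ereal s, x) \<partial>walk.C s x 0 0 ?h0)"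
    proof (rule nn_integral_cong)
      fix h
      have "(if exits_within B T 0 (h(0 := p)) then 1 else exit_value B T n p) = exit_value B T n p" for p
        using exit_value_outside[OF T, of p B n] by (auto simp: exits_within_def)
      then show "(\<integral>\<^sup>+ p. (if exits_within B T 0 (h(0 := p)) then 1 else exit_value B T n p) \<partial>step_kernel \<omega> s x 0 h) =
        exit_value B T n (ereal s, x)"
        by (simp add: step_kernel_def nn_integral_return)
    qed
    also have "\<dots> = exit_value B T n (ereal s, x)"
      using prob_space.emeasure_space_1[OF walk.prob_space_C[of ?h0 0 s x 0]] by simp
    finally show ?case by simp
  next
    case (Suc j)
    have "(\<integral>\<^sup>+ h. (if exits_within B T (Suc j) h then 1 else exit_value B T n (h (Suc j))) \<partial>walk.C s x 0 (Suc (Suc j)) (\<lambda>_. undefined)) =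
      (\<integral>\<^sup>+ h. (\<integral>\<^sup>+ p. (if exits_within B T (Suc j) (h(Suc j := p)) then 1 else exit_value B T n p) \<partial>step_kernel \<omega> s x (Suc j) h)
        \<partial>walk.C s x 0 (Suc j) (\<lambda>_. undefined))"
      unfolding nn_integral_C_Suc[OF meas[of "Suc j" n]] fun_upd_same ..
    also have "\<dots> \<le> (\<integral>\<^sup>+ h. (if exits_within B T j h then 1 else exit_value B T (Suc n) (h j)) \<partial>walk.C s x 0 (Suc j) (\<lambda>_. undefined))"
    proof (rule nn_integral_mono)
      fix h
      interpret K: prob_space "step_kernel \<omega> s x (Suc j) h" by (rule prob_space_step_kernel)
      show "(\<integral>\<^sup>+ p. (if exits_within B T (Suc j) (h(Suc j := p)) then 1 else exit_value B T n p) \<partial>step_kernel \<omega> s x (Suc j) h)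
        \<le> (if exits_within B T j h then 1 else exit_value B T (Suc n) (h j))"
      proof (cases "exits_within B T j h")
        case True
        then obtain i where "i \<le> j" "fst (h i) \<le> ereal T" "snd (h i) \<notin> B" by (auto simp: exits_within_def)
        then have "exits_within B T (Suc j) (h(Suc j := p))" for p
          by (auto simp: exits_within_def intro!: exI[of _ i])
        then show ?thesis using True by (simp add: K.emeasure_space_1)
      next
        case False
        have "(if exits_within B T (Suc j) (h(Suc j := p)) then 1 else exit_value B T n p) = exit_value B T n p" for p
          using False exit_value_outside[OF T, of p B n] by (auto simp: exits_within_def le_Suc_eq)
        then show ?thesis
          using False exit_value_superharmonic[where p = "h j"] by (simp add: step_kernel_def)
      qed
    qed
    also have "\<dots> \<le> exit_value B T (Suc n + j) (ereal s, x)" by (rule Suc.IH)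
    finally show ?case by simp
  }
qed

lemma emeasure_walk_exit_le:
  assumes T: "0 \<le> T"
  shows "emeasure (walk_law \<omega> s x) {w. \<exists>n. exits_within B T n w} \<le> (SUP n. ennreal (exit_prob \<omega> B T n s x))"
proof -
  have E: "{w. exits_within B T n w} \<in> sets (walk_law \<omega> s x)" for n
  proof -
    have "Measurable.pred (walk_law \<omega> s x) (exits_within B T n)"
      by (rule exits_within_measurable) (rule measurable_walk_coordinate)
    then show ?thesis by (simp add: pred_def)
  qed
  have le: "emeasure (walk_law \<omega> s x) {w. exits_within B T n w} \<le> ennreal (exit_prob \<omega> B T n s x)" for n
  proof -
    let ?S = "PiM {0..<Suc n} (\<lambda>_. state_space) :: (nat \<Rightarrow> ereal \<times> 'd site) measure"
    define X where "X = {h \<in> space ?S. exits_within B T n h}"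
    have X: "X \<in> sets ?S"
    proof -
      have "Measurable.pred ?S (exits_within B T n)"
      proof (rule exits_within_measurable)
        fix i assume "i \<le> n"
        then show "(\<lambda>h. h i) \<in> ?S \<rightarrow>\<^sub>M state_space"
          by (intro measurable_component_singleton) auto
      qed
      then show ?thesis by (simp add: pred_def X_def)
    qed
    have "emeasure (walk_law \<omega> s x) {w. exits_within B T n w} = emeasure (walk_law \<omega> s x) {w. restrict w {0..<Suc n} \<in> X}"
    proof -
      have "exits_within B T n (restrict w {0..<Suc n}) = exits_within B T n w" for w
        unfolding exits_within_def by (simp add: less_Suc_eq_le cong: conj_cong)
      moreover have "restrict w {0..<Suc n} \<in> space ?S" for w :: "nat \<Rightarrow> ereal \<times> 'd site"
        by (simp add: space_PiM)
      ultimately have "{w. exits_within B T n w} = {w. restrict w {0..<Suc n} \<in> X}"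
        unfolding X_def by blast
      then show ?thesis by (rule arg_cong[where f = "emeasure (walk_law \<omega> s x)"])
    qed
    also have "\<dots> = emeasure (walk.C s x 0 (Suc n) (\<lambda>_. undefined)) X"
      by (rule emeasure_walk_law_initial_segment[OF X])
    also have "\<dots> = (\<integral>\<^sup>+ h. indicator X h \<partial>walk.C s x 0 (Suc n) (\<lambda>_. undefined))"
      using X walk.sets_C[of "\<lambda>_. undefined" 0 s x "Suc n"] by (intro nn_integral_indicator[symmetric]) simp
    also have "\<dots> \<le> (\<integral>\<^sup>+ h. (if exits_within B T n h then 1 else exit_value B T 0 (h n))
        \<partial>walk.C s x 0 (Suc n) (\<lambda>_. undefined))"
      by (intro nn_integral_mono) (auto simp: X_def indicator_def)
    also have "\<dots> \<le> exit_value B T (0 + n) (ereal s, x)"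
      by (rule walk_exit_initial_segment[OF T])
    finally show ?thesis by (simp add: exit_value_def)
  qed
  have "(SUP n. emeasure (walk_law \<omega> s x) {w. exits_within B T n w}) =
      emeasure (walk_law \<omega> s x) (\<Union>n. {w. exits_within B T n w})"
  proof (rule SUP_emeasure_incseq)
    show "range (\<lambda>n. {w. exits_within B T n w}) \<subseteq> sets (walk_law \<omega> s x)" using E by auto
    show "incseq (\<lambda>n. {w. exits_within B T n w})"
      by (auto simp: incseq_def exits_within_def intro: order_trans)
  qed
  moreover have "{w. \<exists>n. exits_within B T n w} = (\<Union>n. {w. exits_within B T n w})" by auto
  moreover have "(SUP n. emeasure (walk_law \<omega> s x) {w. exits_within B T n w}) \<le> (SUP n. ennreal (exit_prob \<omega> B T n s x))"
    by (intro SUP_mono) (use le in blast)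
  ultimately show ?thesis by simp
qed

end

section \<open>Cubes and cutoff functions\<close>

definition sup_norm :: "'d::finite site \<Rightarrow> int" where
  "sup_norm x = Max (range (\<lambda>i. \<bar>x $ i\<bar>))"

definition cube :: "nat \<Rightarrow> 'd::finite site set" where
  "cube k = {x. sup_norm x < int k}"

lemma abs_component_le_sup_norm: "\<bar>x $ i\<bar> \<le> sup_norm x"
  unfolding sup_norm_def by (intro Max_ge) auto

lemma sup_norm_leI: "(\<And>i. \<bar>x $ i\<bar> \<le> k) \<Longrightarrow> sup_norm x \<le> k"
  unfolding sup_norm_def by (subst Max_le_iff) auto

lemma sup_norm_nonneg: "0 \<le> sup_norm x"
  using abs_component_le_sup_norm[of x undefined] by linarith

lemma sup_norm_zero [simp]: "sup_norm 0 = 0"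
  by (intro antisym sup_norm_nonneg sup_norm_leI) simp

lemma sup_norm_triangle: "sup_norm (x + y) \<le> sup_norm x + sup_norm y"
proof (rule sup_norm_leI)
  fix i show "\<bar>(x + y) $ i\<bar> \<le> sup_norm x + sup_norm y"
    using abs_component_le_sup_norm[of x i] abs_component_le_sup_norm[of y i] by simp
qed

lemma sup_norm_edge: "(x, y) \<in> edges \<Longrightarrow> sup_norm x \<le> sup_norm y + 1"
proof -
  assume "(x, y) \<in> edges"
  then have "sup_norm (x - y) \<le> 1"
    using abs_component_le_graph_norm[of "x - y"] by (intro sup_norm_leI) (simp add: edges_def)
  then show ?thesis using sup_norm_triangle[of "x - y" y] by simp
qed

lemma graph_norm_le_sup_norm: "graph_norm (x :: 'd::finite site) \<le> int CARD('d) * sup_norm x"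
  unfolding graph_norm_def
  using sum_bounded_above[of "UNIV :: 'd set" "\<lambda>i. \<bar>x $ i\<bar>" "sup_norm x"] abs_component_le_sup_norm[of x]
  by simp

lemma cube_eq: "cube k = vec_lambda ` ((UNIV :: 'd::finite set) \<rightarrow>\<^sub>E {- int k<..<int k})"
proof -
  have *: "x \<in> cube k \<longleftrightarrow> (\<forall>i. \<bar>x $ i\<bar> < int k)" for x :: "'d site"
    unfolding cube_def sup_norm_def by (simp add: Max_less_iff)
  have "x \<in> cube k \<longleftrightarrow> vec_nth x \<in> (UNIV \<rightarrow>\<^sub>E {- int k<..<int k})" for x :: "'d site"
  proof -
    have "\<bar>a\<bar> < int k \<longleftrightarrow> a \<in> {- int k<..<int k}" for a by auto
    then show ?thesis using * by (simp add: PiE_iff)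
  qed
  then have cube: "x \<in> cube k \<longleftrightarrow> vec_nth x \<in> (UNIV \<rightarrow>\<^sub>E {- int k<..<int k})" for x :: "'d site" .
  have inv: "vec_nth (vec_lambda f) = f" for f :: "'d \<Rightarrow> int" by (rule ext) simp
  show ?thesis
  proof (intro set_eqI iffI)
    fix x :: "'d site" assume "x \<in> cube k"
    then show "x \<in> vec_lambda ` (UNIV \<rightarrow>\<^sub>E {- int k<..<int k})"
      by (intro image_eqI[where x = "vec_nth x"]) (simp only: vec_nth_inverse, simp only: cube)
  next
    fix x :: "'d site" assume "x \<in> vec_lambda ` (UNIV \<rightarrow>\<^sub>E {- int k<..<int k})"
    then show "x \<in> cube k" by (elim imageE) (simp only: cube inv)
  qed
qed

lemma finite_cube [simp]: "finite (cube k)"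
  unfolding cube_eq by (intro finite_imageI finite_PiE) auto

lemma cube_mono: "m \<le> k \<Longrightarrow> cube m \<subseteq> cube k"
  by (auto simp: cube_def)

lemma card_cube: "k \<ge> 1 \<Longrightarrow> card (cube k :: 'd::finite site set) = (2 * k - 1) ^ CARD('d)"
proof -
  assume k: "k \<ge> 1"
  have "card (cube k :: 'd site set) = card ((UNIV :: 'd set) \<rightarrow>\<^sub>E {- int k<..<int k})"
    unfolding cube_eq by (rule card_image) (auto intro!: inj_onI)
  also have "\<dots> = (\<Prod>i\<in>(UNIV :: 'd set). card {- int k<..<int k})"
    by (rule card_PiE) simp
  also have "card {- int k<..<int k} = 2 * k - 1"
    using k by (simp add: nat_diff_distrib)
  finally show ?thesis by simp
qed

text \<open>
  Equal to \<open>1\<close> at the origin, zero off the cube of radius \<open>m\<close>, and with increments at most \<open>1/m\<close>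
  along bonds.
\<close>

definition cutoff :: "nat \<Rightarrow> 'd::finite site \<Rightarrow> real" where
  "cutoff m x = max 0 (1 - real_of_int (sup_norm x) / real m)"

lemma cutoff_outside: "1 \<le> m \<Longrightarrow> x \<notin> cube m \<Longrightarrow> cutoff m x = 0"
proof -
  assume m: "1 \<le> m" "x \<notin> cube m"
  then have "real m \<le> real_of_int (sup_norm x)" by (simp add: cube_def)
  then have "1 \<le> real_of_int (sup_norm x) / real m" using m by simp
  then show ?thesis by (simp add: cutoff_def)
qed

lemma cutoff_inner: "1 \<le> m \<Longrightarrow> 2 * j \<le> m \<Longrightarrow> x \<in> cube (Suc j) \<Longrightarrow> 1/2 \<le> cutoff m x"
proof -
  assume m: "1 \<le> m" "2 * j \<le> m" "x \<in> cube (Suc j)"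
  then have "real_of_int (sup_norm x) \<le> real j" by (simp add: cube_def)
  moreover have "2 * real j \<le> real m" using m by linarith
  ultimately have "real_of_int (sup_norm x) \<le> real m / 2" by linarith
  then have "real_of_int (sup_norm x) / real m \<le> 1/2" using m by (simp add: field_simps)
  then show ?thesis unfolding cutoff_def by linarith
qed

lemma cutoff_edge:
  assumes "1 \<le> m" "(x, y) \<in> edges"
  shows "(cutoff m x - cutoff m y)\<^sup>2 \<le> 1 / (real m)\<^sup>2"
proof -
  have "sup_norm x \<le> sup_norm y + 1" "sup_norm y \<le> sup_norm x + 1"
    using assms sup_norm_edge edges_sym by blast+
  then have "\<bar>real_of_int (sup_norm x) - real_of_int (sup_norm y)\<bar> \<le> 1" by linarith
  then have "\<bar>real_of_int (sup_norm x) - real_of_int (sup_norm y)\<bar> / real m \<le> 1 / real m"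
    using assms by (simp add: divide_right_mono)
  then have "\<bar>real_of_int (sup_norm x) / real m - real_of_int (sup_norm y) / real m\<bar> \<le> 1 / real m"
    by (simp add: diff_divide_distrib[symmetric])
  then have "\<bar>cutoff m x - cutoff m y\<bar> \<le> 1 / real m"
    unfolding cutoff_def by linarith
  then have "\<bar>cutoff m x - cutoff m y\<bar>\<^sup>2 \<le> (1 / real m)\<^sup>2" by (intro power_mono) auto
  then show ?thesis by (simp add: power_divide)
qed

text \<open>
  The quenched probability to leave a cube around the origin within \<open>n\<close> jumps, to the power \<open>3/2\<close>.
\<close>

definition exit_energy :: "'d::finite env \<Rightarrow> nat \<Rightarrow> real \<Rightarrow> nat \<Rightarrow> real" where
  "exit_energy \<omega> k T n = exit_prob \<omega> (cube k) T n 0 0 * sqrt (exit_prob \<omega> (cube k) T n 0 0)"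

context regular_environment
begin

lemma exit_energy_nonneg: "0 \<le> exit_energy \<omega> k T n"
  using exit_prob_bounds by (simp add: exit_energy_def)

text \<open>
  The cutoff is at least \<open>1/2\<close> at sites within distance \<open>j\<close> of the origin, and a walk from such a site
  that moves by \<open>k\<close> has left the cube of radius \<open>m\<close>.  Thus the energy estimate bounds the sum over all these starting points.
\<close>

lemma sum_exit_energy_le:
  assumes T: "0 \<le> T" and m: "1 \<le> m" "2 * j \<le> m" "m + j \<le> k"
  shows "(\<Sum>x\<in>cube (Suc j). exit_energy (env_shift 0 x \<omega>) k T n) \<le>
    6 / (real m)\<^sup>2 * (LBINT s:{0..T}. \<Sum>x\<in>cube (Suc m). total_rate \<omega> s x)"
proof -
  let ?u = "\<lambda>x. exit_prob \<omega> (cube m) T n 0 x"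
  let ?\<eta> = "cutoff m :: 'd site \<Rightarrow> real"
  have u: "0 \<le> ?u x" "?u x \<le> 1" for x using exit_prob_bounds by auto
  have "exit_energy (env_shift 0 x \<omega>) k T n \<le> 4 * ((?\<eta> x)\<^sup>2 * (?u x * sqrt (?u x)))" if x: "x \<in> cube (Suc j)" for x
  proof -
    interpret shift: regular_environment "env_shift 0 x \<omega>" by (rule regular_shift)
    have "exit_prob (env_shift 0 x \<omega>) (cube k) T n 0 0 \<le> exit_prob \<omega> (cube m) T n 0 (0 + x)"
    proof (rule exit_prob_compare)
      fix z assume "z + x \<in> cube m"
      have "sup_norm z \<le> sup_norm (z + x) + sup_norm (- x)" using sup_norm_triangle[of "z + x" "- x"] by simp
      also have "sup_norm (- x) = sup_norm x" by (simp add: sup_norm_def)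
      finally show "z \<in> cube k" using \<open>z + x \<in> cube m\<close> x m by (simp add: cube_def)
    qed
    then have "exit_energy (env_shift 0 x \<omega>) k T n \<le> ?u x * sqrt (?u x)"
      unfolding exit_energy_def using shift.exit_prob_bounds[of "cube k" T n 0 0] u[of x]
      by (intro mult_mono real_sqrt_le_mono) auto
    also have "1 * (?u x * sqrt (?u x)) \<le> 4 * (?\<eta> x)\<^sup>2 * (?u x * sqrt (?u x))"
    proof (rule mult_right_mono)
      have "(1/2)\<^sup>2 \<le> (?\<eta> x)\<^sup>2" using cutoff_inner[OF m(1,2) x] by (intro power_mono) auto
      then show "1 \<le> 4 * (?\<eta> x)\<^sup>2" by (simp add: power2_eq_square)
    qed (use u in auto)
    finally show ?thesis by (simp add: mult.assoc)
  qed
  then have "(\<Sum>x\<in>cube (Suc j). exit_energy (env_shift 0 x \<omega>) k T n) \<le> (\<Sum>x\<in>cube (Suc j). 4 * ((?\<eta> x)\<^sup>2 * (?u x * sqrt (?u x))))"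
    by (rule sum_mono)
  also have "\<dots> \<le> (\<Sum>x\<in>cube (Suc m). 4 * ((?\<eta> x)\<^sup>2 * (?u x * sqrt (?u x))))"
    using m u by (intro sum_mono2 cube_mono) auto
  also have "\<dots> = 4 * (\<Sum>x\<in>cube m. (?\<eta> x)\<^sup>2 * (?u x * sqrt (?u x)))"
    unfolding sum_distrib_left
    using m by (intro sum.mono_neutral_right cube_mono) (auto simp: cutoff_outside)
  also have "\<dots> \<le> 4 * (3/2 * (LBINT s:{0..T}. (\<Sum>x\<in>cube (Suc m). \<Sum>y\<in>cube (Suc m). \<omega> s (x, y) * (?\<eta> x - ?\<eta> y)\<^sup>2)))"
  proof (intro mult_left_mono exit_prob_energy_estimate T)
    show "neighbours x \<subseteq> cube (Suc m)" if "x \<in> cube m" for x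
    proof safe
      fix y assume "(x, y) \<in> edges"
      then have "sup_norm y \<le> sup_norm x + 1" using edges_sym sup_norm_edge by blast
      then show "y \<in> cube (Suc m)" using that by (simp add: cube_def)
    qed
  qed (use m in \<open>auto simp: cutoff_outside cube_mono\<close>)
  also have "\<dots> \<le> 4 * (3/2 * (LBINT s:{0..T}. 1 / (real m)\<^sup>2 * (\<Sum>x\<in>cube (Suc m). total_rate \<omega> s x)))"
  proof (intro mult_left_mono set_integral_mono)
    show "set_integrable lborel {0..T} (\<lambda>s. \<Sum>x\<in>cube (Suc m). \<Sum>y\<in>cube (Suc m). \<omega> s (x, y) * (?\<eta> x - ?\<eta> y)\<^sup>2)"
      by (intro set_integrable_sum set_integrable_mult_left locally_integrable)
    show "set_integrable lborel {0..T} (\<lambda>s. 1 / (real m)\<^sup>2 * (\<Sum>x\<in>cube (Suc m). total_rate \<omega> s x))"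
      by (intro set_integrable_mult_right set_integrable_sum total_rate_integrable)
    fix s
    have "(\<Sum>y\<in>cube (Suc m). \<omega> s (x, y) * (?\<eta> x - ?\<eta> y)\<^sup>2) \<le> 1 / (real m)\<^sup>2 * total_rate \<omega> s x" for x
    proof -
      have "(\<Sum>y\<in>cube (Suc m). \<omega> s (x, y) * (?\<eta> x - ?\<eta> y)\<^sup>2) \<le> (\<Sum>y\<in>cube (Suc m) \<union> neighbours x. \<omega> s (x, y) * (?\<eta> x - ?\<eta> y)\<^sup>2)"
        by (intro sum_mono2) (auto intro: mult_nonneg_nonneg rate_nonneg)
      also have "\<dots> = (\<Sum>y\<in>neighbours x. \<omega> s (x, y) * (?\<eta> x - ?\<eta> y)\<^sup>2)"
        by (intro sum.mono_neutral_right) (auto simp: zero_off)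
      also have "\<dots> \<le> (\<Sum>y\<in>neighbours x. \<omega> s (x, y) * (1 / (real m)\<^sup>2))"
        using m by (intro sum_mono mult_left_mono cutoff_edge rate_nonneg) auto
      finally show ?thesis by (simp add: total_rate_def sum_divide_distrib)
    qed
    then show "(\<Sum>x\<in>cube (Suc m). \<Sum>y\<in>cube (Suc m). \<omega> s (x, y) * (?\<eta> x - ?\<eta> y)\<^sup>2) \<le>
        1 / (real m)\<^sup>2 * (\<Sum>x\<in>cube (Suc m). total_rate \<omega> s x)"
      unfolding sum_distrib_left by (rule sum_mono)
  qed auto
  also have "\<dots> = 6 / (real m)\<^sup>2 * (LBINT s:{0..T}. \<Sum>x\<in>cube (Suc m). total_rate \<omega> s x)"
    by simp
  finally show ?thesis .
qed

end

section \<open>Measurability in the environment\<close>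

text \<open>
  Joint measurability in the environment and the starting time.  The environment is
  parametrised by an arbitrary measurable space so that the version \<open>\<rho>\<close> below can be inserted.
\<close>

lemma exit_prob_env_measurable:
  fixes \<rho> :: "'a \<Rightarrow> 'd::finite env"
  assumes joint: "\<And>e. (\<lambda>p. \<rho> (fst p) (snd p) e) \<in> borel_measurable (R \<Otimes>\<^sub>M borel)"
  shows "(\<lambda>p. exit_prob (\<rho> (fst p)) B T n (snd p) z) \<in> borel_measurable (R \<Otimes>\<^sub>M borel)"
proof -
  have rate: "(\<lambda>x. \<rho> (f x) (g x) e) \<in> borel_measurable N"
    if "f \<in> N \<rightarrow>\<^sub>M R" "g \<in> borel_measurable N" for N :: "'b measure" and f g e
    using measurable_compose[OF measurable_Pair[OF that] joint[of e]] by simp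
  show ?thesis
  proof (induction n arbitrary: z)
    case 0
    have "(\<lambda>p :: 'a \<times> real. if snd p \<le> T \<and> z \<notin> B then 1 else 0 :: real) \<in> borel_measurable (R \<Otimes>\<^sub>M borel)"
      by measurable
    then show ?case by simp
  next
    case (Suc n)
    have IH: "(\<lambda>q. exit_prob (\<rho> (fst (fst q))) B T n (snd q) y) \<in> borel_measurable ((R \<Otimes>\<^sub>M borel) \<Otimes>\<^sub>M borel)" for y
    proof -
      have "(\<lambda>q. (fst (fst q), snd q)) \<in> (R \<Otimes>\<^sub>M borel) \<Otimes>\<^sub>M borel \<rightarrow>\<^sub>M R \<Otimes>\<^sub>M borel" by measurable
      from measurable_compose[OF this Suc[of y]] show ?thesis by simp
    qed
    have clock: "(\<lambda>q. clock (\<rho> (fst (fst q))) z (snd (fst q)) (snd q)) \<in> borel_measurable ((R \<Otimes>\<^sub>M borel) \<Otimes>\<^sub>M borel)"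
      unfolding clock_def total_rate_def
      by (intro borel_measurable_LBINT_interval borel_measurable_sum rate) measurable
    have flow: "(\<lambda>q. \<Sum>y\<in>neighbours z. \<rho> (fst (fst q)) (snd q) (z, y) * exit_prob (\<rho> (fst (fst q))) B T n (snd q) y)
        \<in> borel_measurable ((R \<Otimes>\<^sub>M borel) \<Otimes>\<^sub>M borel)"
      by (intro borel_measurable_sum borel_measurable_times IH rate) measurable
    have "(\<lambda>p. LBINT s:{snd p..T}. exp (- clock (\<rho> (fst p)) z (snd p) s) *
         (\<Sum>y\<in>neighbours z. \<rho> (fst p) s (z, y) * exit_prob (\<rho> (fst p)) B T n s y)) \<in> borel_measurable (R \<Otimes>\<^sub>M borel)"
    proof (rule borel_measurable_LBINT_interval)
      show "(\<lambda>q. exp (- clock (\<rho> (fst (fst q))) z (snd (fst q)) (snd q)) *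
         (\<Sum>y\<in>neighbours z. \<rho> (fst (fst q)) (snd q) (z, y) * exit_prob (\<rho> (fst (fst q))) B T n (snd q) y))
         \<in> borel_measurable ((R \<Otimes>\<^sub>M borel) \<Otimes>\<^sub>M borel)"
        using clock flow by measurable
    qed measurable
    moreover have "(\<lambda>p :: 'a \<times> real. if snd p \<le> T then 1 else 0 :: real) \<in> borel_measurable (R \<Otimes>\<^sub>M borel)"
      by measurable
    ultimately show ?case by (cases "z \<in> B") (simp_all add: exit_prob.simps(2))
  qed
qed

lemma env_space_rates:
  assumes "\<omega> \<in> space env_space"
  shows "e \<in> edges \<Longrightarrow> 0 < \<omega> t e" "e \<notin> edges \<Longrightarrow> \<omega> t e = 0" "0 \<le> \<omega> t e"
proof -
  have "if e \<in> edges then 0 < \<omega> t e else \<omega> t e = 0" using assms unfolding space_env_space by blast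
  then show "e \<in> edges \<Longrightarrow> 0 < \<omega> t e" "e \<notin> edges \<Longrightarrow> \<omega> t e = 0" "0 \<le> \<omega> t e"
    by (auto split: if_splits)
qed

text \<open>
  A single conductance is \<open>\<omega>\<^sub>t(x, y) = (\<tau>\<^sub>t\<^sub>,\<^sub>x \<omega>)\<^sub>0(0, y - x)\<close>, so measurability of the shifts on the events
  \<open>{\<omega>. \<omega>\<^sub>0(0, z) > q}\<close> gives joint measurability of \<open>(\<omega>, t) \<mapsto> \<omega>\<^sub>t(e)\<close>.  The exceptional null sets depend on
  the event; rational \<open>q\<close> and all \<open>z\<close> leave a single null set, on which \<open>\<rho>\<close> is set to zero.
\<close>

lemma admissible_jointly_measurable_version:
  fixes P :: "'d::finite env measure"
  assumes adm: "admissible P"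
  obtains \<rho> :: "'d env \<Rightarrow> 'd env" where
    "\<And>e. (\<lambda>p. \<rho> (fst p) (snd p) e) \<in> borel_measurable (P \<Otimes>\<^sub>M borel)"
    "AE \<omega> in P. \<rho> \<omega> = \<omega>"
proof -
  have sets_P: "sets P = sets env_space" and sm: "shifts_measurable P"
    using adm by (auto simp: admissible_def)
  have space_P: "space P = space env_space" by (rule sets_eq_imp_space_eq[OF sets_P])
  define A where "A z q = {\<omega> \<in> space P. q < \<omega> 0 (0, z)}" for z :: "'d site" and q :: real
  have A: "A z q \<in> sets P" for z q
  proof -
    have "(\<lambda>\<omega>. \<omega> 0 (0, z)) \<in> borel_measurable P"
      using measurable_eval_env[of 0 "(0, z)"] by (simp cong: measurable_cong_sets add: sets_P)
    then show ?thesis unfolding A_def by measurable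
  qed
  have "\<exists>N. N \<in> null_sets P \<and> (\<lambda>(\<omega>, t, x). indicator (A z q) (env_shift t x \<omega>) :: real) \<in> borel_measurable
          (restrict_space P (space P - N) \<Otimes>\<^sub>M (borel \<Otimes>\<^sub>M count_space UNIV))" for z q
    using sm A[of z q] unfolding shifts_measurable_def by blast
  then obtain N where N: "\<And>z q. N z q \<in> null_sets P"
    and meas: "\<And>z q. (\<lambda>(\<omega>, t, x). indicator (A z q) (env_shift t x \<omega>) :: real) \<in> borel_measurable
          (restrict_space P (space P - N z q) \<Otimes>\<^sub>M (borel \<Otimes>\<^sub>M count_space UNIV))" by metis
  define N0 where "N0 = (\<Union>z. \<Union>q\<in>\<rat>. N z q)"
  have N0: "N0 \<in> null_sets P"
    unfolding N0_def using N by (intro null_sets_UN' null_sets_UN countable_rat) auto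
  define \<Omega> where "\<Omega> = space P - N0"
  have \<Omega>: "\<Omega> \<in> sets P" using N0 by (auto simp: \<Omega>_def)
  define \<rho> where "\<rho> \<omega> = (if \<omega> \<in> \<Omega> then \<omega> else (\<lambda>_ _. 0))" for \<omega> :: "'d env"
  have shift_space: "env_shift s z \<omega> \<in> space P" if "\<omega> \<in> space P" for s z \<omega>
    using measurable_space[OF measurable_env_shift, of \<omega>] that unfolding space_P .
  have level: "{p \<in> space (P \<Otimes>\<^sub>M borel). fst p \<in> \<Omega> \<and> q < fst p (snd p) (x, y)} \<in> sets (P \<Otimes>\<^sub>M borel)"
    if q: "q \<in> \<rat>" for q and x y :: "'d site"
  proof -
    let ?z = "y - x"
    let ?M = "restrict_space (P \<Otimes>\<^sub>M (borel :: real measure)) (\<Omega> \<times> UNIV)"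
    have \<Omega>2: "\<Omega> \<times> UNIV \<in> sets (P \<Otimes>\<^sub>M (borel :: real measure))" using \<Omega> by (intro pair_measureI) auto
    have "(\<lambda>p. fst p) \<in> ?M \<rightarrow>\<^sub>M restrict_space P (space P - N ?z q)"
    proof (rule measurable_restrict_space2)
      have "\<Omega> \<subseteq> space P - N ?z q" using q unfolding \<Omega>_def N0_def by blast
      then show "(\<lambda>p. fst p) \<in> space ?M \<rightarrow> space P - N ?z q" by (auto simp: space_restrict_space)
      show "(\<lambda>p. fst p) \<in> ?M \<rightarrow>\<^sub>M P" by (intro measurable_restrict_space1 measurable_fst)
    qed
    moreover have "(\<lambda>p. (snd p, x)) \<in> ?M \<rightarrow>\<^sub>M borel \<Otimes>\<^sub>M count_space UNIV"
      by (intro measurable_restrict_space1) measurable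
    ultimately have "(\<lambda>p. (fst p, snd p, x)) \<in> ?M \<rightarrow>\<^sub>M restrict_space P (space P - N ?z q) \<Otimes>\<^sub>M (borel \<Otimes>\<^sub>M count_space UNIV)"
      by (rule measurable_Pair)
    from measurable_compose[OF this meas]
    have "(\<lambda>p. indicator (A ?z q) (env_shift (snd p) x (fst p)) :: real) \<in> borel_measurable ?M" by simp
    then have "{p \<in> space ?M. 0 < (indicator (A ?z q) (env_shift (snd p) x (fst p)) :: real)} \<in> sets ?M"
      by (rule borel_measurable_less[OF borel_measurable_const])
    moreover have "{p \<in> space ?M. 0 < (indicator (A ?z q) (env_shift (snd p) x (fst p)) :: real)} =
        {p \<in> space (P \<Otimes>\<^sub>M borel). fst p \<in> \<Omega> \<and> q < fst p (snd p) (x, y)}"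
      using shift_space
      by (auto simp: space_restrict_space space_pair_measure A_def env_shift_apply \<Omega>_def indicator_def split: if_splits)
    ultimately show ?thesis
      using \<Omega>2 by (simp add: sets_restrict_space_iff)
  qed
  have nonneg: "0 \<le> \<omega> t e" if "\<omega> \<in> space P" for \<omega> t e
    using that env_space_rates(3) unfolding space_P by blast
  show ?thesis
  proof
    show "AE \<omega> in P. \<rho> \<omega> = \<omega>"
      using AE_not_in[OF N0] AE_space by eventually_elim (simp add: \<rho>_def \<Omega>_def)
    fix e :: "'d site \<times> 'd site"
    obtain x y where e: "e = (x, y)" by (cases e)
    show "(\<lambda>p. \<rho> (fst p) (snd p) e) \<in> borel_measurable (P \<Otimes>\<^sub>M borel)"
      unfolding borel_measurable_iff_greater
    proof
      fix a :: real
      show "{p \<in> space (P \<Otimes>\<^sub>M borel). a < \<rho> (fst p) (snd p) e} \<in> sets (P \<Otimes>\<^sub>M borel)"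
      proof (cases "a < 0")
        case True
        have "{p \<in> space (P \<Otimes>\<^sub>M borel). a < \<rho> (fst p) (snd p) e} = space (P \<Otimes>\<^sub>M borel)"
        proof -
          have "0 \<le> \<rho> \<omega> t e" for \<omega> t using nonneg[of \<omega> t e] by (simp add: \<rho>_def \<Omega>_def)
          then have "a < \<rho> \<omega> t e" for \<omega> t using True less_le_trans by blast
          then show ?thesis by simp
        qed
        then show ?thesis by (simp only: sets.top)
      next
        case False
        have "{p \<in> space (P \<Otimes>\<^sub>M borel). a < \<rho> (fst p) (snd p) e} =
          (\<Union>q\<in>{q\<in>\<rat>. a < q}. {p \<in> space (P \<Otimes>\<^sub>M borel). fst p \<in> \<Omega> \<and> q < fst p (snd p) (x, y)})"
          using False Rats_dense_in_real[of a] unfolding e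
          by (auto simp: \<rho>_def split: if_splits)
        also have "\<dots> \<in> sets (P \<Otimes>\<^sub>M borel)"
          using level[of _ x y] by (intro sets.countable_UN' countable_subset[OF _ countable_rat]) auto
        finally show ?thesis .
      qed
    qed
  qed
qed

section \<open>Admissible laws\<close>

text \<open>
  An admissible law together with a jointly measurable version of the environment.  Functions of the
  environment are made measurable by evaluating them at \<open>\<rho> \<omega>\<close>, which changes them on a null set only.
\<close>

locale annealed_environment =
  fixes P :: "'d::finite env measure" and \<rho> :: "'d env \<Rightarrow> 'd env"
  assumes admissible: "admissible P"
    and joint: "\<And>e. (\<lambda>p. \<rho> (fst p) (snd p) e) \<in> borel_measurable (P \<Otimes>\<^sub>M borel)"
    and version: "AE \<omega> in P. \<rho> \<omega> = \<omega>"
begin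

sublocale prob_space P
  using admissible by (simp add: admissible_def)

lemma sets_P [measurable_cong]: "sets P = sets env_space"
  using admissible by (simp add: admissible_def)

lemma space_P: "space P = space env_space"
  by (rule sets_eq_imp_space_eq[OF sets_P])

lemma rate_at_measurable: "(\<lambda>\<omega>. \<omega> t e) \<in> borel_measurable P"
  using measurable_eval_env[of t e] by (simp cong: measurable_cong_sets add: sets_P)

lemma shift_measurable: "env_shift s z \<in> P \<rightarrow>\<^sub>M P"
  using measurable_env_shift[of s z] by (simp cong: measurable_cong_sets add: sets_P)

lemma nn_integral_env_shift:
  assumes "f \<in> borel_measurable P"
  shows "(\<integral>\<^sup>+ \<omega>. f (env_shift s z \<omega>) \<partial>P) = (\<integral>\<^sup>+ \<omega>. f \<omega> \<partial>P)"
proof -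
  have "distr P P (env_shift s z) = P" using admissible by (simp add: admissible_def stationary_def)
  moreover have "integral\<^sup>N (distr P P (env_shift s z)) f = (\<integral>\<^sup>+ \<omega>. f (env_shift s z \<omega>) \<partial>P)"
    by (rule nn_integral_distr[OF shift_measurable]) (simp add: assms)
  ultimately show ?thesis by simp
qed

lemma AE_env_shift:
  assumes "AE \<omega> in P. Q \<omega>"
  shows "AE \<omega> in P. Q (env_shift s z \<omega>)"
proof (rule AE_distrD[OF shift_measurable])
  have "distr P P (env_shift s z) = P" using admissible by (simp add: admissible_def stationary_def)
  then show "AE \<omega> in distr P P (env_shift s z). Q \<omega>" using assms by (simp only:)
qed

definition mean_rate :: real where
  "mean_rate = (\<integral>\<omega>. total_rate \<omega> 0 0 \<partial>P)"

lemma rate_integrable: "integrable P (\<lambda>\<omega>. \<omega> t e)"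
proof (cases "e \<in> edges")
  case True then show ?thesis using admissible by (auto simp: admissible_def)
next
  case False
  have "integrable P (\<lambda>\<omega>. \<omega> t e) \<longleftrightarrow> integrable P (\<lambda>\<omega>. 0 :: real)"
    by (rule Bochner_Integration.integrable_cong[OF refl])
      (use False env_space_rates(2) in \<open>unfold space_P, blast\<close>)
  then show ?thesis by simp
qed

lemma rate_nonneg: "\<omega> \<in> space P \<Longrightarrow> 0 \<le> \<omega> t e"
  using env_space_rates(3) unfolding space_P by blast

lemma total_rate_at_measurable: "(\<lambda>\<omega>. total_rate \<omega> t z) \<in> borel_measurable P"
  unfolding total_rate_def by (intro borel_measurable_sum rate_at_measurable)

lemma mean_rate_nonneg: "0 \<le> mean_rate"
  unfolding mean_rate_def total_rate_def
  by (intro integral_nonneg_AE AE_I2 sum_nonneg rate_nonneg)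

lemma nn_integral_total_rate: "(\<integral>\<^sup>+ \<omega>. ennreal (total_rate \<omega> t z) \<partial>P) = ennreal mean_rate"
proof -
  have "(\<integral>\<^sup>+ \<omega>. ennreal (total_rate \<omega> t z) \<partial>P) = (\<integral>\<^sup>+ \<omega>. ennreal (total_rate (env_shift t z \<omega>) 0 0) \<partial>P)"
  proof -
    have "total_rate (env_shift t z \<omega>) 0 0 = total_rate \<omega> t z" for \<omega> :: "'d env"
    proof -
      have "total_rate \<omega> t (0 + z) = (\<Sum>y\<in>neighbours 0. \<omega> t (z, y + z))"
        unfolding total_rate_def neighbours_shift by (simp add: sum.reindex)
      then show ?thesis by (simp add: total_rate_def env_shift_apply)
    qed
    then show ?thesis by simp
  qed
  also have "\<dots> = (\<integral>\<^sup>+ \<omega>. ennreal (total_rate \<omega> 0 0) \<partial>P)"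
    by (rule nn_integral_env_shift) (intro measurable_compose[OF _ measurable_ennreal] total_rate_at_measurable)
  also have "\<dots> = ennreal mean_rate"
    unfolding mean_rate_def
  proof (rule nn_integral_eq_integral)
    show "integrable P (\<lambda>\<omega>. total_rate \<omega> 0 0)"
      unfolding total_rate_def by (intro Bochner_Integration.integrable_sum rate_integrable)
    show "AE \<omega> in P. 0 \<le> total_rate \<omega> 0 0"
      unfolding total_rate_def by (intro AE_I2 sum_nonneg rate_nonneg)
  qed
  finally show ?thesis .
qed

lemma total_rate_version_measurable:
  "(\<lambda>p. total_rate (\<rho> (fst p)) (snd p) z) \<in> borel_measurable (P \<Otimes>\<^sub>M lborel)"
proof -
  have "(\<lambda>p. total_rate (\<rho> (fst p)) (snd p) z) \<in> borel_measurable (P \<Otimes>\<^sub>M borel)"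
    unfolding total_rate_def by (intro borel_measurable_sum joint)
  moreover have "sets (P \<Otimes>\<^sub>M (lborel :: real measure)) = sets (P \<Otimes>\<^sub>M borel)" by (intro sets_pair_measure_cong) auto
  ultimately show ?thesis by (simp cong: measurable_cong_sets)
qed

lemma nn_integral_time_total_rate:
  assumes "a \<le> b"
  shows "(\<integral>\<^sup>+ \<omega>. (\<integral>\<^sup>+ s. ennreal (total_rate (\<rho> \<omega>) s z) * indicator {a..b} s \<partial>lborel) \<partial>P) = ennreal (mean_rate * (b - a))"
proof -
  interpret pair_sigma_finite lborel P ..
  have m: "(\<lambda>(s, \<omega>). ennreal (total_rate (\<rho> \<omega>) s z) * indicator {a..b} s) \<in> borel_measurable (lborel \<Otimes>\<^sub>M P)"
  proof -
    have "(\<lambda>p. total_rate (\<rho> (snd p)) (fst p) z) \<in> borel_measurable (lborel \<Otimes>\<^sub>M P)"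
      using measurable_compose[OF measurable_pair_swap' total_rate_version_measurable[of z]]
      by (simp add: case_prod_unfold)
    then show ?thesis by (simp add: case_prod_unfold)
  qed
  have "(\<integral>\<^sup>+ \<omega>. (\<integral>\<^sup>+ s. ennreal (total_rate (\<rho> \<omega>) s z) * indicator {a..b} s \<partial>lborel) \<partial>P) =
     (\<integral>\<^sup>+ s. (\<integral>\<^sup>+ \<omega>. ennreal (total_rate (\<rho> \<omega>) s z) * indicator {a..b} s \<partial>P) \<partial>lborel)"
    by (rule Fubini'[OF m])
  also have "\<dots> = (\<integral>\<^sup>+ s. ennreal mean_rate * indicator {a..b} s \<partial>lborel)"
  proof (rule nn_integral_cong)
    fix s
    have "(\<integral>\<^sup>+ \<omega>. ennreal (total_rate (\<rho> \<omega>) s z) * indicator {a..b} s \<partial>P) =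
       (\<integral>\<^sup>+ \<omega>. ennreal (total_rate \<omega> s z) * indicator {a..b} s \<partial>P)"
      using version by (intro nn_integral_cong_AE) auto
    also have "\<dots> = (\<integral>\<^sup>+ \<omega>. ennreal (total_rate \<omega> s z) \<partial>P) * indicator {a..b} s"
      by (rule nn_integral_multc) (intro measurable_compose[OF _ measurable_ennreal] total_rate_at_measurable)
    finally show "(\<integral>\<^sup>+ \<omega>. ennreal (total_rate (\<rho> \<omega>) s z) * indicator {a..b} s \<partial>P) = ennreal mean_rate * indicator {a..b} s"
      by (simp add: nn_integral_total_rate)
  qed
  also have "\<dots> = ennreal (mean_rate * (b - a))"
  proof -
    have "(\<integral>\<^sup>+ s. ennreal mean_rate * indicator {a..b} s \<partial>lborel) = ennreal mean_rate * emeasure lborel {a..b}"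
      by (rule nn_integral_cmult_indicator) simp
    also have "\<dots> = ennreal (mean_rate * (b - a))"
      using assms mean_rate_nonneg by (simp only: emeasure_lborel_Icc ennreal_mult'[OF mean_rate_nonneg])
    finally show ?thesis .
  qed
  finally show ?thesis .
qed

lemma version_rate_measurable: "(\<lambda>t. \<rho> \<omega> t e) \<in> borel_measurable borel" if "\<omega> \<in> space P"
  using measurable_compose[OF measurable_Pair1'[OF that] joint[of e]] by simp

text \<open>
  Local integrability of the rates in time comes from Tonelli: by stationarity the mean total rate
  is the same finite number at all times.
\<close>

lemma AE_regular: "AE \<omega> in P. regular_environment \<omega>"
proof -
  have sym: "AE \<omega> in P. \<forall>e\<in>edges. \<forall>t. \<omega> t e = \<omega> t (snd e, fst e)"
  proof (rule AE_ball_countable[THEN iffD2])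
    show "\<forall>e\<in>edges. AE \<omega> in P. \<forall>t. \<omega> t e = \<omega> t (snd e, fst e)"
    proof
      fix e :: "'d site \<times> 'd site" assume "e \<in> edges"
      then show "AE \<omega> in P. \<forall>t. \<omega> t e = \<omega> t (snd e, fst e)"
        using admissible unfolding admissible_def by (cases e) auto
    qed
  qed simp
  have int: "AE \<omega> in P. (\<integral>\<^sup>+ s. ennreal (total_rate (\<rho> \<omega>) s z) * indicator {- real n..real n} s \<partial>lborel) \<noteq> \<infinity>" for z n
  proof (rule nn_integral_PInf_AE)
    have "(\<lambda>p. ennreal (total_rate (\<rho> (fst p)) (snd p) z) * indicator {- real n..real n} (snd p)) \<in> borel_measurable (P \<Otimes>\<^sub>M lborel)"
      using total_rate_version_measurable[of z] by measurable
    then show "(\<lambda>\<omega>. \<integral>\<^sup>+ s. ennreal (total_rate (\<rho> \<omega>) s z) * indicator {- real n..real n} s \<partial>lborel) \<in> borel_measurable P"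
      by (intro lborel.borel_measurable_nn_integral) (simp add: case_prod_unfold)
  qed (simp add: nn_integral_time_total_rate)
  then have "AE \<omega> in P. \<forall>z n. (\<integral>\<^sup>+ s. ennreal (total_rate (\<rho> \<omega>) s z) * indicator {- real n..real n} s \<partial>lborel) \<noteq> \<infinity>"
    by (simp add: AE_all_countable)
  with sym version AE_space show ?thesis
  proof eventually_elim
    case (elim \<omega>)
    have meas: "(\<lambda>t. \<omega> t e) \<in> borel_measurable borel" for e
      using version_rate_measurable[of \<omega> e] elim(2,3) by simp
    have zero: "\<omega> t e = 0" if "e \<notin> edges" for t e
      using elim(3) that env_space_rates(2) unfolding space_P by blast
    show ?case
    proof
      show "0 < \<omega> t e" if "e \<in> edges" for t e
        using elim(3) that env_space_rates(1) unfolding space_P by blast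
      show "\<omega> t (x, y) = \<omega> t (y, x)" for t x y
      proof (cases "(x, y) \<in> edges")
        case True
        with elim(1) have "\<omega> t (x, y) = \<omega> t (snd (x, y), fst (x, y))" by blast
        then show ?thesis by (simp only: fst_conv snd_conv)
      next
        case False
        then have "(y, x) \<notin> edges" using edges_sym[of x y] by blast
        with False show ?thesis using zero by metis
      qed
      show "set_integrable lborel {a..b} (\<lambda>t. \<omega> t e)" for a b e
      proof -
        obtain x y where e: "e = (x, y)" by (cases e)
        obtain n where n: "max \<bar>a\<bar> \<bar>b\<bar> \<le> real n" using real_arch_simple by blast
        have le: "\<omega> t (x, y) \<le> total_rate \<omega> t x" for t
        proof (cases "(x, y) \<in> edges")
          case True
          then show ?thesis unfolding total_rate_def
            by (intro member_le_sum) (auto simp: rate_nonneg[OF elim(3)])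
        next
          case False
          then show ?thesis unfolding total_rate_def
            by (simp add: zero sum_nonneg rate_nonneg[OF elim(3)])
        qed
        show ?thesis unfolding set_integrable_def
        proof (rule integrableI_bounded)
          show "(\<lambda>t. indicator {a..b} t *\<^sub>R \<omega> t e) \<in> borel_measurable lborel" using meas[of e] by measurable
          have "(\<integral>\<^sup>+ t. ennreal (norm (indicator {a..b} t *\<^sub>R \<omega> t e)) \<partial>lborel) \<le>
             (\<integral>\<^sup>+ s. ennreal (total_rate \<omega> s x) * indicator {- real n..real n} s \<partial>lborel)"
            using n le by (intro nn_integral_mono) (auto simp: indicator_def e rate_nonneg[OF elim(3)] intro!: ennreal_leI)
          also have "\<dots> < \<infinity>" using elim(2,4) by (simp add: less_top)
          finally show "(\<integral>\<^sup>+ t. ennreal (norm (indicator {a..b} t *\<^sub>R \<omega> t e)) \<partial>lborel) < \<infinity>" .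
        qed
      qed
    qed (use zero meas in auto)
  qed
qed

end

section \<open>Annealed exit probabilities\<close>

text \<open>
  The solution \<open>\<theta>\<close> of \<open>\<theta>\<^sup>3 = a / (a + x)\<close>.  The tail of the maximal displacement is bounded by a multiple of
  \<open>\<theta>\<^sup>4\<close> with \<open>a = sqrt T\<close>, that is, by \<open>(sqrt T / k)\<^bsup>4/3\<^esup>\<close> for large \<open>k\<close>.
\<close>

definition decay :: "real \<Rightarrow> real \<Rightarrow> real" where
  "decay a x = root 3 (a / (a + x))"

lemma decay_cube: "(decay a x) ^ 3 = a / (a + x)"
  by (simp add: decay_def odd_real_root_pow)

lemma decay_bounds: "0 < a \<Longrightarrow> 0 \<le> x \<Longrightarrow> 0 < decay a x \<and> decay a x \<le> 1"
  by (simp add: decay_def)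

text \<open>
  Up to constants \<open>\<theta>\<^sup>4\<close> is minus the derivative of \<open>a \<theta>\<close>, hence the tails are summable with sum of order \<open>a\<close>.
\<close>

lemma decay_telescope:
  assumes a: "0 < a"
  shows "(decay a (real (Suc k))) ^ 4 \<le> 3 * a * (decay a (real k) - decay a (real (Suc k)))"
proof -
  define p q where "p = decay a (real (Suc k))" and "q = decay a (real k)"
  have pq: "0 < p" "0 < q" using decay_bounds[OF a] by (auto simp: p_def q_def)
  have p3: "p ^ 3 = a / (a + real (Suc k))" and q3: "q ^ 3 = a / (a + real k)"
    unfolding p_def q_def by (rule decay_cube)+
  (* The cubes of 1 / p and 1 / q differ by 1 / a; the rest is the factorisation of a difference of cubes. *)
  have inv: "a / p ^ 3 - a / q ^ 3 = 1"
    unfolding p3 q3 using a by (simp add: field_simps)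
  have "p ^ 3 \<le> q ^ 3" unfolding p3 q3 using a by (intro divide_left_mono) auto
  then have le: "p \<le> q" using pq power_mono_iff[of p q 3] by simp
  have "a * (q ^ 3 - p ^ 3) = p ^ 3 * q ^ 3"
    using inv pq by (simp add: field_simps)
  moreover have "q ^ 3 - p ^ 3 = (q - p) * (q\<^sup>2 + q * p + p\<^sup>2)"
    by (simp add: power2_eq_square power3_eq_cube algebra_simps)
  ultimately have "p ^ 3 * q ^ 3 = a * (q - p) * (q\<^sup>2 + q * p + p\<^sup>2)" by simp
  also have "\<dots> \<le> a * (q - p) * (3 * q\<^sup>2)"
  proof (rule mult_left_mono)
    have "q * p \<le> q * q" "p * p \<le> q * q" using le pq by (auto intro: mult_mono mult_left_mono)
    then show "q\<^sup>2 + q * p + p\<^sup>2 \<le> 3 * q\<^sup>2" by (simp add: power2_eq_square)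
  qed (use a le in auto)
  finally have "q\<^sup>2 * (p ^ 3 * q) \<le> q\<^sup>2 * (3 * a * (q - p))"
    by (simp add: power2_eq_square power3_eq_cube ac_simps)
  then have "p ^ 3 * q \<le> 3 * a * (q - p)" using pq by simp
  moreover have "p ^ 4 \<le> p ^ 3 * q"
    using le pq by (simp add: numeral_eq_Suc mult_left_mono)
  ultimately show ?thesis by (simp add: p_def q_def)
qed

lemma sum_decay_le:
  assumes a: "0 < a"
  shows "(\<Sum>k<n. (decay a (real (Suc k))) ^ 4) \<le> 3 * a"
proof -
  have "(\<Sum>k<n. (decay a (real (Suc k))) ^ 4) \<le> (\<Sum>k<n. 3 * a * (decay a (real k) - decay a (real (Suc k))))"
    by (intro sum_mono decay_telescope a)
  also have "\<dots> = 3 * a * (decay a (real 0) - decay a (real n))"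
    unfolding sum_distrib_left[symmetric] sum_lessThan_telescope'[of "\<lambda>k. decay a (real k)"] ..
  also have "\<dots> \<le> 3 * a * 1"
    using a decay_bounds[OF a, of 0] decay_bounds[OF a, of "real n"] by (intro mult_left_mono) auto
  finally show ?thesis by simp
qed

text \<open>
  Converts a bound on the mean of \<open>e\<^bsup>3/2\<^esup>\<close> into one on the mean of \<open>e\<close>, with a parameter \<open>c\<close> to be
  optimised.
\<close>

lemma young_three_halves:
  fixes e c :: real
  assumes "0 \<le> e" "0 < c"
  shows "e \<le> sqrt c * (e * sqrt e) + 1 / c"
proof (cases "1 \<le> c * e")
  case True
  then have "1 \<le> sqrt (c * e)" by simp
  then have "e * 1 \<le> e * sqrt (c * e)" using assms by (intro mult_left_mono) auto
  also have "\<dots> = sqrt c * (e * sqrt e)" by (simp add: real_sqrt_mult)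
  also have "\<dots> \<le> sqrt c * (e * sqrt e) + 1 / c" using assms by simp
  finally show ?thesis by simp
next
  case False
  then have "e \<le> 1 / c" using assms by (simp add: field_simps)
  moreover have "0 \<le> sqrt c * (e * sqrt e)" using assms by simp
  ultimately show ?thesis by linarith
qed

lemma (in regular_environment) nn_integral_total_rate_eq_clock:
  "(\<integral>\<^sup>+ s. ennreal (total_rate \<omega> s z) * indicator {a..b} s \<partial>lborel) = ennreal (clock \<omega> z a b)"
proof -
  have "(\<integral>\<^sup>+ s. ennreal (total_rate \<omega> s z) * indicator {a..b} s \<partial>lborel) =
      (\<integral>\<^sup>+ s. ennreal (indicator {a..b} s *\<^sub>R total_rate \<omega> s z) \<partial>lborel)"
    by (intro nn_integral_cong) (auto simp: indicator_def)
  also have "\<dots> = ennreal (clock \<omega> z a b)"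
    unfolding clock_def set_lebesgue_integral_def
    using total_rate_integrable[of a b z] total_rate_nonneg
    by (intro nn_integral_eq_integral) (auto simp: set_integrable_def)
  finally show ?thesis .
qed

lemma ennreal_inverse_cancel: "0 < x \<Longrightarrow> ennreal (1 / x) * (ennreal x * c) = c"
  by (simp add: mult.assoc[symmetric] ennreal_mult[symmetric])

context annealed_environment
begin

lemma exit_prob_version_measurable: "(\<lambda>\<omega>. exit_prob (\<rho> \<omega>) B T n s z) \<in> borel_measurable P"
proof -
  have "(\<lambda>\<omega>. (\<omega>, s)) \<in> P \<rightarrow>\<^sub>M P \<Otimes>\<^sub>M borel" by measurable
  from measurable_compose[OF this exit_prob_env_measurable[OF joint]] show ?thesis by simp
qed

lemma exit_energy_version_measurable: "(\<lambda>\<omega>. exit_energy (\<rho> \<omega>) k T n) \<in> borel_measurable P"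
  using exit_prob_version_measurable unfolding exit_energy_def by measurable

definition energy_const :: real where
  "energy_const = 24 * 3 ^ CARD('d) * mean_rate"

lemma energy_const_nonneg: "0 \<le> energy_const"
  using mean_rate_nonneg by (simp add: energy_const_def)

text \<open>
  By stationarity the mean of \<open>exit_energy\<close> is the same for all starting points, so it equals its average
  over a cube.  There the quenched estimate applies, whose right hand side has mean of order
  \<open>T / m\<^sup>2\<close> times the volume; the volume cancels.
\<close>

lemma annealed_exit_energy:
  assumes T: "0 \<le> T" and k: "1 \<le> k"
  shows "(\<integral>\<^sup>+ \<omega>. ennreal (exit_energy (\<rho> \<omega>) k T n) \<partial>P) \<le> ennreal (energy_const * T / (real k)\<^sup>2)"
proof -
  (* The cutoff has radius m, about k / 2, and the average runs over the sites within distance j, about m / 2, so m + j is at most k.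
     For k = 1 this leaves the origin as the only starting point and the indicator of the origin as cutoff. *)
  define m j where "m = (k + 1) div 2" and "j = m div 2"
  have m: "1 \<le> m" "2 * j \<le> m" "m + j \<le> k" "k \<le> 2 * m" "m \<le> 2 * j + 1"
    using k unfolding j_def m_def by presburger+
  let ?J = "cube (Suc j) :: 'd site set" and ?M = "cube (Suc m) :: 'd site set"
  let ?c = "\<integral>\<^sup>+ \<omega>. ennreal (exit_energy (\<rho> \<omega>) k T n) \<partial>P"
  let ?N1 = "real (card ?J)" and ?N2 = "real (card ?M)"
  have AE_shift: "AE \<omega> in P. \<forall>x. \<rho> (env_shift 0 x \<omega>) = env_shift 0 x \<omega>"
    using AE_env_shift[OF version] by (simp add: AE_all_countable)
  have "ennreal ?N1 * ?c = (\<Sum>x\<in>?J. \<integral>\<^sup>+ \<omega>. ennreal (exit_energy (\<rho> (env_shift 0 x \<omega>)) k T n) \<partial>P)"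
  proof -
    have "(\<integral>\<^sup>+ \<omega>. ennreal (exit_energy (\<rho> (env_shift 0 x \<omega>)) k T n) \<partial>P) = ?c" for x
      by (rule nn_integral_env_shift) (intro measurable_compose[OF _ measurable_ennreal] exit_energy_version_measurable)
    then show ?thesis by (simp add: ennreal_of_nat_eq_real_of_nat)
  qed
  also have "\<dots> = (\<integral>\<^sup>+ \<omega>. (\<Sum>x\<in>?J. ennreal (exit_energy (\<rho> (env_shift 0 x \<omega>)) k T n)) \<partial>P)"
  proof (rule nn_integral_sum[symmetric])
    fix x
    have "(\<lambda>\<omega>. ennreal (exit_energy (\<rho> \<omega>) k T n)) \<in> borel_measurable P"
      by (intro measurable_compose[OF _ measurable_ennreal] exit_energy_version_measurable)
    from measurable_compose[OF shift_measurable this]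
    show "(\<lambda>\<omega>. ennreal (exit_energy (\<rho> (env_shift 0 x \<omega>)) k T n)) \<in> borel_measurable P" .
  qed
  also have "\<dots> \<le> (\<integral>\<^sup>+ \<omega>. ennreal (6 / (real m)\<^sup>2) *
      (\<Sum>x\<in>?M. \<integral>\<^sup>+ s. ennreal (total_rate (\<rho> \<omega>) s x) * indicator {0..T} s \<partial>lborel) \<partial>P)"
  proof (rule nn_integral_mono_AE)
    show "AE \<omega> in P. (\<Sum>x\<in>?J. ennreal (exit_energy (\<rho> (env_shift 0 x \<omega>)) k T n)) \<le>
      ennreal (6 / (real m)\<^sup>2) * (\<Sum>x\<in>?M. \<integral>\<^sup>+ s. ennreal (total_rate (\<rho> \<omega>) s x) * indicator {0..T} s \<partial>lborel)"
      using AE_regular version AE_shift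
    proof eventually_elim
      case (elim \<omega>)
      interpret regular_environment \<omega> by (rule elim(1))
      have nn: "0 \<le> exit_energy (env_shift 0 x \<omega>) k T n" for x
        by (rule regular_environment.exit_energy_nonneg[OF regular_shift])
      have "(\<Sum>x\<in>?J. ennreal (exit_energy (\<rho> (env_shift 0 x \<omega>)) k T n)) = ennreal (\<Sum>x\<in>?J. exit_energy (env_shift 0 x \<omega>) k T n)"
        using elim(3) nn by (simp add: sum_ennreal)
      also have "\<dots> \<le> ennreal (6 / (real m)\<^sup>2 * (\<Sum>x\<in>?M. clock \<omega> x 0 T))"
      proof (rule ennreal_leI)
        have "(LBINT s:{0..T}. \<Sum>x\<in>?M. total_rate \<omega> s x) = (\<Sum>x\<in>?M. clock \<omega> x 0 T)"
          unfolding clock_def by (rule set_integral_sum) (rule total_rate_integrable)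
        then show "(\<Sum>x\<in>?J. exit_energy (env_shift 0 x \<omega>) k T n) \<le> 6 / (real m)\<^sup>2 * (\<Sum>x\<in>?M. clock \<omega> x 0 T)"
          using sum_exit_energy_le[OF T m(1,2,3), of n] by simp
      qed
      also have "\<dots> = ennreal (6 / (real m)\<^sup>2) * (\<Sum>x\<in>?M. ennreal (clock \<omega> x 0 T))"
        by (subst ennreal_mult) (auto simp: sum_ennreal clock_nonneg sum_nonneg)
      also have "(\<Sum>x\<in>?M. ennreal (clock \<omega> x 0 T)) =
          (\<Sum>x\<in>?M. \<integral>\<^sup>+ s. ennreal (total_rate (\<rho> \<omega>) s x) * indicator {0..T} s \<partial>lborel)"
        unfolding elim(2) nn_integral_total_rate_eq_clock ..
      finally show ?case .
    qed
  qed
  also have "\<dots> = ennreal (6 / (real m)\<^sup>2) * (\<Sum>x\<in>?M. \<integral>\<^sup>+ \<omega>.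
      (\<integral>\<^sup>+ s. ennreal (total_rate (\<rho> \<omega>) s x) * indicator {0..T} s \<partial>lborel) \<partial>P)"
  proof -
    have meas: "(\<lambda>\<omega>. \<integral>\<^sup>+ s. ennreal (total_rate (\<rho> \<omega>) s x) * indicator {0..T} s \<partial>lborel) \<in> borel_measurable P" for x
    proof -
      have "(\<lambda>p. ennreal (total_rate (\<rho> (fst p)) (snd p) x) * indicator {0..T} (snd p)) \<in> borel_measurable (P \<Otimes>\<^sub>M lborel)"
        using total_rate_version_measurable[of x] by measurable
      then show ?thesis
        by (intro lborel.borel_measurable_nn_integral) (simp add: case_prod_unfold)
    qed
    then show ?thesis by (subst nn_integral_cmult) (auto simp: nn_integral_sum)
  qed
  also have "\<dots> = ennreal (6 / (real m)\<^sup>2) * (ennreal ?N2 * ennreal (mean_rate * T))"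
    using T by (simp add: nn_integral_time_total_rate ennreal_of_nat_eq_real_of_nat)
  also have "\<dots> = ennreal (6 / (real m)\<^sup>2 * (?N2 * (mean_rate * T)))"
  proof -
    have "ennreal ?N2 * ennreal (mean_rate * T) = ennreal (?N2 * (mean_rate * T))"
      using T mean_rate_nonneg by (intro ennreal_mult[symmetric]) auto
    then show ?thesis
      using T mean_rate_nonneg by (simp only:) (intro ennreal_mult[symmetric], auto)
  qed
  finally have le: "ennreal ?N1 * ?c \<le> ennreal (6 / (real m)\<^sup>2 * (?N2 * (mean_rate * T)))" .
  have N1: "real m ^ CARD('d) \<le> ?N1" "0 < ?N1"
  proof -
    have N: "?N1 = real (2 * j + 1) ^ CARD('d)" by (simp add: card_cube)
    show "real m ^ CARD('d) \<le> ?N1" unfolding N using m by (intro power_mono) auto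
    show "0 < ?N1" unfolding N by simp
  qed
  have N2: "?N2 \<le> 3 ^ CARD('d) * real m ^ CARD('d)"
  proof -
    have "?N2 = real (2 * m + 1) ^ CARD('d)" by (simp add: card_cube)
    also have "\<dots> \<le> (3 * real m) ^ CARD('d)" using m by (intro power_mono) auto
    finally show ?thesis by (simp add: power_mult_distrib)
  qed
  have "?c = ennreal (1 / ?N1) * (ennreal ?N1 * ?c)"
    by (rule ennreal_inverse_cancel[OF N1(2), symmetric])
  also have "\<dots> \<le> ennreal (1 / ?N1) * ennreal (6 / (real m)\<^sup>2 * (?N2 * (mean_rate * T)))"
    by (intro mult_left_mono le) simp
  also have "\<dots> = ennreal (1 / ?N1 * (6 / (real m)\<^sup>2 * (?N2 * (mean_rate * T))))"
    using N1 T mean_rate_nonneg by (intro ennreal_mult[symmetric]) auto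
  also have "\<dots> \<le> ennreal (energy_const * T / (real k)\<^sup>2)"
  proof (rule ennreal_leI)
    have "?N2 / ?N1 \<le> 3 ^ CARD('d)"
    proof -
      have "?N2 \<le> 3 ^ CARD('d) * ?N1" using N2 N1(1) by (smt (verit) mult_left_mono zero_le_power)
      then show ?thesis using N1(2) by (simp add: field_simps)
    qed
    then have "(?N2 / ?N1) * (6 * mean_rate * T / (real m)\<^sup>2) \<le> 3 ^ CARD('d) * (6 * mean_rate * T / (real m)\<^sup>2)"
      using T mean_rate_nonneg by (intro mult_right_mono) auto
    also have "\<dots> \<le> 3 ^ CARD('d) * (6 * mean_rate * T * (4 / (real k)\<^sup>2))"
    proof -
      have "(real k)\<^sup>2 \<le> (2 * real m)\<^sup>2" using m by (intro power_mono) auto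
      then have "1 / (real m)\<^sup>2 \<le> 4 / (real k)\<^sup>2" using m k by (simp add: field_simps)
      then have "6 * mean_rate * T * (1 / (real m)\<^sup>2) \<le> 6 * mean_rate * T * (4 / (real k)\<^sup>2)"
        using T mean_rate_nonneg by (intro mult_left_mono) auto
      then show ?thesis by (intro mult_left_mono) auto
    qed
    finally show "1 / ?N1 * (6 / (real m)\<^sup>2 * (?N2 * (mean_rate * T))) \<le> energy_const * T / (real k)\<^sup>2"
      by (simp add: energy_const_def ac_simps)
  qed
  finally show ?thesis .
qed

text \<open>
  Young's inequality with \<open>c = \<theta>\<^bsup>-4\<^esup>\<close> balances the two terms when \<open>k\<close> is at least \<open>sqrt T\<close>.  For smaller \<open>k\<close> the
  right hand side is at least \<open>1\<close>.
\<close>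

lemma annealed_exit_prob:
  assumes T: "0 < T" and k: "1 \<le> k"
  shows "(\<integral>\<^sup>+ \<omega>. ennreal (exit_prob (\<rho> \<omega>) (cube k) T n 0 0) \<partial>P)
     \<le> ennreal (4 * (energy_const + 1) * (decay (sqrt T) (real k)) ^ 4)"
proof -
  define a \<theta> where "a = sqrt T" and "\<theta> = decay a (real k)"
  have a: "0 < a" "a\<^sup>2 = T" using T by (auto simp: a_def)
  have \<theta>: "0 < \<theta>" "\<theta> \<le> 1" "\<theta> ^ 3 = a / (a + real k)"
    using decay_bounds[OF a(1), of "real k"] by (auto simp: \<theta>_def decay_cube)
  have reg: "AE \<omega> in P. regular_environment (\<rho> \<omega>)"
    using AE_regular version by eventually_elim simp
  show ?thesis
  proof (cases "real k < a")
    case True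
    have "1/2 \<le> \<theta> ^ 3" unfolding \<theta>(3) using True a by (simp add: field_simps)
    moreover have "\<theta> ^ 3 \<le> \<theta> ^ 1" using \<theta> by (intro power_decreasing) auto
    ultimately have "1/2 * (1/2) \<le> \<theta> ^ 3 * \<theta>" by (intro mult_mono) auto
    then have "1 \<le> 4 * \<theta> ^ 4" by (simp add: numeral_eq_Suc ac_simps)
    also have "\<dots> \<le> 4 * (energy_const + 1) * \<theta> ^ 4"
      using energy_const_nonneg \<theta> by (intro mult_right_mono) auto
    finally have one: "1 \<le> 4 * (energy_const + 1) * \<theta> ^ 4" .
    have "(\<integral>\<^sup>+ \<omega>. ennreal (exit_prob (\<rho> \<omega>) (cube k) T n 0 0) \<partial>P) \<le> (\<integral>\<^sup>+ \<omega>. 1 \<partial>P)"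
      using reg by (intro nn_integral_mono_AE) (auto elim!: eventually_mono dest: regular_environment.exit_prob_bounds)
    also have "\<dots> = ennreal 1" by (simp add: emeasure_space_1)
    also have "\<dots> \<le> ennreal (4 * (energy_const + 1) * \<theta> ^ 4)" by (rule ennreal_leI[OF one])
    finally show ?thesis by (simp add: \<theta>_def a_def)
  next
    case False
    have "(\<integral>\<^sup>+ \<omega>. ennreal (exit_prob (\<rho> \<omega>) (cube k) T n 0 0) \<partial>P) \<le>
       (\<integral>\<^sup>+ \<omega>. ennreal (1 / \<theta>\<^sup>2) * ennreal (exit_energy (\<rho> \<omega>) k T n) + ennreal (\<theta> ^ 4) \<partial>P)"
    proof (rule nn_integral_mono_AE, rule eventually_mono[OF reg])
      fix \<omega> assume "regular_environment (\<rho> \<omega>)"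
      then interpret regular_environment "\<rho> \<omega>" .
      let ?e = "exit_prob (\<rho> \<omega>) (cube k) T n 0 0"
      have "?e \<le> sqrt (1 / \<theta> ^ 4) * (?e * sqrt ?e) + 1 / (1 / \<theta> ^ 4)"
        using exit_prob_bounds \<theta>(1) by (intro young_three_halves) auto
      also have "sqrt (1 / \<theta> ^ 4) = 1 / \<theta>\<^sup>2"
        by (rule real_sqrt_unique) (auto simp: power_one_over power_mult[symmetric])
      finally have "ennreal ?e \<le> ennreal (1 / \<theta>\<^sup>2 * exit_energy (\<rho> \<omega>) k T n + \<theta> ^ 4)"
        by (intro ennreal_leI) (simp add: exit_energy_def)
      also have "\<dots> = ennreal (1 / \<theta>\<^sup>2) * ennreal (exit_energy (\<rho> \<omega>) k T n) + ennreal (\<theta> ^ 4)"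
        using exit_energy_nonneg[of k T n] \<theta>(1) by (subst ennreal_plus) (auto simp: ennreal_mult[symmetric])
      finally show "ennreal ?e \<le> ennreal (1 / \<theta>\<^sup>2) * ennreal (exit_energy (\<rho> \<omega>) k T n) + ennreal (\<theta> ^ 4)" .
    qed
    also have "\<dots> = ennreal (1 / \<theta>\<^sup>2) * (\<integral>\<^sup>+ \<omega>. ennreal (exit_energy (\<rho> \<omega>) k T n) \<partial>P) + ennreal (\<theta> ^ 4)"
    proof -
      have [measurable]: "(\<lambda>\<omega>. exit_energy (\<rho> \<omega>) k T n) \<in> borel_measurable P"
        by (rule exit_energy_version_measurable)
      show ?thesis by (subst nn_integral_add) (auto simp: nn_integral_cmult emeasure_space_1)
    qed
    also have "\<dots> \<le> ennreal (1 / \<theta>\<^sup>2) * ennreal (energy_const * T / (real k)\<^sup>2) + ennreal (\<theta> ^ 4)"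
      using T by (intro add_right_mono mult_left_mono annealed_exit_energy k) auto
    also have "\<dots> = ennreal (1 / \<theta>\<^sup>2 * (energy_const * T / (real k)\<^sup>2) + \<theta> ^ 4)"
    proof -
      have p: "ennreal (1 / \<theta>\<^sup>2) * ennreal (energy_const * T / (real k)\<^sup>2) = ennreal (1 / \<theta>\<^sup>2 * (energy_const * T / (real k)\<^sup>2))"
        using T energy_const_nonneg by (intro ennreal_mult[symmetric]) auto
      show ?thesis unfolding p using T energy_const_nonneg \<theta>(1) by (intro ennreal_plus[symmetric]) auto
    qed
    also have "\<dots> \<le> ennreal (4 * (energy_const + 1) * \<theta> ^ 4)"
    proof (rule ennreal_leI)
      have "T / (real k)\<^sup>2 \<le> 4 * \<theta> ^ 6"
      proof -
        have "(a + real k)\<^sup>2 \<le> (2 * real k)\<^sup>2" using False a by (intro power_mono) auto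
        then have "4 * a\<^sup>2 / (2 * real k)\<^sup>2 \<le> 4 * a\<^sup>2 / (a + real k)\<^sup>2"
          using k a by (intro divide_left_mono) auto
        then have "a\<^sup>2 / (real k)\<^sup>2 \<le> 4 * (a\<^sup>2 / (a + real k)\<^sup>2)"
          by (simp add: power_mult_distrib)
        also have "a\<^sup>2 / (a + real k)\<^sup>2 = (\<theta> ^ 3)\<^sup>2" unfolding \<theta>(3) by (simp add: power_divide)
        finally show ?thesis by (simp add: a(2) power_mult[symmetric])
      qed
      then have "1 / \<theta>\<^sup>2 * (energy_const * (T / (real k)\<^sup>2)) \<le> 1 / \<theta>\<^sup>2 * (energy_const * (4 * \<theta> ^ 6))"
        using energy_const_nonneg by (intro mult_left_mono) auto
      also have "\<dots> = 4 * energy_const * \<theta> ^ 4"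
        using \<theta>(1) by (simp add: field_simps power_add[symmetric])
      finally have "1 / \<theta>\<^sup>2 * (energy_const * T / (real k)\<^sup>2) + \<theta> ^ 4 \<le> 4 * energy_const * \<theta> ^ 4 + \<theta> ^ 4"
        by simp
      also have "\<dots> \<le> 4 * (energy_const + 1) * \<theta> ^ 4"
        using \<theta>(1) by (simp add: algebra_simps)
      finally show "1 / \<theta>\<^sup>2 * (energy_const * T / (real k)\<^sup>2) + \<theta> ^ 4 \<le> 4 * (energy_const + 1) * \<theta> ^ 4" .
    qed
    finally show ?thesis by (simp add: \<theta>_def a_def)
  qed
qed

text \<open>
  The limit \<open>n \<rightarrow> \<infinity>\<close>, in which the number of jumps is unrestricted.
\<close>

definition ever_exit :: "nat \<Rightarrow> real \<Rightarrow> 'd env \<Rightarrow> ennreal" where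
  "ever_exit k T \<omega> = (SUP n. ennreal (exit_prob (\<rho> \<omega>) (cube k) T n 0 0))"

lemma ever_exit_measurable [measurable]: "ever_exit k T \<in> borel_measurable P"
  unfolding ever_exit_def
  by (intro borel_measurable_SUP measurable_compose[OF _ measurable_ennreal] exit_prob_version_measurable) auto

lemma annealed_ever_exit:
  assumes T: "0 < T" and k: "1 \<le> k"
  shows "(\<integral>\<^sup>+ \<omega>. ever_exit k T \<omega> \<partial>P) \<le> ennreal (4 * (energy_const + 1) * (decay (sqrt T) (real k)) ^ 4)"
proof -
  have "(\<integral>\<^sup>+ \<omega>. ever_exit k T \<omega> \<partial>P) = (SUP n. \<integral>\<^sup>+ \<omega>. ennreal (exit_prob (\<rho> \<omega>) (cube k) T n 0 0) \<partial>P)"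
    unfolding ever_exit_def
  proof (rule nn_integral_monotone_convergence_SUP_AE)
    show "AE \<omega> in P. ennreal (exit_prob (\<rho> \<omega>) (cube k) T n 0 0) \<le> ennreal (exit_prob (\<rho> \<omega>) (cube k) T (Suc n) 0 0)" for n
      using AE_regular version
    proof eventually_elim
      case (elim \<omega>)
      then interpret regular_environment "\<rho> \<omega>" by simp
      show ?case by (intro ennreal_leI exit_prob_Suc_mono)
    qed
  qed (intro measurable_compose[OF _ measurable_ennreal] exit_prob_version_measurable)
  also have "\<dots> \<le> ennreal (4 * (energy_const + 1) * (decay (sqrt T) (real k)) ^ 4)"
    by (intro SUP_least annealed_exit_prob T k)
  finally show ?thesis .
qed

end

section \<open>Maximal displacement and tightness\<close>

text \<open>
  Whether or not some arrival is later than \<open>t\<close>, the index chosen in \<open>position\<close> belongs to an arrival that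
  is not later than \<open>t\<close>: a least index is preceded only by such arrivals, and if there is no later
  arrival, every index has this property.
\<close>

lemma position_visited:
  assumes "fst (w 0) \<le> ereal t"
  obtains n where "position t w = snd (w n)" "fst (w n) \<le> ereal t"
proof -
  let ?n = "LEAST n. ereal t < fst (w (Suc n))"
  have "fst (w ?n) \<le> ereal t"
  proof (cases ?n)
    case 0 then show ?thesis using assms by simp
  next
    case (Suc m)
    then have "\<not> ereal t < fst (w (Suc m))" by (intro not_less_Least) simp
    then show ?thesis unfolding Suc by simp
  qed
  then show ?thesis by (rule that[of ?n, rotated]) (simp add: position_def)
qed

text \<open>
  A site at distance \<open>s\<close> in the maximum norm lies outside exactly \<open>s\<close> of the cubes of radius \<open>1, 2, \<dots>\<close>.
\<close>

lemma max_displacement_le: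
  fixes w :: "'d::finite walk"
  assumes "fst (w 0) = 0"
  shows "max_displacement T w \<le> (\<Sum>k. ennreal (real CARD('d)) * indicator {w. \<exists>n. exits_within (cube (Suc k)) T n w} w)"
    (is "_ \<le> (\<Sum>k. ?f k)")
  unfolding max_displacement_def
proof (rule SUP_least)
  fix t assume t: "t \<in> {0..T}"
  then have "fst (w 0) \<le> ereal t" using assms by simp
  then obtain n where n: "position t w = snd (w n)" "fst (w n) \<le> ereal t" by (rule position_visited)
  define s where "s = nat (sup_norm (position t w))"
  have s: "sup_norm (position t w) = int s" using sup_norm_nonneg[of "position t w"] by (simp add: s_def)
  have f: "?f k = ennreal (real CARD('d))" if "k < s" for k
  proof -
    have "snd (w n) \<notin> cube (Suc k)" using s that n(1) by (simp add: cube_def)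
    moreover have "fst (w n) \<le> ereal T" using n(2) t by (meson atLeastAtMost_iff ereal_less_eq(3) order_trans)
    ultimately have "exits_within (cube (Suc k)) T n w" unfolding exits_within_def by blast
    then have "w \<in> {w. \<exists>n. exits_within (cube (Suc k)) T n w}" by blast
    then show ?thesis by simp
  qed
  have "real_of_int (graph_norm (position t w)) \<le> real CARD('d) * real s"
    using graph_norm_le_sup_norm[of "position t w"] unfolding s by (metis of_int_le_iff of_int_mult of_int_of_nat_eq)
  then have "ennreal (real_of_int (graph_norm (position t w))) \<le> ennreal (real CARD('d) * real s)"
    by (rule ennreal_leI)
  also have "\<dots> = (\<Sum>k<s. ?f k)"
    using f by (simp add: ennreal_mult ennreal_of_nat_eq_real_of_nat mult.commute)
  also have "\<dots> \<le> (\<Sum>k. ?f k)"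
    by (rule sum_le_suminf) auto
  finally show "ennreal (real_of_int (graph_norm (position t w))) \<le> (\<Sum>k. ?f k)" .
qed

context regular_environment
begin

lemma ever_exits_measurable: "{w. \<exists>n. exits_within B T n w} \<in> sets (walk_law \<omega> s x)"
proof -
  have "{w. exits_within B T n w} \<in> sets (walk_law \<omega> s x)" for n
  proof -
    have "Measurable.pred (walk_law \<omega> s x) (exits_within B T n)"
      by (rule exits_within_measurable) (rule measurable_walk_coordinate)
    then show ?thesis by (simp add: pred_def)
  qed
  then have "(\<Union>n. {w. exits_within B T n w}) \<in> sets (walk_law \<omega> s x)" by blast
  moreover have "(\<Union>n. {w. exits_within B T n w}) = {w. \<exists>n. exits_within B T n w}" by auto
  ultimately show ?thesis by simp
qed

lemma position_measurable: "{w. position t w \<in> A} \<in> sets (walk_law \<omega> s x)"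
proof -
  have fst_m: "(\<lambda>w. fst (w n)) \<in> borel_measurable (walk_law \<omega> s x)" for n
    by (rule measurable_compose[OF measurable_walk_coordinate]) (simp add: state_space_def)
  have snd_m: "(\<lambda>w. snd (w n)) \<in> walk_law \<omega> s x \<rightarrow>\<^sub>M count_space UNIV" for n
    by (rule measurable_compose[OF measurable_walk_coordinate]) (simp add: state_space_def)
  have less: "Measurable.pred (walk_law \<omega> s x) (\<lambda>w. ereal t < fst (w (Suc n)))" for n
    using fst_m[of "Suc n"] by measurable
  have least: "(\<lambda>w. LEAST n. ereal t < fst (w (Suc n))) \<in> walk_law \<omega> s x \<rightarrow>\<^sub>M count_space UNIV"
    using less by (rule measurable_Least)
  have "(\<lambda>w. snd (w (LEAST n. ereal t < fst (w (Suc n))))) \<in> walk_law \<omega> s x \<rightarrow>\<^sub>M count_space UNIV"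
    by (rule measurable_compose_countable[OF snd_m least])
  then have "(\<lambda>w. position t w) \<in> walk_law \<omega> s x \<rightarrow>\<^sub>M count_space UNIV"
    unfolding position_def .
  from measurable_sets[OF this, of A] show ?thesis by (simp add: vimage_def)
qed

lemma nn_integral_max_displacement_le:
  assumes T: "0 \<le> T"
  shows "(\<integral>\<^sup>+ w. max_displacement T w \<partial>walk_law \<omega> 0 0) \<le>
    (\<Sum>k. ennreal (real CARD('d)) * (SUP n. ennreal (exit_prob \<omega> (cube (Suc k)) T n 0 0)))"
proof -
  let ?D = "\<lambda>k. {w. \<exists>n. exits_within (cube (Suc k)) T n w} :: 'd walk set"
  have "(\<integral>\<^sup>+ w. max_displacement T w \<partial>walk_law \<omega> 0 0) \<le>
     (\<integral>\<^sup>+ w. (\<Sum>k. ennreal (real CARD('d)) * indicator (?D k) w) \<partial>walk_law \<omega> 0 0)"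
  proof (rule nn_integral_mono_AE)
    show "AE w in walk_law \<omega> 0 0. max_displacement T w \<le> (\<Sum>k. ennreal (real CARD('d)) * indicator (?D k) w)"
      using walk_start[of 0 0]
    proof eventually_elim
      case (elim w)
      then show ?case by (intro max_displacement_le) (simp add: zero_ereal_def)
    qed
  qed
  also have "\<dots> = (\<Sum>k. \<integral>\<^sup>+ w. ennreal (real CARD('d)) * indicator (?D k) w \<partial>walk_law \<omega> 0 0)"
    by (intro nn_integral_suminf borel_measurable_times_ennreal borel_measurable_const borel_measurable_indicator ever_exits_measurable)
  also have "\<dots> = (\<Sum>k. ennreal (real CARD('d)) * emeasure (walk_law \<omega> 0 0) (?D k))"
    by (intro suminf_cong nn_integral_cmult_indicator ever_exits_measurable)
  also have "\<dots> \<le> (\<Sum>k. ennreal (real CARD('d)) * (SUP n. ennreal (exit_prob \<omega> (cube (Suc k)) T n 0 0)))"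
    by (intro suminf_le mult_left_mono emeasure_walk_exit_le T) auto
  finally show ?thesis .
qed

lemma emeasure_position_outside_cube:
  assumes t: "0 \<le> t"
  shows "emeasure (walk_law \<omega> 0 0) {w. position t w \<notin> cube k} \<le> (SUP n. ennreal (exit_prob \<omega> (cube k) t n 0 0))"
proof -
  have "emeasure (walk_law \<omega> 0 0) {w. position t w \<notin> cube k} \<le> emeasure (walk_law \<omega> 0 0) {w. \<exists>n. exits_within (cube k) t n w}"
  proof (rule emeasure_mono_AE[OF _ ever_exits_measurable])
    show "AE w in walk_law \<omega> 0 0. w \<in> {w. position t w \<notin> cube k} \<longrightarrow> w \<in> {w. \<exists>n. exits_within (cube k) t n w}"
      using walk_start[of 0 0]
    proof eventually_elim
      case (elim w)
      then have "fst (w 0) \<le> ereal t" using t by simp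
      then obtain n where "position t w = snd (w n)" "fst (w n) \<le> ereal t" by (rule position_visited)
      then show ?case by (auto simp: exits_within_def)
    qed
  qed
  also have "\<dots> \<le> (SUP n. ennreal (exit_prob \<omega> (cube k) t n 0 0))"
    by (rule emeasure_walk_exit_le[OF t])
  finally show ?thesis .
qed

end

context annealed_environment
begin

lemma annealed_max_displacement_le:
  assumes T: "0 < T"
  shows "(\<integral>\<^sup>+ \<omega>. (\<integral>\<^sup>+ w. max_displacement T w \<partial>walk_law \<omega> 0 0) \<partial>P)
    \<le> ennreal (12 * real CARD('d) * (energy_const + 1) * sqrt T)"
proof -
  let ?d = "real CARD('d)" and ?c = "4 * (energy_const + 1)"
  have "(\<integral>\<^sup>+ \<omega>. (\<integral>\<^sup>+ w. max_displacement T w \<partial>walk_law \<omega> 0 0) \<partial>P) \<le>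
    (\<integral>\<^sup>+ \<omega>. (\<Sum>k. ennreal ?d * ever_exit (Suc k) T \<omega>) \<partial>P)"
  proof (rule nn_integral_mono_AE)
    show "AE \<omega> in P. (\<integral>\<^sup>+ w. max_displacement T w \<partial>walk_law \<omega> 0 0) \<le> (\<Sum>k. ennreal ?d * ever_exit (Suc k) T \<omega>)"
      using AE_regular version
    proof eventually_elim
      case (elim \<omega>)
      interpret regular_environment \<omega> by (rule elim(1))
      show ?case unfolding ever_exit_def elim(2)
        using T by (intro nn_integral_max_displacement_le) simp
    qed
  qed
  also have "\<dots> = (\<Sum>k. \<integral>\<^sup>+ \<omega>. ennreal ?d * ever_exit (Suc k) T \<omega> \<partial>P)"
    by (intro nn_integral_suminf) measurable
  also have "\<dots> = (\<Sum>k. ennreal ?d * (\<integral>\<^sup>+ \<omega>. ever_exit (Suc k) T \<omega> \<partial>P))"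
    by (intro suminf_cong nn_integral_cmult ever_exit_measurable)
  also have "\<dots> \<le> (\<Sum>k. ennreal ?d * ennreal (?c * (decay (sqrt T) (real (Suc k))) ^ 4))"
    by (intro suminf_le mult_left_mono annealed_ever_exit T) auto
  also have "\<dots> \<le> ennreal (12 * ?d * (energy_const + 1) * sqrt T)"
  proof (rule suminf_le_const)
    fix n
    have nn: "0 \<le> ?c" using energy_const_nonneg by simp
    have summand: "ennreal ?d * ennreal (?c * (decay (sqrt T) (real (Suc k))) ^ 4) = ennreal (?d * (?c * (decay (sqrt T) (real (Suc k))) ^ 4))" for k
      using nn by (intro ennreal_mult[symmetric]) auto
    have "(\<Sum>k<n. ennreal ?d * ennreal (?c * (decay (sqrt T) (real (Suc k))) ^ 4)) =
       ennreal (\<Sum>k<n. ?d * (?c * (decay (sqrt T) (real (Suc k))) ^ 4))"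
      unfolding summand using nn by (intro sum_ennreal) auto
    also have "\<dots> = ennreal (?d * ?c * (\<Sum>k<n. (decay (sqrt T) (real (Suc k))) ^ 4))"
      unfolding sum_distrib_left mult.assoc ..
    also have "\<dots> \<le> ennreal (?d * ?c * (3 * sqrt T))"
      using nn T by (intro ennreal_leI mult_left_mono sum_decay_le) auto
    also have "?d * ?c * (3 * sqrt T) = 12 * ?d * (energy_const + 1) * sqrt T" by simp
    finally show "(\<Sum>k<n. ennreal ?d * ennreal (?c * (decay (sqrt T) (real (Suc k))) ^ 4)) \<le>
      ennreal (12 * ?d * (energy_const + 1) * sqrt T)" .
  qed auto
  finally show ?thesis .
qed

text \<open>
  Stated with \<open>\<theta>\<^sup>3\<close> in place of the smaller \<open>\<theta>\<^sup>4\<close> because \<open>\<theta>\<^sup>3\<close> is rational in \<open>sqrt T\<close> and \<open>k\<close>.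
\<close>

lemma annealed_position_in_cube:
  assumes T: "0 < T" and k: "1 \<le> k"
  shows "ennreal (1 - 4 * (energy_const + 1) * (sqrt T / (sqrt T + real k))) \<le> annealed P 0 0 {w. position T w \<in> cube k}"
proof -
  let ?b = "4 * (energy_const + 1) * (sqrt T / (sqrt T + real k))"
  have b: "0 \<le> ?b" using T energy_const_nonneg by auto
  have "(\<integral>\<^sup>+ \<omega>. ever_exit k T \<omega> \<partial>P) \<le> ennreal (4 * (energy_const + 1) * (decay (sqrt T) (real k)) ^ 4)"
    by (rule annealed_ever_exit[OF T k])
  also have "\<dots> \<le> ennreal ?b"
    unfolding decay_cube[symmetric] using energy_const_nonneg decay_bounds[of "sqrt T" "real k"] T
    by (intro ennreal_leI mult_left_mono power_decreasing) auto
  finally have E: "(\<integral>\<^sup>+ \<omega>. ever_exit k T \<omega> \<partial>P) \<le> ennreal ?b" .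
  have "ennreal (1 - ?b) = 1 - ennreal ?b" using b by (simp add: ennreal_minus[symmetric])
  also have "\<dots> \<le> 1 - (\<integral>\<^sup>+ \<omega>. ever_exit k T \<omega> \<partial>P)" by (rule ennreal_minus_mono[OF order_refl E])
  also have "\<dots> \<le> (\<integral>\<^sup>+ \<omega>. 1 - ever_exit k T \<omega> \<partial>P)"
  proof -
    have "1 = (\<integral>\<^sup>+ \<omega>. 1 \<partial>P)" by (simp add: emeasure_space_1)
    also have "\<dots> \<le> (\<integral>\<^sup>+ \<omega>. (1 - ever_exit k T \<omega>) + ever_exit k T \<omega> \<partial>P)"
    proof (rule nn_integral_mono)
      fix \<omega> show "1 \<le> (1 - ever_exit k T \<omega>) + ever_exit k T \<omega>"
      proof (cases "ever_exit k T \<omega> \<le> 1")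
        case True
        then show ?thesis by (simp add: diff_add_cancel_ennreal)
      next
        case False
        then show ?thesis by (intro add_increasing) auto
      qed
    qed
    also have "\<dots> = (\<integral>\<^sup>+ \<omega>. 1 - ever_exit k T \<omega> \<partial>P) + (\<integral>\<^sup>+ \<omega>. ever_exit k T \<omega> \<partial>P)"
      by (rule nn_integral_add) measurable
    finally show ?thesis
      by (simp add: ennreal_minus_le_iff add.commute)
  qed
  also have "\<dots> \<le> annealed P 0 0 {w. position T w \<in> cube k}"
    unfolding annealed_def
  proof (rule nn_integral_mono_AE)
    show "AE \<omega> in P. 1 - ever_exit k T \<omega> \<le> emeasure (walk_law \<omega> 0 0) {w. position T w \<in> cube k}"
      using AE_regular version
    proof eventually_elim
      case (elim \<omega>)
      interpret regular_environment \<omega> by (rule elim(1))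
      interpret W: prob_space "walk_law \<omega> 0 0" by (rule prob_space_walk_law)
      let ?O = "{w. position T w \<notin> cube k} :: 'd walk set"
      have O: "?O \<in> sets (walk_law \<omega> 0 0)"
        using position_measurable[of T "- cube k" 0 0] by (simp only: Compl_iff)
      have "{w. position T w \<in> cube k} = space (walk_law \<omega> 0 0) - ?O" by auto
      then have "emeasure (walk_law \<omega> 0 0) {w. position T w \<in> cube k} = emeasure (walk_law \<omega> 0 0) (space (walk_law \<omega> 0 0) - ?O)"
        by (rule arg_cong)
      also have "\<dots> = 1 - emeasure (walk_law \<omega> 0 0) ?O"
        unfolding W.emeasure_space_1[symmetric] by (rule emeasure_compl[OF O]) simp
      also have "\<dots> \<ge> 1 - ever_exit k T \<omega>"
        unfolding ever_exit_def elim(2)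
        using T by (intro ennreal_minus_mono emeasure_position_outside_cube) auto
      finally show ?case .
    qed
  qed
  finally show ?thesis .
qed

text \<open>
  The bound depends on time and radius only through \<open>sqrt T / k\<close>, so it is the same for all \<open>n\<close> when time is
  scaled by \<open>n\<^sup>2\<close> and radius by \<open>n\<close>.
\<close>

lemma tight_rescaled:
  assumes t: "0 < t"
  shows "tight_family (annealed P 0 0) (\<lambda>n. rescaled n t) {1..}"
  unfolding tight_family_def
proof (intro allI impI)
  fix \<epsilon> :: real assume \<epsilon>: "0 < \<epsilon>"
  let ?c = "4 * (energy_const + 1)"
  (* Chosen so that ?c * (sqrt t / (sqrt t + r)) is at most epsilon. *)
  obtain r where r: "?c * sqrt t / \<epsilon> \<le> real r" "1 \<le> r"
    using real_arch_simple[of "max (?c * sqrt t / \<epsilon>) 1"] by auto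
  let ?K = "cbox (\<chi> i. - real r) (\<chi> i. real r) :: (real ^ 'd) set"
  show "\<exists>K. compact K \<and> (\<forall>n\<in>{1..}. ennreal (1 - \<epsilon>) \<le> annealed P 0 0 {w. rescaled n t w \<in> K})"
  proof (intro exI[of _ ?K] conjI ballI compact_cbox)
    fix n :: nat assume "n \<in> {1..}"
    then have n: "1 \<le> n" by simp
    let ?T = "t * (real n)\<^sup>2" and ?k = "r * n"
    have sqrtT: "sqrt ?T = sqrt t * real n" using n by (simp add: real_sqrt_mult)
    have "1 - \<epsilon> \<le> 1 - ?c * (sqrt ?T / (sqrt ?T + real ?k))"
    proof -
      have "?c * sqrt t \<le> \<epsilon> * real r" using r(1) \<epsilon> by (simp add: field_simps)
      also have "\<dots> \<le> \<epsilon> * (sqrt t + real r)" using \<epsilon> t by (intro mult_left_mono) auto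
      finally have "?c * (sqrt t / (sqrt t + real r)) \<le> \<epsilon>"
        using t r by (simp add: field_simps add_pos_nonneg)
      moreover have "sqrt ?T / (sqrt ?T + real ?k) = sqrt t / (sqrt t + real r)"
        unfolding sqrtT using n by (simp add: distrib_right[symmetric])
      ultimately show ?thesis by simp
    qed
    then have "ennreal (1 - \<epsilon>) \<le> ennreal (1 - ?c * (sqrt ?T / (sqrt ?T + real ?k)))" by (rule ennreal_leI)
    also have "\<dots> \<le> annealed P 0 0 {w. position ?T w \<in> cube ?k}"
      using t n r by (intro annealed_position_in_cube) auto
    also have "\<dots> \<le> annealed P 0 0 {w. rescaled n t w \<in> ?K}"
      unfolding annealed_def
    proof (rule nn_integral_mono_AE, rule eventually_mono[OF AE_regular])
      fix \<omega> :: "'d env" assume "regular_environment \<omega>"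
      then interpret regular_environment \<omega> .
      define A where "A = {x :: 'd site. (\<chi> i. real_of_int (x $ i) / real n) \<in> ?K}"
      have "{w. rescaled n t w \<in> ?K} = {w. position ?T w \<in> A}"
        by (simp add: rescaled_def A_def)
      then have "{w. rescaled n t w \<in> ?K} \<in> sets (walk_law \<omega> 0 0)"
        by (simp only: position_measurable)
      moreover have "rescaled n t w \<in> ?K" if "position ?T w \<in> cube ?k" for w :: "'d walk"
      proof -
        have "\<bar>real_of_int (position ?T w $ i)\<bar> \<le> real r * real n" for i
        proof -
          have "\<bar>position ?T w $ i\<bar> \<le> int ?k"
            using that abs_component_le_sup_norm[of "position ?T w" i] by (simp add: cube_def)
          then have "real_of_int \<bar>position ?T w $ i\<bar> \<le> real_of_int (int ?k)" by (simp only: of_int_le_iff)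
          then show ?thesis by simp
        qed
        then have "\<bar>rescaled n t w $ i\<bar> \<le> real r" for i
          using n by (simp add: rescaled_def abs_divide divide_le_eq)
        then have "- real r \<le> rescaled n t w $ i \<and> rescaled n t w $ i \<le> real r" for i
          using abs_le_D1 abs_le_D2 by (metis minus_le_iff)
        then show ?thesis by (simp add: mem_box_cart)
      qed
      ultimately show "emeasure (walk_law \<omega> 0 0) {w. position ?T w \<in> cube ?k} \<le> emeasure (walk_law \<omega> 0 0) {w. rescaled n t w \<in> ?K}"
        by (intro emeasure_mono) auto
    qed
    finally show "ennreal (1 - \<epsilon>) \<le> annealed P 0 0 {w. rescaled n t w \<in> ?K}" .
  qed
qed

end

theorem proposition1p4:
  fixes P :: "'d::finite env measure"
  assumes "admissible P"
  shows "(\<exists>C::real. \<forall>T>0.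
            (\<integral>\<^sup>+ \<omega>. (\<integral>\<^sup>+ w. max_displacement T w \<partial>walk_law \<omega> 0 0) \<partial>P) \<le> ennreal (C * sqrt T)) \<and>
         (\<forall>t>0. tight_family (annealed P 0 0) (\<lambda>n. rescaled n t) {1..})"
proof -
  obtain \<rho> where "\<And>e. (\<lambda>p. \<rho> (fst p) (snd p) e) \<in> borel_measurable (P \<Otimes>\<^sub>M borel)" "AE \<omega> in P. \<rho> \<omega> = \<omega>"
    using admissible_jointly_measurable_version[OF assms] by blast
  then interpret annealed_environment P \<rho> using assms by unfold_locales
  show ?thesis using annealed_max_displacement_le tight_rescaled by blast
qed

end
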